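(* Let $\mathcal V$ be a ruled quintic surface in $\mathrm{PG}(6,q)$, $q\ge 6$. (1) $\mathcal V$ contains exactly $q+1$ lines, exactly $1$ non-degenerate conic, exactly $q^2$ twisted cubics, exactly $q^4-q^2$ $4$-dim nrcs, and exactly $q^6-q^4$ $5$-dim nrcs. (2) Every $5$-space of $\mathrm{PG}(6,q)$ meets $\mathcal V$ in exactly one of the following configurations, and the number of $5$-spaces of each type is as listed: a $5$-dim nrc: $q^6-q^4$; a $4$-dim nrc and $1$ generator: $q^5+q^4-q^3-q^2$; a twisted cubic (and no generator): $(q^4-q^3)/2$; a twisted cubic and $1$ generator: $q^3+q^2$; a twisted cubic and $2$ generators: $(q^4+q^3)/2$; the conic (and no generator): $(q^3-q)/3$; the conic and $1$ generator: $q^3/2+q/2+1$; the conic and $2$ generators: $q^2+q$; the conic and $3$ generators: $(q^3-q)/6$.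
   Context: Construction: in $\mathrm{PG}(6,q)$ let $\alpha$ be a plane and $\Pi_3$ a $3$-space with $\alpha\cap\Pi_3=\emptyset$. Let $\mathcal C$ be a non-degenerate conic in $\alpha$ and $\mathcal N_3$ a twisted cubic in $\Pi_3$, parametrised as $\mathcal C=\{(1,\theta,\theta^2)\}$ and $\mathcal N_3=\{(1,\epsilon,\epsilon^2,\epsilon^3)\}$ ($\theta,\epsilon\in\mathbb F_q\cup\{\infty\}$), and let $\phi\in\mathrm{PGL}(2,q)$ act on parameters, giving a bijection $\mathcal C\to\mathcal N_3$. The ruled quintic surface $\mathcal V$ is the set of points on the $q+1$ lines (generators) joining each point of $\mathcal C$ to its image under $\phi$; $\mathcal C$ is its conic directrix ("the conic"). An $r$-dim nrc is a normal rational curve spanning an $r$-space; a twisted cubic is a $3$-dim nrc. *)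

theory Defs
  imports "HOL-Analysis.Analysis"
begin

text \<open>
  PG(n,q) is modelled on the vector space of dimension n + 1 over a finite field of q elements.
  A projective \<open>r\<close>-space is a linear subspace of vector space dimension \<open>r + 1\<close>, and a point is
  itself a subspace of dimension 1; curves and surfaces are sets of points.
\<close>

definition pg_space :: "nat \<Rightarrow> ('a::field ^ 'n) set \<Rightarrow> bool" where
  "pg_space r S \<longleftrightarrow> vec.subspace S \<and> vec.dim S = r + 1"

definition pg_points :: "('a::field ^ 'n) set \<Rightarrow> ('a ^ 'n) set set" where
  "pg_points S = {P. pg_space 0 P \<and> P \<subseteq> S}"

definition pg_join :: "('a::field ^ 'n) set \<Rightarrow> ('a ^ 'n) set \<Rightarrow> ('a ^ 'n) set" where
  "pg_join P Q = vec.span (P \<union> Q)"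

text \<open>\<open>b 0, \<dots>, b r\<close> are the base vectors of a homogeneous coordinate system of the \<open>r\<close>-space \<open>S\<close>.\<close>

definition pg_basis :: "nat \<Rightarrow> (nat \<Rightarrow> 'a::field ^ 'n) \<Rightarrow> ('a ^ 'n) set \<Rightarrow> bool" where
  "pg_basis r b S \<longleftrightarrow>
     inj_on b {..r} \<and> vec.independent (b ` {..r}) \<and> vec.span (b ` {..r}) = S"

text \<open>
  A parameter in \<open>F\<^sub>q \<union> {\<infinity>}\<close> is given by homogeneous coordinates \<open>v \<noteq> 0\<close> on PG(1,q):
  \<open>\<theta>\<close> is \<open>(1, \<theta>)\<close> and \<open>\<infinity>\<close> is \<open>(0, 1)\<close>.  In the coordinates given by \<open>b\<close> the point below is
  \<open>(1, \<theta>, \<dots>, \<theta>^r)\<close>, respectively \<open>(0, \<dots>, 0, 1)\<close>.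
\<close>

definition nrc_point :: "nat \<Rightarrow> (nat \<Rightarrow> 'a::field ^ 'n) \<Rightarrow> 'a ^ 2 \<Rightarrow> ('a ^ 'n) set" where
  "nrc_point r b v = vec.span {\<Sum>i\<le>r. (v $ 1 ^ (r - i) * v $ 2 ^ i) *s b i}"

definition nrc_points :: "nat \<Rightarrow> (nat \<Rightarrow> 'a::field ^ 'n) \<Rightarrow> ('a ^ 'n) set set" where
  "nrc_points r b = {nrc_point r b v | v. v \<noteq> 0}"

definition nrc :: "nat \<Rightarrow> ('a::field ^ 'n) set set \<Rightarrow> bool" where
  "nrc r N \<longleftrightarrow> (\<exists>S b. pg_space r S \<and> pg_basis r b S \<and> N = nrc_points r b)"

abbreviation twisted_cubic :: "('a::field ^ 'n) set set \<Rightarrow> bool" where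
  "twisted_cubic \<equiv> nrc 3"

definition quad_form :: "'a::field ^ 'n ^ 'n \<Rightarrow> 'a ^ 'n \<Rightarrow> 'a" where
  "quad_form A x = (\<Sum>i\<in>UNIV. \<Sum>j\<in>UNIV. A $ i $ j * x $ i * x $ j)"

text \<open>
  Every quadratic form on a plane \<open>\<pi>\<close> is the restriction of a form \<open>quad_form A\<close> on the whole
  space.  \<open>A\<close> is not required to be symmetric, so that characteristic 2 is covered, and
  non-degeneracy of the restriction to \<open>\<pi>\<close> is the absence of singular points: no non-zero singular
  vector of \<open>\<pi>\<close> lies in the radical of the polar form \<open>(x, z) \<mapsto> Q (x + z) - Q x - Q z\<close>.
\<close>

definition nondegenerate_conic :: "('a::field ^ 'n) set set \<Rightarrow> bool" where
  "nondegenerate_conic D \<longleftrightarrow> (\<exists>\<pi> A.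
     pg_space 2 \<pi> \<and>
     (\<forall>z\<in>\<pi>. quad_form A z = 0 \<and>
        (\<forall>x\<in>\<pi>. quad_form A (x + z) - quad_form A x - quad_form A z = 0) \<longrightarrow> z = 0) \<and>
     D = {P \<in> pg_points \<pi>. \<forall>x\<in>P. quad_form A x = 0})"

text \<open>
  \<open>V\<close> is the ruled quintic surface with conic directrix \<open>C\<close> and set of generators \<open>G\<close>.
  The element of PGL(2,q) is represented by an invertible matrix \<open>M\<close>.
\<close>

definition ruled_quintic_surface ::
    "('a::field ^ 7) set set \<Rightarrow> ('a ^ 7) set set \<Rightarrow> ('a ^ 7) set set \<Rightarrow> bool" where
  "ruled_quintic_surface V C G \<longleftrightarrow> (\<exists>\<alpha> \<beta> a b (M :: 'a ^ 2 ^ 2).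
     pg_space 2 \<alpha> \<and> pg_space 3 \<beta> \<and> pg_points \<alpha> \<inter> pg_points \<beta> = {} \<and>
     pg_basis 2 a \<alpha> \<and> pg_basis 3 b \<beta> \<and> invertible M \<and>
     C = nrc_points 2 a \<and>
     G = {pg_join (nrc_point 2 a v) (nrc_point 3 b (M *v v)) | v. v \<noteq> 0} \<and>
     V = (\<Union>l\<in>G. pg_points l))"

text \<open>
  The section of \<open>V\<close> by \<open>H\<close> consists of an \<open>r\<close>-dimensional normal rational curve and exactly
  \<open>k\<close> generators; for \<open>r = 2\<close> the curve is the conic directrix \<open>C\<close>.
\<close>

definition section_type ::
    "('a::field ^ 7) set set \<Rightarrow> ('a ^ 7) set set \<Rightarrow> ('a ^ 7) set set \<Rightarrow>
     nat \<Rightarrow> nat \<Rightarrow> ('a ^ 7) set \<Rightarrow> bool" where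
  "section_type V C G r k H \<longleftrightarrow> (\<exists>N L.
     (if r = 2 then N = C else nrc r N) \<and> L \<subseteq> G \<and> finite L \<and> card L = k \<and>
     pg_points H \<inter> V = N \<union> (\<Union>l\<in>L. pg_points l))"

end

theory Submission
  imports Defs
begin

text \<open>
  In coordinates the surface consists of the points \<open>s A(v) + t B(v)\<close>, where \<open>v\<close> runs over PG(1,q)
  and \<open>A\<close>, \<open>B\<close> parametrise the conic and the twisted cubic.  A 5-space is then a pair \<open>(f, g)\<close> of binary
  forms of degrees 2 and 3 up to scalars, with section \<open>s f(v) + t g(v) = 0\<close>: each common root of \<open>f\<close>
  and \<open>g\<close> contributes a generator, and \<open>f = m F\<close>, \<open>g = m G\<close> with \<open>F\<close>, \<open>G\<close> coprime leaves the curve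
  \<open>G(v) A(v) - F(v) B(v)\<close>, which is a normal rational curve of degree \<open>5 - deg m\<close>.  The numbers of pairs
  with a given number of common roots follow from their factorial moments.  Conversely, a normal
  rational curve of degree \<open>r \<le> 4\<close> on the surface has \<open>r + 2\<close> points on distinct generators; forms
  \<open>(F, G)\<close> of degrees \<open>r - 3\<close>, \<open>r - 2\<close> can be chosen to vanish at \<open>2 r - 4\<close> of them, and the unique linear
  relation between the points forces them to vanish at the others as well.  For \<open>r = 5\<close> the curve
  spans a 5-space, and counting points excludes every section type but the first.
\<close>

section \<open>Binary forms over a finite field\<close>

definition bform :: "nat \<Rightarrow> ('a::field ^ 2 \<Rightarrow> 'a) \<Rightarrow> bool" where
  "bform d F \<longleftrightarrow> (\<exists>c. \<forall>v. F v = (\<Sum>i\<le>d. c i * (v $ 1 ^ (d - i) * v $ 2 ^ i)))"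

definition cross2 :: "'a::field ^ 2 \<Rightarrow> 'a ^ 2 \<Rightarrow> 'a" where
  "cross2 v w = v $ 1 * w $ 2 - v $ 2 * w $ 1"

definition proj_line :: "('a::field ^ 2) set" where
  "proj_line = {v. v $ 1 = 1} \<union> {v. v $ 1 = 0 \<and> v $ 2 = 1}"

lemma bform_monom: "i \<le> d \<Longrightarrow> bform d (\<lambda>v. k * (v $ 1 ^ (d - i) * v $ 2 ^ i))"
  unfolding bform_def by (rule exI[of _ "\<lambda>j. if j = i then k else 0"]) (auto simp: sum.delta if_distrib[of "\<lambda>x. x * _"] cong: if_cong)

lemma bform_zero: "bform d (\<lambda>_. 0)"
  unfolding bform_def by (rule exI[of _ "\<lambda>_. 0"]) auto

lemma bform_add: "bform d F \<Longrightarrow> bform d G \<Longrightarrow> bform d (\<lambda>v. F v + G v)"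
  unfolding bform_def
proof (elim exE)
  fix c e assume "\<forall>v. F v = (\<Sum>i\<le>d. c i * (v $ 1 ^ (d - i) * v $ 2 ^ i))"
    "\<forall>v. G v = (\<Sum>i\<le>d. e i * (v $ 1 ^ (d - i) * v $ 2 ^ i))"
  then show "\<exists>c. \<forall>v. F v + G v = (\<Sum>i\<le>d. c i * (v $ 1 ^ (d - i) * v $ 2 ^ i))"
    by (intro exI[of _ "\<lambda>i. c i + e i"]) (simp add: sum.distrib algebra_simps)
qed

lemma bform_cmult: "bform d F \<Longrightarrow> bform d (\<lambda>v. k * F v)"
  unfolding bform_def
proof (elim exE)
  fix c assume "\<forall>v. F v = (\<Sum>i\<le>d. c i * (v $ 1 ^ (d - i) * v $ 2 ^ i))"
  then show "\<exists>c. \<forall>v. k * F v = (\<Sum>i\<le>d. c i * (v $ 1 ^ (d - i) * v $ 2 ^ i))"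
    by (intro exI[of _ "\<lambda>i. k * c i"]) (simp add: sum_distrib_left mult.assoc)
qed

lemma bform_uminus: "bform d F \<Longrightarrow> bform d (\<lambda>v. - F v)"
  using bform_cmult[of d F "-1"] by simp

lemma bform_diff: "bform d F \<Longrightarrow> bform d G \<Longrightarrow> bform d (\<lambda>v. F v - G v)"
  using bform_add[of d F "\<lambda>v. - G v"] bform_uminus by fastforce

lemma bform_sum: "(\<And>i. i \<in> I \<Longrightarrow> bform d (F i)) \<Longrightarrow> bform d (\<lambda>v. \<Sum>i\<in>I. F i v)"
  by (induction I rule: infinite_finite_induct) (auto intro: bform_zero bform_add)

lemma bform_const: "bform 0 F \<longleftrightarrow> (\<exists>k. F = (\<lambda>_. k))"
  unfolding bform_def by (auto simp: fun_eq_iff intro: exI[of _ "\<lambda>_. _"])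

lemma bform_const_fun: "bform 0 (\<lambda>_. k)"
  unfolding bform_const by blast

lemma bform_mult:
  assumes "bform d F" "bform e G"
  shows "bform (d + e) (\<lambda>v. F v * G v)"
proof -
  obtain a where a: "\<And>v. F v = (\<Sum>i\<le>d. a i * (v $ 1 ^ (d - i) * v $ 2 ^ i))"
    using assms(1) by (auto simp: bform_def)
  obtain b where b: "\<And>v. G v = (\<Sum>i\<le>e. b i * (v $ 1 ^ (e - i) * v $ 2 ^ i))"
    using assms(2) by (auto simp: bform_def)
  have "F v * G v = (\<Sum>i\<le>d. \<Sum>j\<le>e. (a i * b j) * (v $ 1 ^ (d + e - (i + j)) * v $ 2 ^ (i + j)))" for v
    unfolding a b sum_product
  proof (intro sum.cong refl)
    fix i j assume "i \<in> {..d}" "j \<in> {..e}"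
    then have "d + e - (i + j) = (d - i) + (e - j)" by auto
    then show "a i * (v $ 1 ^ (d - i) * v $ 2 ^ i) * (b j * (v $ 1 ^ (e - j) * v $ 2 ^ j)) =
       a i * b j * (v $ 1 ^ (d + e - (i + j)) * v $ 2 ^ (i + j))"
      by (simp add: power_add algebra_simps)
  qed
  moreover have "bform (d + e) (\<lambda>v. \<Sum>i\<le>d. \<Sum>j\<le>e. (a i * b j) * (v $ 1 ^ (d + e - (i + j)) * v $ 2 ^ (i + j)))"
    by (intro bform_sum bform_monom) auto
  ultimately show ?thesis by simp
qed

lemma bform_power: "bform d F \<Longrightarrow> bform (d * k) (\<lambda>v. F v ^ k)"
proof (induction k)
  case 0
  then show ?case by (simp add: bform_const_fun)
next
  case (Suc k)
  then show ?case using bform_mult[of d F "d * k"] by simp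
qed

lemma bform_coord: "bform (Suc 0) (\<lambda>v. v $ 1)" "bform (Suc 0) (\<lambda>v. v $ 2)"
  using bform_monom[of 0 1 1] bform_monom[of 1 1 1] by auto

lemma bform_linear: "bform (Suc 0) (\<lambda>v. a * v $ 1 + b * v $ 2)"
  by (intro bform_add bform_cmult bform_coord)

lemma bform_cross2: "bform (Suc 0) (cross2 v)"
  unfolding cross2_def by (intro bform_diff bform_cmult bform_coord)

lemma bform_prod:
  assumes "finite I" "\<And>i. i \<in> I \<Longrightarrow> bform (Suc 0) (F i)"
  shows "bform (card I) (\<lambda>v. \<Prod>i\<in>I. F i v)"
  using assms
proof (induction I)
  case empty
  then show ?case by (simp add: bform_const_fun)
next
  case (insert i I)
  then show ?case using bform_mult[of "Suc 0" "F i" "card I"] by simp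
qed

lemma bform_subst:
  assumes "bform d F" "bform (Suc 0) (\<lambda>v. L v $ 1)" "bform (Suc 0) (\<lambda>v. L v $ 2)"
  shows "bform d (\<lambda>v. F (L v))"
proof -
  obtain a where a: "\<And>v. F v = (\<Sum>i\<le>d. a i * (v $ 1 ^ (d - i) * v $ 2 ^ i))"
    using assms(1) by (auto simp: bform_def)
  have "bform d (\<lambda>v. L v $ 1 ^ (d - i) * L v $ 2 ^ i)" if "i \<le> d" for i
    using bform_mult[OF bform_power[OF assms(2), of "d - i"] bform_power[OF assms(3), of i]] that by simp
  then show ?thesis
    unfolding a by (intro bform_sum bform_cmult) auto
qed

lemma bform_homogeneous: "bform d F \<Longrightarrow> F (k *s v) = k ^ d * F v"
proof -
  assume "bform d F"
  then obtain a where a: "\<And>v. F v = (\<Sum>i\<le>d. a i * (v $ 1 ^ (d - i) * v $ 2 ^ i))"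
    by (auto simp: bform_def)
  show ?thesis
    unfolding a sum_distrib_left
  proof (intro sum.cong refl)
    fix i assume "i \<in> {..d}"
    then have "k ^ d = k ^ (d - i) * k ^ i" by (simp flip: power_add)
    then show "a i * ((k *s v) $ 1 ^ (d - i) * (k *s v) $ 2 ^ i) = k ^ d * (a i * (v $ 1 ^ (d - i) * v $ 2 ^ i))"
      by (simp add: power_mult_distrib algebra_simps)
  qed
qed

lemma cross2_self [simp]: "cross2 v v = 0"
  by (simp add: cross2_def)

lemma proj_line_nonzero: "v \<in> proj_line \<Longrightarrow> v \<noteq> 0"
  by (auto simp: proj_line_def)

lemma cross2_eq_0_iff:
  "v \<in> proj_line \<Longrightarrow> w \<in> proj_line \<Longrightarrow> cross2 v w = 0 \<longleftrightarrow> v = w"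
  by (auto simp: proj_line_def cross2_def vec_eq_iff forall_2)

lemma proj_line_rep:
  assumes "v \<noteq> 0"
  obtains k w where "w \<in> proj_line" "k \<noteq> 0" "v = k *s w"
proof (cases "v $ 1 = 0")
  case True
  then have "v $ 2 \<noteq> 0" using assms by (auto simp: vec_eq_iff forall_2)
  then show ?thesis using True
    by (intro that[of "vector [0, 1]" "v $ 2"]) (auto simp: proj_line_def vec_eq_iff forall_2)
next
  case False
  then show ?thesis
    by (intro that[of "vector [1, v $ 2 / v $ 1]" "v $ 1"]) (auto simp: proj_line_def vec_eq_iff forall_2)
qed

lemma card_proj_line: "card (proj_line :: ('a::{field,finite} ^ 2) set) = CARD('a) + 1"
proof -
  have 1: "{v :: 'a ^ 2. v $ 1 = 1} = range (\<lambda>t. vector [1, t])"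
  proof (intro equalityI subsetI)
    fix v :: "'a ^ 2" assume "v \<in> {v. v $ 1 = 1}"
    then have "v = vector [1, v $ 2]" by (auto simp: vec_eq_iff forall_2)
    then show "v \<in> range (\<lambda>t. vector [1, t])" by blast
  qed auto
  have "inj (\<lambda>t::'a. vector [1, t] :: 'a ^ 2)"
    by (rule injI) (metis vector_2(2))
  then have "card {v :: 'a ^ 2. v $ 1 = 1} = CARD('a)"
    unfolding 1 by (rule card_image)
  moreover have "{v :: 'a ^ 2. v $ 1 = 0 \<and> v $ 2 = 1} = {vector [0, 1]}"
    by (auto simp: vec_eq_iff forall_2)
  moreover have "vector [0, 1] \<notin> {v :: 'a ^ 2. v $ 1 = 1}" by simp
  ultimately show ?thesis
    unfolding proj_line_def by simp
qed

text \<open>Expanding \<open>F\<close> in the coordinates \<open>cross2 v w\<close> and a complementary one leaves only terms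
  divisible by \<open>cross2 v w\<close> when \<open>F v = 0\<close>.\<close>

lemma bform_factor:
  assumes F: "bform (Suc d) F" and v: "v \<noteq> 0" "F v = 0"
  obtains G where "bform d G" "\<And>w. F w = cross2 v w * G w"
proof -
  obtain z :: "'a ^ 2" where z: "cross2 v z = 1"
  proof (cases "v $ 1 = 0")
    case True
    then have "v $ 2 \<noteq> 0" using v by (auto simp: vec_eq_iff forall_2)
    then show ?thesis using True by (intro that[of "vector [- 1 / v $ 2, 0]"]) (simp add: cross2_def)
  next
    case False
    then show ?thesis by (intro that[of "vector [0, 1 / v $ 1]"]) (simp add: cross2_def)
  qed
  define E where "E = (\<lambda>p :: 'a ^ 2. F (p $ 1 *s v + p $ 2 *s z))"
  have "bform (Suc d) E"
    unfolding E_def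
    using bform_subst[OF F, of "\<lambda>p. p $ 1 *s v + p $ 2 *s z"]
      bform_linear[of "v $ 1" "z $ 1"] bform_linear[of "v $ 2" "z $ 2"]
    by (simp add: mult.commute)
  then obtain a where a: "\<And>p. E p = (\<Sum>i\<le>Suc d. a i * (p $ 1 ^ (Suc d - i) * p $ 2 ^ i))"
    by (auto simp: bform_def)
  have "E (vector [1, 0]) = 0"
    using v by (simp add: E_def)
  then have a0: "a 0 = 0"
    unfolding a by (simp add: sum.atMost_shift)
  define L where "L = (\<lambda>w. vector [cross2 w z, cross2 v w] :: 'a ^ 2)"
  have L: "F w = E (L w)" for w
  proof -
    have e: "v $ 1 * z $ 2 - v $ 2 * z $ 1 = 1" using z by (simp add: cross2_def)
    have "w = cross2 w z *s v + cross2 v w *s z"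
      using e by (simp add: vec_eq_iff forall_2 cross2_def) algebra
    then show ?thesis by (simp add: E_def L_def)
  qed
  define G where "G = (\<lambda>w. \<Sum>i\<le>d. a (Suc i) * (L w $ 1 ^ (d - i) * L w $ 2 ^ i))"
  have "F w = cross2 v w * G w" for w
    unfolding L a G_def sum_distrib_left
    by (subst sum.atMost_Suc_shift) (simp add: a0 L_def algebra_simps)
  moreover have "bform d G"
  proof -
    have "bform (Suc 0) (\<lambda>w. L w $ 1)"
      using bform_uminus[OF bform_cross2[of z]] by (simp add: L_def cross2_def algebra_simps)
    moreover have "bform (Suc 0) (\<lambda>w. L w $ 2)"
      using bform_cross2[of v] by (simp add: L_def)
    moreover have "bform d (\<lambda>p. \<Sum>i\<le>d. a (Suc i) * (p $ 1 ^ (d - i) * p $ 2 ^ i))"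
      unfolding bform_def by (rule exI[of _ "\<lambda>i. a (Suc i)"]) simp
    ultimately show ?thesis
      unfolding G_def by (rule bform_subst[rotated])
  qed
  ultimately show ?thesis using that by blast
qed

lemma bform_eq_0:
  assumes "bform d F" "K \<subseteq> proj_line" "d < card K" "\<And>v. v \<in> K \<Longrightarrow> F v = 0"
  shows "F v = 0"
  using assms
proof (induction d arbitrary: F K v)
  case 0
  then have "K \<noteq> {}" by auto
  with 0 show ?case by (auto simp: bform_const)
next
  case (Suc d)
  then have "K \<noteq> {}" by auto
  then obtain w where w: "w \<in> K" by blast
  obtain G where G: "bform d G" "\<And>u. F u = cross2 w u * G u"
    using bform_factor[OF Suc.prems(1), of w] w Suc.prems proj_line_nonzero by blast
  have "G u = 0" for u
  proof (rule Suc.IH[OF G(1)])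
    show "K - {w} \<subseteq> proj_line" using Suc.prems by auto
    show "d < card (K - {w})"
      using Suc.prems w by simp
    show "G u = 0" if "u \<in> K - {w}" for u
      using Suc.prems(4)[of u] that G(2)[of u] cross2_eq_0_iff[of w u] w Suc.prems(2) by auto
  qed
  then show ?case using G by simp
qed

lemma bform_ext:
  assumes "bform d F" "bform d G" "K \<subseteq> proj_line" "d < card K" "\<And>v. v \<in> K \<Longrightarrow> F v = G v"
  shows "F = G"
proof
  fix v
  have "F v - G v = 0"
    by (rule bform_eq_0[OF bform_diff[OF assms(1,2)] assms(3,4)]) (simp add: assms(5))
  then show "F v = G v" by simp
qed

lemma bform_mult_eq_0:
  fixes F G :: "'a::{field,finite} ^ 2 \<Rightarrow> 'a"
  assumes "bform d F" "bform e G" "d + e \<le> CARD('a)" "\<And>v. F v * G v = 0"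
  shows "F = (\<lambda>_. 0) \<or> G = (\<lambda>_. 0)"
proof (rule ccontr)
  assume "\<not> ?thesis"
  then obtain a b where ab: "F a \<noteq> 0" "G b \<noteq> 0" by (auto simp: fun_eq_iff)
  let ?Z = "{v \<in> proj_line. F v = 0}" and ?Y = "{v \<in> proj_line. G v = 0}"
  have "card ?Z \<le> d"
  proof (rule ccontr)
    assume "\<not> card ?Z \<le> d"
    then have "F a = 0" using bform_eq_0[OF assms(1), of ?Z a] by fastforce
    then show False using ab by simp
  qed
  moreover have "card ?Y \<le> e"
  proof (rule ccontr)
    assume "\<not> card ?Y \<le> e"
    then have "G b = 0" using bform_eq_0[OF assms(2), of ?Y b] by fastforce
    then show False using ab by simp
  qed
  moreover have "?Z \<union> ?Y = proj_line" using assms(4) by auto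
  ultimately show False
    using card_Un_le[of ?Z ?Y] assms(3) card_proj_line[where 'a='a] by simp
qed

lemma bform_mult_cancel:
  fixes F G H :: "'a::{field,finite} ^ 2 \<Rightarrow> 'a"
  assumes "bform d F" "bform e G" "bform e H" "d + e \<le> CARD('a)" "F \<noteq> (\<lambda>_. 0)"
    "\<And>v. F v * G v = F v * H v"
  shows "G = H"
proof -
  have "F v * (G v - H v) = 0" for v
    using assms(6)[of v] by (simp add: right_diff_distrib)
  then have "(\<lambda>v. G v - H v) = (\<lambda>_. 0)"
    using bform_mult_eq_0[OF assms(1) bform_diff[OF assms(2,3)] assms(4)] assms(5) by blast
  then show ?thesis by (simp add: fun_eq_iff)
qed

lemma bform_1_root:
  assumes "bform (Suc 0) F"
  obtains v where "v \<in> proj_line" "F v = 0"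
proof -
  obtain c where c: "\<And>v. F v = (\<Sum>i\<le>Suc 0. c i * (v $ 1 ^ (Suc 0 - i) * v $ 2 ^ i))"
    using assms by (auto simp: bform_def)
  show ?thesis
  proof (cases "c 1 = 0")
    case True
    then show ?thesis
      using c by (intro that[of "vector [0, 1]"]) (auto simp: proj_line_def)
  next
    case False
    then show ?thesis
      using c by (intro that[of "vector [1, - c 0 / c 1]"]) (auto simp: proj_line_def)
  qed
qed

lemma bform_1_eq:
  assumes "bform (Suc 0) F" "v \<noteq> 0" "F v = 0"
  obtains k where "\<And>w. F w = k * cross2 v w"
proof -
  obtain G where G: "bform 0 G" "\<And>w. F w = cross2 v w * G w"
    using bform_factor[OF assms] by blast
  then show ?thesis using that by (auto simp: bform_const mult.commute)
qed

lemma bform_prod_cross2: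
  assumes "finite K" shows "bform (card K) (\<lambda>w. \<Prod>v\<in>K. cross2 v w)"
  by (intro bform_prod assms bform_cross2)

lemma prod_cross2_eq_0_iff:
  assumes "finite K" "K \<subseteq> proj_line" "w \<in> proj_line"
  shows "(\<Prod>v\<in>K. cross2 v w) = 0 \<longleftrightarrow> w \<in> K"
  using assms cross2_eq_0_iff by (force simp: prod_zero_iff)

lemma finite_bform: "finite {F :: 'a::{field,finite} ^ 2 \<Rightarrow> 'a. bform d F}"
  by simp

lemma card_bform_vanishing:
  fixes K :: "('a::{field,finite} ^ 2) set"
  assumes "K \<subseteq> proj_line" "card K \<le> d + 1" "d \<le> CARD('a)"
  shows "card {F. bform d F \<and> (\<forall>v\<in>K. F v = 0)} = CARD('a) ^ (d + 1 - card K)"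
  using assms
proof (induction d arbitrary: K)
  case 0
  show ?case
  proof (cases "K = {}")
    case True
    have "{F :: 'a ^ 2 \<Rightarrow> 'a. bform 0 F} = range (\<lambda>k _. k)" by (auto simp: bform_const)
    moreover have "inj (\<lambda>k (_ :: 'a ^ 2). k :: 'a)" by (auto simp: inj_def fun_eq_iff)
    ultimately show ?thesis using True by (simp add: card_image)
  next
    case False
    then have "{F :: 'a ^ 2 \<Rightarrow> 'a. bform 0 F \<and> (\<forall>v\<in>K. F v = 0)} = {\<lambda>_. 0}"
      by (auto simp: bform_const)
    moreover have "card K = 1" using 0 False by (simp add: card_gt_0_iff le_Suc_eq)
    ultimately show ?thesis by simp
  qed
next
  case (Suc d)
  have inj: "inj_on (\<lambda>G w. cross2 v w * G w) {G. bform d G}" if "v \<noteq> 0" for v :: "'a ^ 2"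
  proof (rule inj_onI)
    fix G H :: "'a ^ 2 \<Rightarrow> 'a"
    assume *: "G \<in> {G. bform d G}" "H \<in> {G. bform d G}"
      "(\<lambda>w. cross2 v w * G w) = (\<lambda>w. cross2 v w * H w)"
    have "cross2 v \<noteq> (\<lambda>_. 0)"
    proof
      assume "cross2 v = (\<lambda>_. 0)"
      then have "cross2 v (vector [1, 0]) = 0" "cross2 v (vector [0, 1]) = 0" by auto
      then show False using that by (auto simp: cross2_def vec_eq_iff forall_2)
    qed
    then show "G = H"
      using bform_mult_cancel[OF bform_cross2, of d G H v] * Suc.prems(3) by (auto simp: fun_eq_iff)
  qed
  show ?case
  proof (cases "K = {}")
    case True
    define z :: "'a ^ 2" where "z = vector [0, 1]"
    have z: "z \<in> proj_line" "z \<noteq> 0" by (auto simp: z_def proj_line_def vec_eq_iff forall_2)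
    define \<Phi> where "\<Phi> = (\<lambda>(k :: 'a, G :: 'a ^ 2 \<Rightarrow> 'a) w. k * w $ 2 ^ Suc d + cross2 z w * G w)"
    have "inj_on \<Phi> (UNIV \<times> {G. bform d G})"
    proof (rule inj_onI, clarsimp)
      fix k l :: 'a and G H :: "'a ^ 2 \<Rightarrow> 'a"
      assume *: "bform d G" "bform d H" "\<Phi> (k, G) = \<Phi> (l, H)"
      from fun_cong[OF *(3), of z] have "k = l" by (simp add: \<Phi>_def z_def)
      with *(3) have "(\<lambda>w. cross2 z w * G w) = (\<lambda>w. cross2 z w * H w)"
        by (auto simp: \<Phi>_def fun_eq_iff)
      then have "G = H" using inj[OF z(2)] * by (auto dest: inj_onD)
      with \<open>k = l\<close> show "k = l \<and> G = H" by simp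
    qed
    moreover have "\<Phi> ` (UNIV \<times> {G. bform d G}) = {F. bform (Suc d) F}"
    proof (intro equalityI subsetI)
      fix F assume "F \<in> \<Phi> ` (UNIV \<times> {G. bform d G})"
      then obtain k G where F: "bform d G" "F = (\<lambda>w. k * w $ 2 ^ Suc d + cross2 z w * G w)"
        by (auto simp: \<Phi>_def)
      have "bform (Suc d) (\<lambda>w. k * (w $ 1 ^ (Suc d - Suc d) * w $ 2 ^ Suc d))"
        by (rule bform_monom) simp
      then show "F \<in> {F. bform (Suc d) F}"
        unfolding F(2) mem_Collect_eq
        using bform_mult[OF bform_cross2[of z] F(1)] by (intro bform_add) auto
    next
      fix F :: "'a ^ 2 \<Rightarrow> 'a" assume "F \<in> {F. bform (Suc d) F}"
      then have F: "bform (Suc d) F" by simp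
      have "bform (Suc d) (\<lambda>w. F z * (w $ 1 ^ (Suc d - Suc d) * w $ 2 ^ Suc d))"
        by (rule bform_monom) simp
      then have "bform (Suc d) (\<lambda>w. F w - F z * w $ 2 ^ Suc d)"
        using bform_diff[OF F] by simp
      then obtain G where G: "bform d G" "\<And>w. F w - F z * w $ 2 ^ Suc d = cross2 z w * G w"
        using bform_factor[of d "\<lambda>w. F w - F z * w $ 2 ^ Suc d" z] z by (auto simp: z_def)
      have "F w = F z * w $ 2 ^ Suc d + cross2 z w * G w" for w
        by (simp flip: G(2))
      then have "F = \<Phi> (F z, G)"
        unfolding \<Phi>_def case_prod_conv by (rule ext)
      then show "F \<in> \<Phi> ` (UNIV \<times> {G. bform d G})"
        using G by blast
    qed
    ultimately have "card {F :: 'a ^ 2 \<Rightarrow> 'a. bform (Suc d) F} = CARD('a) * card {G :: 'a ^ 2 \<Rightarrow> 'a. bform d G}"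
      by (metis card_image card_cartesian_product)
    then show ?thesis
      using Suc.IH[of "{}"] True Suc.prems by simp
  next
    case False
    then obtain v where v: "v \<in> K" by blast
    define K' where "K' = K - {v}"
    have K: "K = insert v K'" "v \<notin> K'" "K' \<subseteq> proj_line" "v \<in> proj_line" "card K = Suc (card K')"
      using v Suc.prems card.remove[OF finite v] unfolding K'_def by blast+
    have v0: "v \<noteq> 0" using K proj_line_nonzero by blast
    have "{F. bform (Suc d) F \<and> (\<forall>v\<in>K. F v = 0)} =
      (\<lambda>G w. cross2 v w * G w) ` {G. bform d G \<and> (\<forall>v\<in>K'. G v = 0)}"
    proof (intro equalityI subsetI)
      fix F assume "F \<in> {F. bform (Suc d) F \<and> (\<forall>v\<in>K. F v = 0)}"
      then have F: "bform (Suc d) F" "\<forall>v\<in>K. F v = 0" by auto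
      then obtain G where G: "bform d G" "\<And>w. F w = cross2 v w * G w"
        using bform_factor[OF F(1) v0] v by blast
      have "G w = 0" if "w \<in> K'" for w
        using F(2) G(2)[of w] that K cross2_eq_0_iff[of v w] by auto
      moreover have "F = (\<lambda>w. cross2 v w * G w)" using G(2) by auto
      ultimately show "F \<in> (\<lambda>G w. cross2 v w * G w) ` {G. bform d G \<and> (\<forall>v\<in>K'. G v = 0)}"
        using G(1) by blast
    next
      fix F assume "F \<in> (\<lambda>G w. cross2 v w * G w) ` {G. bform d G \<and> (\<forall>v\<in>K'. G v = 0)}"
      then show "F \<in> {F. bform (Suc d) F \<and> (\<forall>v\<in>K. F v = 0)}"
        using K bform_mult[OF bform_cross2[of v]] by auto
    qed
    moreover have "inj_on (\<lambda>G w. cross2 v w * G w) {G. bform d G \<and> (\<forall>v\<in>K'. G v = 0)}"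
      by (rule inj_on_subset[OF inj[OF v0]]) auto
    ultimately have "card {F. bform (Suc d) F \<and> (\<forall>v\<in>K. F v = 0)} = card {G. bform d G \<and> (\<forall>v\<in>K'. G v = 0)}"
      by (simp add: card_image)
    then show ?thesis
      using Suc.IH[of K'] K Suc.prems by simp
  qed
qed

lemma proj_line_other:
  obtains z where "z \<in> proj_line" "z \<noteq> (v :: 'a::field ^ 2)"
proof (cases "v = vector [0, 1]")
  case True
  then show ?thesis
    by (intro that[of "vector [1, 0]"]) (auto simp: proj_line_def vec_eq_iff forall_2)
next
  case False
  then show ?thesis by (intro that[of "vector [0, 1]"]) (auto simp: proj_line_def)
qed

lemma cross2_nonzero:
  fixes w :: "'a::field ^ 2"
  assumes "w \<in> proj_line"
  shows "cross2 w \<noteq> (\<lambda>_. 0)"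
proof -
  obtain z :: "'a ^ 2" where "z \<in> proj_line" "z \<noteq> w" by (rule proj_line_other)
  then show ?thesis using cross2_eq_0_iff[OF assms] by metis
qed

lemma card_bform:
  assumes "d \<le> CARD('a::{field,finite})"
  shows "card {F :: 'a ^ 2 \<Rightarrow> 'a. bform d F} = CARD('a) ^ (d + 1)"
  using card_bform_vanishing[of "{} :: ('a ^ 2) set" d] assms by simp

lemma bform_separate:
  fixes K :: "('a::{field,finite} ^ 2) set"
  assumes "v \<in> proj_line" "K \<subseteq> proj_line" "v \<notin> K" "card K \<le> d"
  obtains F where "bform d F" "F v \<noteq> 0" "\<And>w. w \<in> K \<Longrightarrow> F w = 0"
proof -
  obtain y where y: "y \<in> proj_line" "y \<noteq> v" by (rule proj_line_other)
  define F where "F = (\<lambda>w. (\<Prod>u\<in>K. cross2 u w) * cross2 y w ^ (d - card K))"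
  have "bform (card K + Suc 0 * (d - card K)) F"
    unfolding F_def by (intro bform_mult bform_prod_cross2 bform_power bform_cross2) simp
  moreover have "F w = 0" if "w \<in> K" for w
    unfolding F_def using that by (auto intro!: prod_zero bexI[of _ w])
  moreover have "F v \<noteq> 0"
    unfolding F_def using assms y cross2_eq_0_iff[of y v] prod_cross2_eq_0_iff[of K v] by auto
  ultimately show ?thesis using that assms(4) by simp
qed

section \<open>Annihilators and hyperplanes\<close>

definition dotp :: "'a::field ^ 'n \<Rightarrow> 'a ^ 'n \<Rightarrow> 'a" where
  "dotp u x = (\<Sum>i\<in>UNIV. u $ i * x $ i)"

definition annih :: "('a::field ^ 'n) set \<Rightarrow> ('a ^ 'n) set" where
  "annih X = {u. \<forall>x\<in>X. dotp u x = 0}"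

definition hplane :: "'a::field ^ 'n \<Rightarrow> ('a ^ 'n) set" where
  "hplane u = {x. dotp u x = 0}"

lemma dotp_simps [simp]:
  "dotp u (x + y) = dotp u x + dotp u y"
  "dotp u (x - y) = dotp u x - dotp u y"
  "dotp u (- x) = - dotp u x"
  "dotp u (k *s x) = k * dotp u x"
  "dotp u 0 = 0"
  "dotp (u + w) x = dotp u x + dotp w x"
  "dotp (u - w) x = dotp u x - dotp w x"
  "dotp (k *s u) x = k * dotp u x"
  "dotp 0 x = 0"
  by (simp_all add: dotp_def sum.distrib sum_subtractf sum_negf sum_distrib_left algebra_simps)

lemma dotp_sum: "dotp u (\<Sum>i\<in>I. f i) = (\<Sum>i\<in>I. dotp u (f i))"
  by (induction I rule: infinite_finite_induct) auto

lemma subspace_hplane: "vec.subspace (hplane u)"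
  by (simp add: vec.subspace_def hplane_def)

lemma annih_span: "annih (vec.span X) = annih X"
proof (intro equalityI subsetI)
  fix u assume "u \<in> annih X"
  then have "X \<subseteq> hplane u" by (auto simp: annih_def hplane_def)
  then have "vec.span X \<subseteq> hplane u"
    by (rule vec.span_minimal) (rule subspace_hplane)
  then show "u \<in> annih (vec.span X)" by (auto simp: annih_def hplane_def)
qed (auto simp: annih_def vec.span_base)

lemma dotp_eq_0_all: "(\<And>x. dotp u x = 0) \<Longrightarrow> u = 0"
proof -
  assume a: "\<And>x. dotp u x = 0"
  have "u $ i = 0" for i
    using a[of "axis i 1"] by (simp add: dotp_def axis_def if_distrib[of "\<lambda>x. _ * x"] cong: if_cong)
  then show ?thesis by (simp add: vec_eq_iff)
qed

lemma dotp_interpolate: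
  fixes S :: "('a::field ^ 'n) set"
  assumes "vec.independent S"
  obtains u where "\<And>w. w \<in> S \<Longrightarrow> dotp u w = \<phi> w"
proof -
  obtain g :: "'a ^ 'n \<Rightarrow> 'a ^ 1" where g: "Vector_Spaces.linear (*s) (*s) g"
    "\<forall>w\<in>S. g w = (\<chi> _. \<phi> w)"
    using vec.linear_independent_extend[OF assms, of "\<lambda>w. (\<chi> _. \<phi> w)"] by blast
  have "dotp (matrix g $ 1) w = \<phi> w" if "w \<in> S" for w
  proof -
    have "dotp (matrix g $ 1) w = (matrix g *v w) $ 1"
      by (simp add: dotp_def matrix_vector_mult_def)
    also have "\<dots> = g w $ 1" by (simp add: matrix_works[OF g(1)])
    finally show ?thesis using g(2) that by simp
  qed
  then show ?thesis using that by blast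
qed

text \<open>The evaluation map \<open>u \<mapsto> (dotp u w)\<close>, \<open>w \<in> S\<close>, is surjective with the annihilator as kernel.\<close>

lemma card_annih_independent:
  fixes S :: "('a::{field,finite} ^ 'n) set"
  assumes S: "vec.independent S"
  shows "card (annih S) * CARD('a) ^ card S = CARD('a) ^ CARD('n)"
proof -
  define T where "T = (\<lambda>u. restrict (dotp u) S)"
  let ?R = "S \<rightarrow>\<^sub>E (UNIV :: 'a set)"
  have fib: "card {u \<in> UNIV. T u = \<phi>} = card (annih S)" if "\<phi> \<in> ?R" for \<phi>
  proof -
    obtain u0 where u0: "\<And>w. w \<in> S \<Longrightarrow> dotp u0 w = \<phi> w"
      using dotp_interpolate[OF S] by metis
    have "{u \<in> UNIV. T u = \<phi>} = (\<lambda>u. u0 + u) ` annih S"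
    proof (intro equalityI subsetI)
      fix u assume "u \<in> {u \<in> UNIV. T u = \<phi>}"
      then have "dotp u w = \<phi> w" if "w \<in> S" for w
        using that by (auto simp: T_def restrict_apply' fun_eq_iff dest: spec[of _ w])
      then have "u - u0 \<in> annih S" using u0 by (auto simp: annih_def)
      moreover have "u = u0 + (u - u0)" by simp
      ultimately show "u \<in> (\<lambda>u. u0 + u) ` annih S" by blast
    next
      fix u assume "u \<in> (\<lambda>u. u0 + u) ` annih S"
      then have "T u w = \<phi> w" for w
        using u0 that by (auto simp: T_def annih_def PiE_def extensional_def)
      then show "u \<in> {u \<in> UNIV. T u = \<phi>}" by auto
    qed
    then show ?thesis by (simp add: card_image)
  qed
  have "CARD('a ^ 'n) = (\<Sum>u\<in>(UNIV :: ('a ^ 'n) set). 1)" by simp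
  also have "\<dots> = (\<Sum>\<phi>\<in>?R. \<Sum>u\<in>{u \<in> UNIV. T u = \<phi>}. 1)"
    by (rule sum.group[symmetric]) (auto simp: T_def intro: finite_PiE)
  also have "\<dots> = (\<Sum>\<phi>\<in>?R. card (annih S))"
    using fib by (intro sum.cong) auto
  also have "\<dots> = card (annih S) * CARD('a) ^ card S"
    by (simp add: card_funcsetE)
  finally show ?thesis by simp
qed

lemma card_annih:
  fixes X :: "('a::{field,finite} ^ 'n) set"
  shows "card (annih X) * CARD('a) ^ vec.dim X = CARD('a) ^ CARD('n)"
proof -
  obtain S where S: "S \<subseteq> X" "vec.independent S" "X \<subseteq> vec.span S" "card S = vec.dim X"
    using vec.basis_exists by blast
  have "vec.span X = vec.span S"
    using S by (metis vec.span_mono vec.span_span subset_antisym)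
  then have "annih X = annih S" by (metis annih_span)
  then show ?thesis using card_annih_independent[OF S(2)] S(4) by simp
qed

lemma CARD_field_ge_2: "CARD('a::{field,finite}) \<ge> 2"
  using card_mono[of UNIV "{0, 1 :: 'a}"] by simp

lemma dim_ge_of_annih:
  fixes X :: "('a::{field,finite} ^ 'n) set"
  assumes "card (annih X) * CARD('a) ^ m \<le> CARD('a) ^ CARD('n)"
  shows "m \<le> vec.dim X"
proof -
  have "card (annih X) * CARD('a) ^ m \<le> card (annih X) * CARD('a) ^ vec.dim X"
    using assms card_annih[of X] by simp
  moreover have "card (annih X) > 0"
    using card_annih[of X] by (cases "card (annih X)") auto
  ultimately have "CARD('a) ^ m \<le> CARD('a) ^ vec.dim X" by simp
  then show ?thesis
    using CARD_field_ge_2[where 'a='a] by (simp add: power_increasing_iff)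
qed

lemma dim_hplane:
  fixes u :: "'a::field ^ 'n"
  assumes "u \<noteq> 0"
  shows "vec.dim (hplane u) + 1 = CARD('n)"
proof -
  obtain w where w: "dotp u w \<noteq> 0" using assms dotp_eq_0_all by blast
  then have "w \<notin> vec.span (hplane u)"
    using subspace_hplane[of u] by (simp add: vec.span_eq_iff[THEN iffD2] hplane_def)
  then have "vec.dim (insert w (hplane u)) = vec.dim (hplane u) + 1"
    by (simp add: vec.dim_insert)
  moreover have "vec.span (insert w (hplane u)) = UNIV"
  proof -
    have "x \<in> vec.span (insert w (hplane u))" for x
    proof -
      define k where "k = dotp u x / dotp u w"
      have "x - k *s w \<in> hplane u" using w by (simp add: hplane_def k_def)
      then have "(x - k *s w) + k *s w \<in> vec.span (insert w (hplane u))"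
        by (intro vec.span_add vec.span_scale) (auto intro: vec.span_base)
      then show ?thesis by simp
    qed
    then show ?thesis by blast
  qed
  then have "vec.dim (insert w (hplane u)) = CARD('n)"
    by (metis vec.dim_span vec_dim_card)
  ultimately show ?thesis by simp
qed

lemma hyperplane_eq_hplane:
  fixes H :: "('a::{field,finite} ^ 'n) set"
  assumes "vec.subspace H" "vec.dim H + 1 = CARD('n)"
  obtains u where "u \<noteq> 0" "H = hplane u"
proof -
  have "card (annih H) * CARD('a) ^ vec.dim H = CARD('a) * CARD('a) ^ vec.dim H"
    using card_annih[of H] by (simp flip: assms(2))
  then have "card (annih H) = CARD('a)" by simp
  then have "card (annih H) \<noteq> card {0 :: 'a ^ 'n}"
    using CARD_field_ge_2[where 'a='a] by simp
  then have "annih H \<noteq> {0}" by metis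
  moreover have "0 \<in> annih H" by (simp add: annih_def)
  ultimately obtain u where u: "u \<in> annih H" "u \<noteq> 0" by blast
  then have "H \<subseteq> hplane u" by (auto simp: annih_def hplane_def)
  moreover have "vec.dim (hplane u) \<le> vec.dim H" using dim_hplane[OF u(2)] assms by simp
  ultimately have "H = hplane u"
    using vec.subspace_dim_equal[OF assms(1) subspace_hplane] by blast
  then show ?thesis using that u by blast
qed

lemma hplane_scale: "k \<noteq> 0 \<Longrightarrow> hplane (k *s u) = hplane u"
  by (auto simp: hplane_def)

lemma hplane_eq_iff:
  fixes u w :: "'a::{field,finite} ^ 'n"
  assumes "u \<noteq> 0" "w \<noteq> 0"
  shows "hplane u = hplane w \<longleftrightarrow> (\<exists>k. k \<noteq> 0 \<and> w = k *s u)"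
proof
  assume eq: "hplane u = hplane w"
  have "card (annih (hplane u)) * CARD('a) ^ vec.dim (hplane u) = CARD('a) * CARD('a) ^ vec.dim (hplane u)"
    using card_annih[of "hplane u"] by (simp flip: dim_hplane[OF assms(1)])
  then have c: "card (annih (hplane u)) = CARD('a)" by simp
  have sub: "range (\<lambda>k. k *s u) \<subseteq> annih (hplane u)"
    by (auto simp: annih_def hplane_def)
  have "inj (\<lambda>k. k *s u)"
    using assms(1) by (auto simp: inj_def)
  then have "card (range (\<lambda>k. k *s u)) = CARD('a)" by (rule card_image)
  then have "range (\<lambda>k. k *s u) = annih (hplane u)"
    using sub c by (intro card_subset_eq) auto
  moreover have "w \<in> annih (hplane u)" unfolding eq by (auto simp: annih_def hplane_def)
  ultimately obtain k where "w = k *s u" by auto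
  then show "\<exists>k. k \<noteq> 0 \<and> w = k *s u" using assms by (intro exI[of _ k]) auto
qed (use hplane_scale in auto)

lemma card_hplanes:
  fixes P :: "('a::{field,finite} ^ 'n) set \<Rightarrow> bool"
  shows "card {H. vec.subspace H \<and> vec.dim H + 1 = CARD('n) \<and> P H} * (CARD('a) - 1) =
    card {u. u \<noteq> 0 \<and> P (hplane u)}"
proof -
  let ?A = "{u. u \<noteq> 0 \<and> P (hplane u)}"
  let ?B = "{H. vec.subspace H \<and> vec.dim H + 1 = CARD('n) \<and> P H}"
  have fib: "card {u \<in> ?A. hplane u = H} = CARD('a) - 1" if H: "H \<in> ?B" for H
  proof -
    obtain u where u: "u \<noteq> 0" "H = hplane u"
      by (rule hyperplane_eq_hplane[of H]) (use H in auto)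
    have "{w \<in> ?A. hplane w = H} = (\<lambda>k. k *s u) ` (UNIV - {0})"
    proof (intro equalityI subsetI)
      fix w assume "w \<in> {w \<in> ?A. hplane w = H}"
      then have "w \<noteq> 0" "hplane u = hplane w" using u by auto
      then obtain k where "k \<noteq> 0" "w = k *s u" using hplane_eq_iff[OF u(1), of w] by blast
      then show "w \<in> (\<lambda>k. k *s u) ` (UNIV - {0})" by blast
    next
      fix w assume "w \<in> (\<lambda>k. k *s u) ` (UNIV - {0})"
      then obtain k where "k \<noteq> 0" "w = k *s u" by blast
      then show "w \<in> {w \<in> ?A. hplane w = H}" using u that hplane_scale[of k u] by simp
    qed
    moreover have "inj_on (\<lambda>k. k *s u) (UNIV - {0})"
      using u(1) by (auto simp: inj_on_def)
    ultimately show ?thesis by (simp add: card_image card_Diff_singleton)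
  qed
  have "card ?A = (\<Sum>u\<in>?A. 1)" by simp
  also have "\<dots> = (\<Sum>H\<in>?B. \<Sum>u\<in>{u \<in> ?A. hplane u = H}. 1)"
  proof (rule sum.group[symmetric])
    show "hplane ` ?A \<subseteq> ?B"
      using subspace_hplane dim_hplane by blast
  qed auto
  also have "\<dots> = (\<Sum>H\<in>?B. CARD('a) - 1)"
    using fib by (intro sum.cong) auto
  finally show ?thesis by simp
qed

section \<open>Points and normal rational curves\<close>

lemma span_singleton_eq_iff:
  fixes x y :: "'a::field ^ 'n"
  assumes "x \<noteq> 0"
  shows "vec.span {x} = vec.span {y} \<longleftrightarrow> (\<exists>k. k \<noteq> 0 \<and> y = k *s x)"
proof
  assume eq: "vec.span {x} = vec.span {y}"
  have "y \<in> vec.span {x}" unfolding eq by (simp add: vec.span_base)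
  then obtain k where k: "y = k *s x" by (auto simp: vec.span_singleton)
  have "x \<in> vec.span {y}" unfolding eq[symmetric] by (simp add: vec.span_base)
  then have "k \<noteq> 0" using k assms by (auto simp: vec.span_singleton)
  then show "\<exists>k. k \<noteq> 0 \<and> y = k *s x" using k by blast
next
  assume "\<exists>k. k \<noteq> 0 \<and> y = k *s x"
  then obtain k where k: "k \<noteq> 0" "y = k *s x" by blast
  then have "x = (1 / k) *s y" by simp
  then have "x \<in> vec.span {y}" by (metis vec.span_base vec.span_scale singletonI)
  moreover have "y \<in> vec.span {x}" unfolding k(2) by (intro vec.span_scale vec.span_base) simp
  ultimately show "vec.span {x} = vec.span {y}" by (simp add: vec.span_eq)
qed

lemma span_singleton_scale: "k \<noteq> 0 \<Longrightarrow> vec.span {k *s x} = vec.span {x :: 'a::field ^ 'n}"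
  using span_singleton_eq_iff[of x "k *s x"] by (cases "x = 0") auto

lemma pg_pointE:
  assumes "pg_space 0 P"
  obtains x where "x \<noteq> 0" "P = vec.span {x}"
proof -
  have P: "vec.subspace P" "vec.dim P = 1" using assms by (auto simp: pg_space_def)
  then have "\<not> P \<subseteq> {0}" by (metis vec.dim_eq_0 zero_neq_one)
  then obtain x where x: "x \<in> P" "x \<noteq> 0" by blast
  have "vec.span {x} \<subseteq> P" using x P by (intro vec.span_minimal) auto
  moreover have "vec.dim (vec.span {x}) = 1" using x by simp
  ultimately have "vec.span {x} = P"
    using P by (intro vec.subspace_dim_equal) auto
  then show ?thesis using that x by blast
qed

lemma pg_space_0_span: "pg_space 0 (vec.span {x}) \<longleftrightarrow> x \<noteq> 0"
  by (auto simp: pg_space_def)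

lemma span_in_pg_points:
  "vec.subspace X \<Longrightarrow> vec.span {x} \<in> pg_points X \<longleftrightarrow> x \<noteq> 0 \<and> x \<in> X"
  using vec.span_minimal[of "{x}" X] vec.span_base[of x "{x}"]
  by (auto simp: pg_points_def pg_space_0_span)

lemma pg_points_eq: "vec.subspace X \<Longrightarrow> pg_points X = (\<lambda>x. vec.span {x}) ` (X - {0})"
proof (intro equalityI subsetI)
  fix P assume X: "vec.subspace X" "P \<in> pg_points X"
  then obtain x where "x \<noteq> 0" "P = vec.span {x}" using pg_pointE by (auto simp: pg_points_def)
  then show "P \<in> (\<lambda>x. vec.span {x}) ` (X - {0})" using X span_in_pg_points by blast
qed (auto simp: span_in_pg_points)

definition vform :: "nat \<Rightarrow> ('a::field ^ 2 \<Rightarrow> 'a ^ 'n) \<Rightarrow> bool" where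
  "vform r n \<longleftrightarrow> (\<forall>k. bform r (\<lambda>v. n v $ k))"

lemma vform_sum: "vform r (\<lambda>v. \<Sum>i\<le>r. (v $ 1 ^ (r - i) * v $ 2 ^ i) *s b i)"
  unfolding vform_def
proof
  fix k
  have "bform r (\<lambda>v. \<Sum>i\<le>r. b i $ k * (v $ 1 ^ (r - i) * v $ 2 ^ i))"
    by (intro bform_sum bform_monom) simp
  then show "bform r (\<lambda>v. (\<Sum>i\<le>r. (v $ 1 ^ (r - i) * v $ 2 ^ i) *s b i) $ k)"
    by (simp add: mult.commute)
qed

lemma vform_coeffs:
  assumes "vform r n"
  obtains b where "\<And>v. n v = (\<Sum>i\<le>r. (v $ 1 ^ (r - i) * v $ 2 ^ i) *s b i)"
proof -
  have "\<forall>k. \<exists>c. \<forall>v. n v $ k = (\<Sum>i\<le>r. c i * (v $ 1 ^ (r - i) * v $ 2 ^ i))"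
    using assms by (simp add: vform_def bform_def)
  then obtain c where c: "\<And>k v. n v $ k = (\<Sum>i\<le>r. c k i * (v $ 1 ^ (r - i) * v $ 2 ^ i))"
    by metis
  show ?thesis
    by (rule that[of "\<lambda>i. \<chi> k. c k i"]) (simp add: vec_eq_iff c mult.commute)
qed

lemma vform_homogeneous: "vform r n \<Longrightarrow> n (k *s v) = k ^ r *s n v"
  using bform_homogeneous[of r "\<lambda>v. n v $ i" k v for i] by (simp add: vform_def vec_eq_iff)

lemma vform_dotp: "vform r n \<Longrightarrow> bform r (\<lambda>v. dotp u (n v))"
  unfolding vform_def dotp_def by (intro bform_sum bform_cmult) auto

lemma vform_diff: "vform r n \<Longrightarrow> vform r m \<Longrightarrow> vform r (\<lambda>v. n v - m v)"
  by (simp add: vform_def bform_diff)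

lemma vform_mult: "bform d F \<Longrightarrow> vform r n \<Longrightarrow> vform (d + r) (\<lambda>v. F v *s n v)"
  by (simp add: vform_def bform_mult)

abbreviation points_of :: "('a::field ^ 2 \<Rightarrow> 'a ^ 'n) \<Rightarrow> ('a ^ 'n) set set" where
  "points_of n \<equiv> (\<lambda>v. vec.span {n v}) ` proj_line"

lemma nrc_points_vform:
  assumes "\<And>v. n v = (\<Sum>i\<le>r. (v $ 1 ^ (r - i) * v $ 2 ^ i) *s b i)"
  shows "nrc_points r b = points_of n"
proof -
  have vf: "vform r n" using vform_sum[of r b] by (simp flip: assms)
  have "nrc_points r b = {vec.span {n v} | v. v \<noteq> 0}"
    by (simp add: nrc_points_def nrc_point_def assms)
  also have "\<dots> = points_of n"
  proof (intro equalityI subsetI)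
    fix P assume "P \<in> {vec.span {n v} | v. v \<noteq> 0}"
    then obtain v where v: "v \<noteq> 0" "P = vec.span {n v}" by blast
    obtain k w where w: "w \<in> proj_line" "k \<noteq> 0" "v = k *s w" by (rule proj_line_rep[OF v(1)])
    have "P = vec.span {n w}"
      unfolding v(2) w(3) vform_homogeneous[OF vf] by (rule span_singleton_scale) (simp add: w)
    then show "P \<in> points_of n" using w by blast
  qed (use proj_line_nonzero in blast)
  finally show ?thesis .
qed

lemma nrcI:
  fixes n :: "'a::{field,finite} ^ 2 \<Rightarrow> 'a ^ 'n"
  assumes vf: "vform r n"
    and ann: "card (annih (range n)) * CARD('a) ^ (r + 1) \<le> CARD('a) ^ CARD('n)"
  shows "nrc r (points_of n)"
proof -
  obtain b where b: "\<And>v. n v = (\<Sum>i\<le>r. (v $ 1 ^ (r - i) * v $ 2 ^ i) *s b i)"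
    using vform_coeffs[OF vf] by blast
  define S where "S = vec.span (b ` {..r})"
  have "range n \<subseteq> S"
    unfolding S_def b by (auto intro!: vec.span_sum vec.span_scale intro: vec.span_base)
  then have "annih S \<subseteq> annih (range n)" by (auto simp: annih_def)
  then have "card (annih S) * CARD('a) ^ (r + 1) \<le> CARD('a) ^ CARD('n)"
    by (meson ann card_mono finite le_trans mult_le_mono1)
  then have dim: "r + 1 \<le> vec.dim S" by (rule dim_ge_of_annih)
  moreover have "vec.dim S \<le> card (b ` {..r})"
    unfolding S_def vec.dim_span by (rule vec.dim_le_card) (auto intro: vec.span_base)
  moreover have "card (b ` {..r}) \<le> r + 1"
    using card_image_le[of "{..r}" b] by simp
  ultimately have c: "card (b ` {..r}) = r + 1" "vec.dim S = r + 1" by auto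
  then have "inj_on b {..r}" by (intro eq_card_imp_inj_on) auto
  moreover have "vec.independent (b ` {..r})"
    by (rule vec.card_le_dim_spanning[of _ S]) (use c in \<open>auto simp: S_def intro: vec.span_base\<close>)
  ultimately have "pg_basis r b S" by (simp add: pg_basis_def S_def)
  moreover have "pg_space r S" using c by (simp add: pg_space_def S_def)
  ultimately show ?thesis
    unfolding nrc_def
    by (intro exI[of _ S] exI[of _ b] conjI nrc_points_vform[symmetric] b)
qed

definition nrc_par :: "nat \<Rightarrow> ('a::field ^ 2 \<Rightarrow> 'a ^ 'n) \<Rightarrow> ('a ^ 'n) set \<Rightarrow> bool" where
  "nrc_par r n S \<longleftrightarrow> vec.subspace S \<and> vec.dim S = r + 1 \<and> (\<forall>v. n v \<in> S) \<and>
     (\<forall>K c. K \<subseteq> proj_line \<longrightarrow> card K \<le> r + 1 \<longrightarrow> (\<Sum>v\<in>K. c v *s n v) = 0 \<longrightarrow> (\<forall>v\<in>K. c v = 0))"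

lemma independent_family_coeff_0:
  assumes "vec.independent (b ` I)" "inj_on b I" "finite I" "(\<Sum>i\<in>I. c i *s b i) = 0" "i \<in> I"
  shows "c i = 0"
proof -
  let ?c = "\<lambda>x. c (inv_into I b x)"
  have "(\<Sum>x\<in>b ` I. ?c x *s x) = (\<Sum>i\<in>I. c i *s b i)"
    using assms by (simp add: sum.reindex)
  then have "?c (b i) = 0"
    using assms vec.independentD[of "b ` I" "b ` I" ?c "b i"] by auto
  then show ?thesis using assms by simp
qed

lemma nrc_par_basis:
  fixes b :: "nat \<Rightarrow> 'a::{field,finite} ^ 'n"
  assumes S: "pg_space r S" "pg_basis r b S"
    and n_def: "n = (\<lambda>v. \<Sum>i\<le>r. (v $ 1 ^ (r - i) * v $ 2 ^ i) *s b i)"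
  shows "nrc_par r n S"
proof -
  have b: "vec.independent (b ` {..r})" "inj_on b {..r}" "vec.span (b ` {..r}) = S"
    using S(2) by (auto simp: pg_basis_def)
  have nS: "n v \<in> S" for v
    unfolding n_def b(3)[symmetric] by (auto intro!: vec.span_sum vec.span_scale intro: vec.span_base)
  have "c v = 0" if K: "K \<subseteq> proj_line" "card K \<le> r + 1" "(\<Sum>v\<in>K. c v *s n v) = 0" "v \<in> K" for K c v
  proof -
    have "(\<Sum>i\<le>r. (\<Sum>v\<in>K. c v * (v $ 1 ^ (r - i) * v $ 2 ^ i)) *s b i) = (\<Sum>v\<in>K. c v *s n v)"
      unfolding n_def vec.scale_sum_left vec.scale_sum_right
      by (subst sum.swap) (simp add: mult.assoc)
    then have z: "(\<Sum>v\<in>K. c v * (v $ 1 ^ (r - i) * v $ 2 ^ i)) = 0" if "i \<le> r" for i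
      using independent_family_coeff_0[OF b(1,2), of "\<lambda>i. \<Sum>v\<in>K. c v * (v $ 1 ^ (r - i) * v $ 2 ^ i)" i] that K(3)
      by simp
    have F0: "(\<Sum>v\<in>K. c v * F v) = 0" if F: "bform r F" for F
    proof -
      obtain a where a: "\<And>v. F v = (\<Sum>i\<le>r. a i * (v $ 1 ^ (r - i) * v $ 2 ^ i))"
        using F by (auto simp: bform_def)
      have "(\<Sum>v\<in>K. c v * F v) = (\<Sum>i\<le>r. a i * (\<Sum>v\<in>K. c v * (v $ 1 ^ (r - i) * v $ 2 ^ i)))"
        unfolding a sum_distrib_left by (subst sum.swap) (simp add: ac_simps)
      then show ?thesis using z by simp
    qed
    have "card (K - {v}) \<le> r" using K by (simp add: card_Diff_singleton)
    then obtain F where F: "bform r F" "F v \<noteq> 0" "\<And>w. w \<in> K - {v} \<Longrightarrow> F w = 0"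
      using bform_separate[of v "K - {v}" r] K by blast
    have "(\<Sum>w\<in>K. c w * F w) = c v * F v + (\<Sum>w\<in>K - {v}. c w * F w)"
      using K(4) by (intro sum.remove) auto
    then have "c v * F v = 0" using F0[OF F(1)] F(3) by simp
    then show ?thesis using F(2) by simp
  qed
  then show "nrc_par r n S"
    using S(1) nS by (auto simp: nrc_par_def pg_space_def)
qed

lemma nrcE:
  fixes N :: "('a::{field,finite} ^ 'n) set set"
  assumes "nrc r N"
  obtains n S where "nrc_par r n S" "N = points_of n"
proof -
  obtain S b where S: "pg_space r S" "pg_basis r b S" "N = nrc_points r b"
    using assms by (auto simp: nrc_def)
  define n where "n = (\<lambda>v :: 'a ^ 2. \<Sum>i\<le>r. (v $ 1 ^ (r - i) * v $ 2 ^ i) *s b i)"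
  have "N = points_of n"
    unfolding S(3) by (rule nrc_points_vform) (simp add: n_def)
  then show ?thesis using that nrc_par_basis[OF S(1,2) n_def] by blast
qed

context
  fixes r :: nat and n :: "'a::{field,finite} ^ 2 \<Rightarrow> 'a ^ 'n" and S
  assumes np: "nrc_par r n S"
begin

lemma nrc_par_indep:
  assumes "K \<subseteq> proj_line" "card K \<le> r + 1" "(\<Sum>v\<in>K. c v *s n v) = 0" "v \<in> K"
  shows "c v = 0"
  using np assms unfolding nrc_par_def by blast

lemma nrc_par_S: "vec.subspace S" "vec.dim S = r + 1" "n v \<in> S"
  using np by (auto simp: nrc_par_def)

lemma nrc_par_nonzero: "v \<in> proj_line \<Longrightarrow> n v \<noteq> 0"
  using nrc_par_indep[of "{v}" "\<lambda>_. 1" v] by auto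

lemma nrc_par_independent:
  assumes K: "K \<subseteq> proj_line" "card K \<le> r + 1"
  shows "inj_on n K" "vec.independent (n ` K)"
proof -
  show inj: "inj_on n K"
  proof (rule inj_onI)
    fix v w assume vw: "v \<in> K" "w \<in> K" "n v = n w"
    show "v = w"
    proof (rule ccontr)
      assume "v \<noteq> w"
      define c where "c = (\<lambda>x. if x = v then 1 else if x = w then - 1 else 0 :: 'a)"
      have "(\<Sum>x\<in>K. c x *s n x) = (\<Sum>x\<in>{v, w}. c x *s n x)"
        using vw by (intro sum.mono_neutral_right) (auto simp: c_def)
      also have "\<dots> = 0" using vw \<open>v \<noteq> w\<close> by (simp add: c_def)
      finally have "c v = 0" using nrc_par_indep[OF K] vw by blast
      then show False by (simp add: c_def)
    qed
  qed
  show "vec.independent (n ` K)"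
  proof (rule ccontr)
    assume "\<not> ?thesis"
    then obtain u where u: "\<exists>x\<in>n ` K. u x \<noteq> 0" "(\<Sum>x\<in>n ` K. u x *s x) = 0"
      using vec.dependent_finite[of "n ` K"] by auto
    then have "(\<Sum>v\<in>K. u (n v) *s n v) = 0" using inj by (simp add: sum.reindex)
    then show False using u(1) nrc_par_indep[OF K, of "\<lambda>v. u (n v)"] by auto
  qed
qed

lemma nrc_par_card_le_dim:
  assumes "K \<subseteq> proj_line" "card K \<le> r + 1" "n ` K \<subseteq> X"
  shows "card K \<le> vec.dim X"
  using vec.independent_card_le_dim[OF assms(3)] nrc_par_independent[OF assms(1,2)]
  by (simp add: card_image)

lemma nrc_par_inter:
  assumes "K \<subseteq> proj_line" "n ` K \<subseteq> X" "vec.dim X \<le> r"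
  shows "card K \<le> vec.dim X"
proof (rule ccontr)
  assume "\<not> ?thesis"
  then obtain K' where K': "K' \<subseteq> K" "card K' = vec.dim X + 1"
    using obtain_subset_with_card_n[of "vec.dim X + 1" K] by auto
  then have "card K' \<le> vec.dim X"
    using assms by (intro nrc_par_card_le_dim) auto
  then show False using K' by simp
qed

lemma nrc_par_span:
  assumes "K \<subseteq> proj_line" "card K = r + 1" "n ` K \<subseteq> X" "vec.subspace X"
  shows "S \<subseteq> X"
proof -
  have "S \<subseteq> vec.span (n ` K)"
    by (rule vec.card_ge_dim_independent)
      (use nrc_par_independent[of K] nrc_par_S assms in \<open>auto simp: card_image\<close>)
  also have "\<dots> \<subseteq> X" using assms by (intro vec.span_minimal) auto
  finally show ?thesis .
qed

lemma nrc_par_dependency: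
  assumes K: "K \<subseteq> proj_line" "card K = r + 2"
  obtains c where "(\<Sum>v\<in>K. c v *s n v) = 0" "\<And>v. v \<in> K \<Longrightarrow> c v \<noteq> 0"
proof -
  obtain v0 where v0: "v0 \<in> K" using K by fastforce
  let ?K = "K - {v0}"
  have cK: "card ?K = r + 1" "?K \<subseteq> proj_line" using K v0 by (auto simp: card_Diff_singleton)
  have "S \<subseteq> vec.span (n ` ?K)"
    by (rule nrc_par_span[OF cK(2,1)]) (auto intro: vec.span_base)
  then have "n v0 \<in> vec.span (n ` ?K)" using nrc_par_S by blast
  then obtain u where u: "n v0 = (\<Sum>x\<in>n ` ?K. u x *s x)"
    by (auto simp: vec.span_finite)
  have inj: "inj_on n ?K" using nrc_par_independent cK by simp
  define c where "c = (\<lambda>v. if v = v0 then - 1 else u (n v))"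
  have "(\<Sum>v\<in>K. c v *s n v) = c v0 *s n v0 + (\<Sum>v\<in>?K. c v *s n v)"
    using v0 by (intro sum.remove) auto
  also have "(\<Sum>v\<in>?K. c v *s n v) = (\<Sum>v\<in>?K. u (n v) *s n v)"
    by (intro sum.cong) (auto simp: c_def)
  also have "\<dots> = n v0" unfolding u using inj by (simp add: sum.reindex)
  finally have sum0: "(\<Sum>v\<in>K. c v *s n v) = 0" by (simp add: c_def)
  have "c v \<noteq> 0" if v: "v \<in> K" for v
  proof
    assume "c v = 0"
    then have "v \<noteq> v0" by (auto simp: c_def)
    have "(\<Sum>v\<in>K - {v}. c v *s n v) = 0"
      using sum0 v \<open>c v = 0\<close> sum.remove[of K v "\<lambda>v. c v *s n v"] by simp
    then have "c v0 = 0"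
      using nrc_par_indep[of "K - {v}" c v0] K v v0 \<open>v \<noteq> v0\<close> by (auto simp: card_Diff_singleton)
    then show False by (simp add: c_def)
  qed
  then show ?thesis using that sum0 by blast
qed

lemma nrc_par_inj:
  assumes "r \<ge> 1"
  shows "inj_on (\<lambda>v. vec.span {n v}) proj_line"
proof (rule inj_onI, rule ccontr)
  fix v w assume vw: "v \<in> proj_line" "w \<in> proj_line" "vec.span {n v} = vec.span {n w}" "v \<noteq> w"
  then have "n ` {v, w} \<subseteq> vec.span {n w}"
    using vec.span_base[of "n v" "{n v}"] by (auto intro: vec.span_base)
  moreover have "vec.dim (vec.span {n w}) = 1"
    using nrc_par_nonzero[OF vw(2)] by simp
  ultimately have "card {v, w} \<le> 1"
    using nrc_par_inter[of "{v, w}" "vec.span {n w}"] vw assms by auto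
  then show False using vw by simp
qed

end

section \<open>Hyperplane sections of the scroll\<close>

locale scroll =
  fixes A B :: "'a::{field,finite} ^ 2 \<Rightarrow> 'a ^ 7"
  assumes vform_A: "vform 2 A" and vform_B: "vform 3 B"
    and full: "\<And>u. (\<And>v. dotp u (A v) = 0) \<Longrightarrow> (\<And>v. dotp u (B v) = 0) \<Longrightarrow> u = 0"
    and q_ge_7: "CARD('a) \<ge> 7"
begin

text \<open>A vector \<open>u\<close> is a hyperplane; \<open>qf u\<close> and \<open>cf u\<close> are the binary forms it induces on the
  two directrices.\<close>

definition qf :: "'a ^ 7 \<Rightarrow> 'a ^ 2 \<Rightarrow> 'a" where "qf u = (\<lambda>v. dotp u (A v))"
definition cf :: "'a ^ 7 \<Rightarrow> 'a ^ 2 \<Rightarrow> 'a" where "cf u = (\<lambda>v. dotp u (B v))"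
definition gen :: "'a ^ 2 \<Rightarrow> ('a ^ 7) set" where "gen v = vec.span {A v, B v}"
definition gens :: "('a ^ 7) set set" where "gens = gen ` proj_line"
definition surf :: "('a ^ 7) set set" where "surf = (\<Union>l\<in>gens. pg_points l)"
definition conic :: "('a ^ 7) set set" where "conic = (\<lambda>v. vec.span {A v}) ` proj_line"
definition roots :: "'a ^ 7 \<Rightarrow> ('a ^ 2) set" where "roots u = {v \<in> proj_line. qf u v = 0 \<and> cf u v = 0}"
definition nvec :: "('a ^ 2 \<Rightarrow> 'a) \<Rightarrow> ('a ^ 2 \<Rightarrow> 'a) \<Rightarrow> 'a ^ 2 \<Rightarrow> 'a ^ 7" where
  "nvec F G v = G v *s A v - F v *s B v"
definition curve :: "('a ^ 2 \<Rightarrow> 'a) \<Rightarrow> ('a ^ 2 \<Rightarrow> 'a) \<Rightarrow> ('a ^ 7) set set" where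
  "curve F G = (\<lambda>v. vec.span {nvec F G v}) ` proj_line"

lemma bform_qf: "bform 2 (qf u)" and bform_cf: "bform 3 (cf u)"
  using vform_dotp[OF vform_A] vform_dotp[OF vform_B] by (simp_all add: qf_def cf_def)

lemma bform_qf': "bform (Suc (Suc 0)) (qf u)" and bform_cf': "bform (Suc (Suc (Suc 0))) (cf u)"
  using bform_qf[of u] bform_cf[of u] by (simp_all only: numeral_2_eq_2 numeral_3_eq_3)

lemma qf_cf_inj: "qf u = qf w \<Longrightarrow> cf u = cf w \<Longrightarrow> u = w"
proof -
  assume "qf u = qf w" "cf u = cf w"
  then have "dotp (u - w) (A v) = 0" "dotp (u - w) (B v) = 0" for v
    by (simp_all add: qf_def cf_def fun_eq_iff)
  then have "u - w = 0" by (rule full)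
  then show ?thesis by simp
qed

lemma qf_cf_bij: "bij_betw (\<lambda>u. (qf u, cf u)) UNIV ({F. bform 2 F} \<times> {G. bform 3 G})"
proof -
  have inj: "inj (\<lambda>u. (qf u, cf u))"
    by (rule injI) (simp add: qf_cf_inj)
  have "card {F :: 'a ^ 2 \<Rightarrow> 'a. bform 2 F} = CARD('a) ^ 3" "card {F :: 'a ^ 2 \<Rightarrow> 'a. bform 3 F} = CARD('a) ^ 4"
    using card_bform[where 'a='a and d = 2] card_bform[where 'a='a and d = 3] q_ge_7 by simp_all
  then have "card ({F. bform 2 F} \<times> {G. bform 3 G} :: (('a ^ 2 \<Rightarrow> 'a) \<times> ('a ^ 2 \<Rightarrow> 'a)) set) = CARD('a ^ 7)"
    by (simp add: card_cartesian_product flip: power_add)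
  moreover have "card (range (\<lambda>u. (qf u, cf u))) = CARD('a ^ 7)"
    by (rule card_image[OF inj])
  moreover have "range (\<lambda>u. (qf u, cf u)) \<subseteq> {F. bform 2 F} \<times> {G. bform 3 G}"
    using bform_qf bform_cf by auto
  ultimately have "range (\<lambda>u. (qf u, cf u)) = {F. bform 2 F} \<times> {G. bform 3 G}"
    by (intro card_subset_eq) auto
  then show ?thesis using inj by (simp add: bij_betw_def)
qed

lemma ex_hyperplane:
  assumes "bform 2 F" "bform 3 G"
  obtains u where "qf u = F" "cf u = G"
proof -
  have "(F, G) \<in> range (\<lambda>u. (qf u, cf u))"
    unfolding bij_betw_imp_surj_on[OF qf_cf_bij] using assms by simp
  then show ?thesis using that by blast
qed

lemma dotp_gen: "dotp u (s *s A v + t *s B v) = s * qf u v + t * cf u v"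
  by (simp add: qf_def cf_def)

lemma relation_forms:
  assumes "(\<Sum>v\<in>K. s v *s A v + t v *s B v) = 0" "bform 2 F" "bform 3 G"
  shows "(\<Sum>v\<in>K. s v * F v + t v * G v) = 0"
proof -
  obtain u where u: "qf u = F" "cf u = G" using ex_hyperplane assms(2,3) by blast
  have "dotp u (\<Sum>v\<in>K. s v *s A v + t v *s B v) = (\<Sum>v\<in>K. s v * F v + t v * G v)"
    unfolding dotp_sum by (simp only: dotp_gen u)
  then show ?thesis using assms(1) by simp
qed

lemma relation_trivial:
  assumes K: "K \<subseteq> proj_line" "card K \<le> 3" and "(\<Sum>v\<in>K. s v *s A v + t v *s B v) = 0" "v \<in> K"
  shows "s v = 0" "t v = 0"
proof -
  have c: "card (K - {v}) \<le> 2" using assms by (simp add: card_Diff_singleton)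
  obtain F where F: "bform 2 F" "F v \<noteq> 0" "\<And>w. w \<in> K - {v} \<Longrightarrow> F w = 0"
    by (rule bform_separate[of v "K - {v}" 2]) (use K c assms(4) in auto)
  obtain G where G: "bform 3 G" "G v \<noteq> 0" "\<And>w. w \<in> K - {v} \<Longrightarrow> G w = 0"
    by (rule bform_separate[of v "K - {v}" 3]) (use K c assms(4) in auto)
  have "(\<Sum>v\<in>K. s v * F v + t v * 0) = 0"
    using relation_forms[OF assms(3) F(1) bform_zero] by simp
  then have "s v * F v = 0"
    using F(3) sum.remove[of K v "\<lambda>v. s v * F v"] assms(4) by simp
  then show "s v = 0" using F(2) by simp
  have "(\<Sum>v\<in>K. s v * 0 + t v * G v) = 0"
    using relation_forms[OF assms(3) bform_zero G(1)] by simp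
  then have "t v * G v = 0"
    using G(3) sum.remove[of K v "\<lambda>v. t v * G v"] assms(4) by simp
  then show "t v = 0" using G(2) by simp
qed

lemma gen_coeffs_0:
  assumes "v \<in> proj_line" "s *s A v + t *s B v = 0"
  shows "s = 0" "t = 0"
  using relation_trivial[of "{v}" "\<lambda>_. s" "\<lambda>_. t" v] assms by auto

lemma gen_unique:
  assumes "v \<in> proj_line" "w \<in> proj_line" "s *s A v + t *s B v = s' *s A w + t' *s B w"
    "s *s A v + t *s B v \<noteq> 0"
  shows "v = w"
proof (rule ccontr)
  assume "v \<noteq> w"
  then have "(\<Sum>x\<in>{v, w}. (if x = v then s else - s') *s A x + (if x = v then t else - t') *s B x) = 0"
    using assms(3) by (simp add: algebra_simps)
  from relation_trivial[OF _ _ this, of v] assms \<open>v \<noteq> w\<close> show False by (auto simp: card_insert_if)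
qed

lemma mem_gen: "x \<in> gen v \<longleftrightarrow> (\<exists>s t. x = s *s A v + t *s B v)"
proof -
  have "x \<in> gen v \<longleftrightarrow> (\<exists>s t. x - s *s A v = t *s B v)"
    by (auto simp: gen_def vec.span_insert vec.span_singleton)
  also have "\<dots> \<longleftrightarrow> (\<exists>s t. x = s *s A v + t *s B v)"
    by (simp add: diff_eq_eq add.commute)
  finally show ?thesis .
qed

lemma subspace_gen: "vec.subspace (gen v)"
  by (simp add: gen_def)

lemma dim_gen_le: "vec.dim (gen v) \<le> 2"
proof -
  have "vec.dim (gen v) \<le> card {A v, B v}"
    unfolding gen_def vec.dim_span by (rule vec.dim_le_card) (auto intro: vec.span_base)
  also have "\<dots> \<le> 2" by (simp add: card_insert_if)
  finally show ?thesis .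
qed

lemma gen_disjoint:
  assumes "v \<in> proj_line" "w \<in> proj_line" "x \<in> gen v" "x \<in> gen w" "x \<noteq> 0"
  shows "v = w"
  using assms gen_unique unfolding mem_gen by blast

lemma span_in_gen: "vec.span {x} \<in> pg_points (gen v) \<longleftrightarrow> x \<noteq> 0 \<and> x \<in> gen v"
  by (rule span_in_pg_points[OF subspace_gen])

lemma A_in_gen: "A v \<in> gen v" and B_in_gen: "B v \<in> gen v" and nvec_in_gen: "nvec F G v \<in> gen v"
proof -
  show "A v \<in> gen v" "B v \<in> gen v" by (auto simp: gen_def intro: vec.span_base)
  then show "nvec F G v \<in> gen v"
    unfolding nvec_def by (intro vec.subspace_diff vec.subspace_scale subspace_gen)
qed

lemma A_nonzero: "v \<in> proj_line \<Longrightarrow> A v \<noteq> 0" and B_nonzero: "v \<in> proj_line \<Longrightarrow> B v \<noteq> 0"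
  using gen_coeffs_0[of v 1 0] gen_coeffs_0[of v 0 1] by auto

lemma nvec_eq_0: "v \<in> proj_line \<Longrightarrow> nvec F G v = 0 \<longleftrightarrow> F v = 0 \<and> G v = 0"
  using gen_coeffs_0[of v "G v" "- F v"] by (auto simp: nvec_def)

lemma inj_gen: "inj_on gen proj_line"
  using gen_disjoint A_in_gen A_nonzero by (intro inj_onI) metis

lemma surf_eq: "surf = (\<Union>v\<in>proj_line. pg_points (gen v))"
  by (simp add: surf_def gens_def)

lemma surfE:
  assumes "P \<in> surf"
  obtains v s t where "v \<in> proj_line" "s *s A v + t *s B v \<noteq> 0" "P = vec.span {s *s A v + t *s B v}"
proof -
  obtain v where v: "v \<in> proj_line" "P \<in> pg_points (gen v)" using assms by (auto simp: surf_eq)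
  then obtain x where "x \<noteq> 0" "x \<in> gen v" "P = vec.span {x}"
    using pg_points_eq[OF subspace_gen] by auto
  then show ?thesis using that v mem_gen by metis
qed

lemma span_in_surf: "vec.span {x} \<in> surf \<longleftrightarrow> x \<noteq> 0 \<and> (\<exists>v\<in>proj_line. x \<in> gen v)"
  by (auto simp: surf_eq span_in_gen)

lemma span_in_hplane: "vec.span {x} \<in> pg_points (hplane u) \<longleftrightarrow> x \<noteq> 0 \<and> dotp u x = 0"
  unfolding span_in_pg_points[OF subspace_hplane] by (simp add: hplane_def)

lemma gen_subset_hplane: "gen v \<subseteq> hplane u \<longleftrightarrow> qf u v = 0 \<and> cf u v = 0"
proof
  assume "gen v \<subseteq> hplane u"
  then have "A v \<in> hplane u" "B v \<in> hplane u" using A_in_gen B_in_gen by blast+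
  then show "qf u v = 0 \<and> cf u v = 0" by (simp add: hplane_def qf_def cf_def)
qed (auto simp: mem_gen hplane_def qf_def cf_def)

lemma curve_point:
  assumes "s * F v + t * G v = 0" "F v \<noteq> 0 \<or> G v \<noteq> 0"
  obtains k where "s *s A v + t *s B v = k *s nvec F G v"
proof (cases "G v = 0")
  case True
  then have "s = 0" "F v \<noteq> 0" using assms by auto
  then show ?thesis using True by (intro that[of "- t / F v"]) (simp add: nvec_def)
next
  case False
  then have "t = - (s * F v) / G v" using assms(1) by (simp add: field_simps eq_neg_iff_add_eq_0)
  then show ?thesis using False
    by (intro that[of "s / G v"]) (simp add: nvec_def vec_eq_iff right_diff_distrib)
qed

lemma section_eq:
  assumes u: "\<And>v. qf u v = m v * F v" "\<And>v. cf u v = m v * G v"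
    and FG: "\<And>v. v \<in> proj_line \<Longrightarrow> F v \<noteq> 0 \<or> G v \<noteq> 0"
  shows "pg_points (hplane u) \<inter> surf = curve F G \<union> (\<Union>l\<in>gen ` roots u. pg_points l)"
proof (intro equalityI subsetI)
  fix P assume P: "P \<in> pg_points (hplane u) \<inter> surf"
  then obtain v s t where v: "v \<in> proj_line" "s *s A v + t *s B v \<noteq> 0" "P = vec.span {s *s A v + t *s B v}"
    using surfE by blast
  have "dotp u (s *s A v + t *s B v) = 0"
    using P span_in_hplane unfolding v(3) by blast
  then have z: "m v * (s * F v + t * G v) = 0"
    unfolding dotp_gen u by (simp add: algebra_simps)
  show "P \<in> curve F G \<union> (\<Union>l\<in>gen ` roots u. pg_points l)"
  proof (cases "m v = 0")
    case True
    then have "v \<in> roots u" using v u by (simp add: roots_def)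
    moreover have "P \<in> pg_points (gen v)" unfolding v(3) span_in_gen using v mem_gen by blast
    ultimately show ?thesis by blast
  next
    case False
    then obtain k where k: "s *s A v + t *s B v = k *s nvec F G v"
      using z FG[OF v(1)] curve_point[of s F v t G] by auto
    then have "k \<noteq> 0" using v(2) by auto
    then have "P = vec.span {nvec F G v}" unfolding v(3) k by (rule span_singleton_scale)
    then show ?thesis using v(1) by (auto simp: curve_def)
  qed
next
  fix P assume P: "P \<in> curve F G \<union> (\<Union>l\<in>gen ` roots u. pg_points l)"
  show "P \<in> pg_points (hplane u) \<inter> surf"
  proof (cases "P \<in> curve F G")
    case True
    then obtain v where v: "v \<in> proj_line" "P = vec.span {nvec F G v}" by (auto simp: curve_def)
    have "dotp u (nvec F G v) = G v * qf u v - F v * cf u v" by (simp add: nvec_def qf_def cf_def)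
    also have "\<dots> = 0" by (simp add: u)
    finally have "P \<in> pg_points (hplane u)"
      unfolding v(2) span_in_hplane using FG v(1) nvec_eq_0 by blast
    moreover have "P \<in> surf"
      unfolding v(2) span_in_surf using FG v(1) nvec_eq_0 nvec_in_gen by blast
    ultimately show ?thesis by blast
  next
    case False
    then obtain v where v: "v \<in> roots u" "P \<in> pg_points (gen v)" using P by blast
    then have "gen v \<subseteq> hplane u" "v \<in> proj_line" by (auto simp: gen_subset_hplane roots_def)
    then show ?thesis using v by (auto simp: surf_eq pg_points_def)
  qed
qed

lemma section_typeI:
  assumes "\<And>v. qf u v = m v * F v" "\<And>v. cf u v = m v * G v"
    "\<And>v. v \<in> proj_line \<Longrightarrow> F v \<noteq> 0 \<or> G v \<noteq> 0"
    "if r = 2 then curve F G = conic else nrc r (curve F G)"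
  shows "section_type surf conic gens r (card (roots u)) (hplane u)"
proof -
  have "inj_on gen (roots u)" by (rule inj_on_subset[OF inj_gen]) (auto simp: roots_def)
  then have "card (gen ` roots u) = card (roots u)" by (rule card_image)
  moreover have "gen ` roots u \<subseteq> gens" by (auto simp: gens_def roots_def)
  ultimately show ?thesis
    unfolding section_type_def
  proof (intro exI conjI)
    show "pg_points (hplane u) \<inter> surf = curve F G \<union> (\<Union>l\<in>gen ` roots u. pg_points l)"
      using assms(1-3) by (rule section_eq)
  qed (use assms(4) in simp_all)
qed

text \<open>The hypothesis on \<open>P\<close> and \<open>Q\<close> is coprimality of \<open>F\<close> and \<open>G\<close>; it bounds the number of
  hyperplanes through the curve.\<close>

lemma nrc_curve:
  assumes vf: "vform r (nvec F G)" and r: "r \<le> 5"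
    and syz: "\<And>P Q. bform 2 P \<Longrightarrow> bform 3 Q \<Longrightarrow> (\<And>v. G v * P v = F v * Q v) \<Longrightarrow>
      \<exists>m. bform (5 - r) m \<and> P = (\<lambda>v. m v * F v) \<and> Q = (\<lambda>v. m v * G v)"
  shows "nrc r (curve F G)"
  unfolding curve_def
proof (rule nrcI[OF vf])
  have sub: "(\<lambda>u. (qf u, cf u)) ` annih (range (nvec F G)) \<subseteq>
    (\<lambda>m. (\<lambda>v. m v * F v, \<lambda>v. m v * G v)) ` {m. bform (5 - r) m}"
  proof (rule image_subsetI)
    fix u assume "u \<in> annih (range (nvec F G))"
    then have "dotp u (nvec F G v) = 0" for v by (auto simp: annih_def)
    then have "G v * qf u v = F v * cf u v" for v by (simp add: nvec_def qf_def cf_def)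
    then show "(qf u, cf u) \<in> (\<lambda>m. (\<lambda>v. m v * F v, \<lambda>v. m v * G v)) ` {m. bform (5 - r) m}"
      using syz[OF bform_qf[of u] bform_cf[of u]] by blast
  qed
  have "inj_on (\<lambda>u. (qf u, cf u)) (annih (range (nvec F G)))"
    by (rule inj_onI) (simp add: qf_cf_inj)
  then have "card (annih (range (nvec F G))) = card ((\<lambda>u. (qf u, cf u)) ` annih (range (nvec F G)))"
    by (rule card_image[symmetric])
  also have "\<dots> \<le> card {m :: 'a ^ 2 \<Rightarrow> 'a. bform (5 - r) m}"
    by (rule surj_card_le[OF finite_bform sub])
  also have "\<dots> = CARD('a) ^ (6 - r)"
  proof -
    have "5 - r + 1 = 6 - r" "5 - r \<le> CARD('a)" using q_ge_7 r by auto
    then show ?thesis using card_bform[where 'a='a and d = "5 - r"] by simp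
  qed
  finally have "card (annih (range (nvec F G))) * CARD('a) ^ (r + 1) \<le> CARD('a) ^ (6 - r) * CARD('a) ^ (r + 1)"
    by (rule mult_le_mono1)
  also have "\<dots> = CARD('a) ^ CARD(7)"
  proof -
    have "6 - r + (r + 1) = CARD(7)" using r by simp
    then show ?thesis by (metis power_add)
  qed
  finally show "card (annih (range (nvec F G))) * CARD('a) ^ (r + 1) \<le> CARD('a) ^ CARD(7)" .
qed

lemma vform_nvec:
  assumes "bform d F" "bform e G" "d + 3 = r" "e + 2 = r"
  shows "vform r (nvec F G)"
  unfolding nvec_def using assms vform_mult[OF assms(1) vform_B] vform_mult[OF assms(2) vform_A]
  by (auto intro: vform_diff)

lemma curve_conic: "curve (\<lambda>_. 0) (\<lambda>_. 1) = conic"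
  by (simp add: curve_def conic_def nvec_def)

lemma nrc_conic: "nrc 2 conic"
  unfolding curve_conic[symmetric]
proof (rule nrc_curve)
  show "vform 2 (nvec (\<lambda>_. 0) (\<lambda>_. 1))" using vform_A by (simp add: nvec_def[abs_def])
  fix P Q :: "'a ^ 2 \<Rightarrow> 'a"
  assume "bform 2 P" "bform 3 Q" "\<And>v. 1 * P v = 0 * Q v"
  then show "\<exists>m. bform (5 - 2) m \<and> P = (\<lambda>v. m v * 0) \<and> Q = (\<lambda>v. m v * 1)"
    by (intro exI[of _ Q]) auto
qed simp

lemma nrc_curve_3:
  assumes "bform (Suc 0) h"
  shows "nrc 3 (curve (\<lambda>_. 1) h)"
proof (rule nrc_curve)
  show "vform 3 (nvec (\<lambda>_. 1) h)"
    using assms by (intro vform_nvec[of 0 _ "Suc 0"] bform_const_fun) auto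
  fix P Q :: "'a ^ 2 \<Rightarrow> 'a"
  assume "bform 2 P" "bform 3 Q" "\<And>v. h v * P v = 1 * Q v"
  then show "\<exists>m. bform (5 - 3) m \<and> P = (\<lambda>v. m v * 1) \<and> Q = (\<lambda>v. m v * h v)"
    by (intro exI[of _ P]) (auto simp: mult.commute)
qed simp

lemma nrc_curve_4:
  assumes F: "bform (Suc 0) F" and G: "bform 2 G" and v0: "v0 \<in> proj_line" "F v0 = 0" "G v0 \<noteq> 0"
    and k: "k \<noteq> 0" "\<And>v. F v = k * cross2 v0 v"
  shows "nrc 4 (curve F G)"
proof (rule nrc_curve)
  show "vform 4 (nvec F G)"
    using assms by (intro vform_nvec[of "Suc 0" _ 2]) auto
  fix P Q :: "'a ^ 2 \<Rightarrow> 'a"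
  assume PQ: "bform 2 P" "bform 3 Q" "\<And>v. G v * P v = F v * Q v"
  have "P v0 = 0" using PQ(3)[of v0] v0 by simp
  then obtain P1 where P1: "bform (Suc 0) P1" "\<And>v. P v = cross2 v0 v * P1 v"
    using bform_factor[of "Suc 0" P v0] PQ(1) proj_line_nonzero[OF v0(1)] by (metis numeral_2_eq_2)
  define m where "m = (\<lambda>v. (1 / k) * P1 v)"
  have m: "bform (Suc 0) m" unfolding m_def by (rule bform_cmult[OF P1(1)])
  have P: "P = (\<lambda>v. m v * F v)" using k P1 by (auto simp: m_def)
  have "F \<noteq> (\<lambda>_. 0)" using cross2_nonzero[OF v0(1)] k by (auto simp: fun_eq_iff)
  moreover have "bform 3 (\<lambda>v. m v * G v)" using bform_mult[OF m G] by (simp add: numeral_3_eq_3 numeral_2_eq_2)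
  moreover have "F v * Q v = F v * (m v * G v)" for v
    using PQ(3)[of v] by (auto simp: P algebra_simps)
  ultimately have "Q = (\<lambda>v. m v * G v)"
    using bform_mult_cancel[OF F PQ(2), of "\<lambda>v. m v * G v"] q_ge_7 by simp
  then show "\<exists>m. bform (5 - 4) m \<and> P = (\<lambda>v. m v * F v) \<and> Q = (\<lambda>v. m v * G v)"
    using P m by auto
qed simp

lemma nrc_curve_5:
  assumes F: "bform 2 F" "F \<noteq> (\<lambda>_. 0)" and G: "bform 3 G"
    and FG: "\<And>v. v \<in> proj_line \<Longrightarrow> F v \<noteq> 0 \<or> G v \<noteq> 0"
    and ndvd: "\<nexists>h. bform (Suc 0) h \<and> G = (\<lambda>v. F v * h v)"
  shows "nrc 5 (curve F G)"
proof (rule nrc_curve)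
  show "vform 5 (nvec F G)"
    using assms by (intro vform_nvec[of 2 _ 3]) auto
  fix P Q :: "'a ^ 2 \<Rightarrow> 'a"
  assume PQ: "bform 2 P" "bform 3 Q" "\<And>v. G v * P v = F v * Q v"
  obtain v0 where v0: "v0 \<in> proj_line" "F v0 \<noteq> 0"
  proof (rule ccontr)
    assume "\<not> thesis"
    then have "\<forall>v\<in>proj_line. F v = 0" using that by blast
    then have "F v = 0" for v
      using bform_eq_0[OF F(1), of proj_line v] card_proj_line[where 'a='a] q_ge_7 by auto
    then show False using F(2) by auto
  qed
  note v00 = proj_line_nonzero[OF v0(1)]
  define c where "c = P v0 / F v0"
  define P' where "P' = (\<lambda>v. P v - c * F v)"
  define Q' where "Q' = (\<lambda>v. Q v - c * G v)"
  have PQ': "bform (Suc (Suc 0)) P'" "bform (Suc (Suc (Suc 0))) Q'"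
    using bform_diff[OF PQ(1) bform_cmult[OF F(1), of c]] bform_diff[OF PQ(2) bform_cmult[OF G, of c]]
    by (simp_all add: P'_def Q'_def numeral_2_eq_2 numeral_3_eq_3)
  have eq': "G v * P' v = F v * Q' v" for v
    using PQ(3)[of v] by (simp add: P'_def Q'_def algebra_simps)
  have z: "P' v0 = 0" using v0 by (simp add: P'_def c_def)
  then have "Q' v0 = 0" using eq'[of v0] v0 by simp
  then obtain Q1 where Q1: "bform (Suc (Suc 0)) Q1" "\<And>v. Q' v = cross2 v0 v * Q1 v"
    using bform_factor[OF PQ'(2) v00] by blast
  obtain P1 where P1: "bform (Suc 0) P1" "\<And>v. P' v = cross2 v0 v * P1 v"
    using bform_factor[OF PQ'(1) v00 z] by blast
  note nz = cross2_nonzero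
  have eq1: "(\<lambda>v. G v * P1 v) = (\<lambda>v. F v * Q1 v)"
  proof (rule bform_mult_cancel[OF bform_cross2[of v0]])
    show "bform 4 (\<lambda>v. G v * P1 v)" using bform_mult[OF G P1(1)] by simp
    show "bform 4 (\<lambda>v. F v * Q1 v)" using bform_mult[OF F(1) Q1(1)] by (simp add: eval_nat_numeral)
    show "cross2 v0 v * (G v * P1 v) = cross2 v0 v * (F v * Q1 v)" for v
      using eq'[of v] unfolding P1 Q1 by (simp add: algebra_simps)
  qed (use q_ge_7 nz v0 in auto)
  have "P1 = (\<lambda>_. 0)"
  proof (rule ccontr)
    assume P1n: "P1 \<noteq> (\<lambda>_. 0)"
    obtain w where w: "w \<in> proj_line" "P1 w = 0" by (rule bform_1_root[OF P1(1)])
    note w0 = proj_line_nonzero[OF w(1)]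
    obtain k where k: "\<And>v. P1 v = k * cross2 w v" by (rule bform_1_eq[OF P1(1) w0 w(2)]) blast
    have k0: "k \<noteq> 0" using P1n k by auto
    have "F w * Q1 w = 0" using fun_cong[OF eq1, of w] w by simp
    then consider "Q1 w = 0" | "F w = 0" by auto
    then show False
    proof cases
      case 1
      then obtain Q2 where Q2: "bform (Suc 0) Q2" "\<And>v. Q1 v = cross2 w v * Q2 v"
        using bform_factor[OF Q1(1) w0] by blast
      have "G = (\<lambda>v. F v * ((1 / k) * Q2 v))"
      proof (rule bform_mult_cancel[OF bform_cross2[of w] G])
        show "bform 3 (\<lambda>v. F v * (1 / k * Q2 v))"
          using bform_mult[OF F(1) bform_cmult[OF Q2(1), of "1 / k"]] by simp
        show "cross2 w v * G v = cross2 w v * (F v * (1 / k * Q2 v))" for v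
          using fun_cong[OF eq1, of v] k0 unfolding k Q2 by (simp add: field_simps)
      qed (use q_ge_7 nz w in auto)
      then show False using ndvd bform_cmult[OF Q2(1), of "1 / k"] by blast
    next
      case 2
      then obtain F1 where F1: "bform (Suc 0) F1" "\<And>v. F v = cross2 w v * F1 v"
        using bform_factor[of "Suc 0" F w] F(1) w0 by (metis numeral_2_eq_2)
      have "(\<lambda>v. k * G v) = (\<lambda>v. F1 v * Q1 v)"
      proof (rule bform_mult_cancel[OF bform_cross2[of w] bform_cmult[OF G]])
        show "bform 3 (\<lambda>v. F1 v * Q1 v)"
          using bform_mult[OF F1(1) Q1(1)] by (simp add: eval_nat_numeral)
        show "cross2 w v * (k * G v) = cross2 w v * (F1 v * Q1 v)" for v
          using fun_cong[OF eq1, of v] unfolding k F1 by (simp add: algebra_simps)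
      qed (use q_ge_7 nz w in auto)
      moreover obtain y where y: "y \<in> proj_line" "F1 y = 0" by (rule bform_1_root[OF F1(1)])
      ultimately have "k * G y = 0" by (metis mult_zero_left)
      then show False using FG[OF y(1)] F1(2)[of y] y k0 by simp
    qed
  qed
  then have P'0: "P' = (\<lambda>_. 0)" using P1(2) by auto
  then have "Q' = (\<lambda>_. 0)"
    using bform_mult_eq_0[OF F(1) PQ'(2)] F(2) eq' q_ge_7 by auto
  then have "P = (\<lambda>v. c * F v) \<and> Q = (\<lambda>v. c * G v)"
    using P'0 by (simp add: P'_def Q'_def fun_eq_iff)
  then show "\<exists>m. bform (5 - 5) m \<and> P = (\<lambda>v. m v * F v) \<and> Q = (\<lambda>v. m v * G v)"
    using bform_const_fun[of c] by (intro exI[of _ "\<lambda>_. c"]) simp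
qed simp

definition hyp_type :: "'a ^ 7 \<Rightarrow> nat \<times> nat" where
  "hyp_type u =
    (if qf u = (\<lambda>_. 0) then (2, card (roots u))
     else if \<exists>h. bform (Suc 0) h \<and> cf u = (\<lambda>v. qf u v * h v) then (3, card (roots u))
     else if card (roots u) = 1 then (4, 1) else (5, 0))"

lemma bform_card_roots:
  fixes F :: "'a ^ 2 \<Rightarrow> 'a"
  assumes "bform d F" "F \<noteq> (\<lambda>_. 0)"
  shows "card {v \<in> proj_line. F v = 0} \<le> d"
proof (rule ccontr)
  assume "\<not> ?thesis"
  then have "F v = 0" for v using bform_eq_0[OF assms(1), of "{v \<in> proj_line. F v = 0}" v] by fastforce
  then show False using assms(2) by auto
qed

lemma qf_cf_zero: "u \<noteq> 0 \<Longrightarrow> qf u = (\<lambda>_. 0) \<Longrightarrow> cf u \<noteq> (\<lambda>_. 0)"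
  by (metis cf_def full qf_def)

text \<open>Two common roots of \<open>qf u\<close> and \<open>cf u\<close> already exhaust the factors of \<open>qf u\<close>.\<close>

lemma two_roots_dvd:
  assumes nz: "qf u \<noteq> (\<lambda>_. 0)" and vw: "v \<in> roots u" "w \<in> roots u" "v \<noteq> w"
  shows "\<exists>h. bform (Suc 0) h \<and> cf u = (\<lambda>x. qf u x * h x)"
proof -
  have pl: "v \<in> proj_line" "w \<in> proj_line" using vw by (auto simp: roots_def)
  note n0 = proj_line_nonzero[OF pl(1)] proj_line_nonzero[OF pl(2)]
  have z: "qf u v = 0" "cf u v = 0" "qf u w = 0" "cf u w = 0" using vw by (auto simp: roots_def)
  have c: "cross2 v w \<noteq> 0" using cross2_eq_0_iff[OF pl] vw by simp
  obtain F1 where F1: "bform (Suc 0) F1" "\<And>x. qf u x = cross2 v x * F1 x"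
    using bform_factor[OF bform_qf' n0(1) z(1)] by blast
  obtain G1 where G1: "bform (Suc (Suc 0)) G1" "\<And>x. cf u x = cross2 v x * G1 x"
    using bform_factor[OF bform_cf' n0(1) z(2)] by blast
  have "F1 w = 0" "G1 w = 0" using F1(2)[of w] G1(2)[of w] z c by auto
  then obtain k G2 where k: "\<And>x. F1 x = k * cross2 w x"
    and G2: "bform (Suc 0) G2" "\<And>x. G1 x = cross2 w x * G2 x"
    using bform_1_eq[OF F1(1) n0(2)] bform_factor[OF G1(1) n0(2)] by metis
  have "k \<noteq> 0"
  proof
    assume "k = 0"
    then have "qf u x = 0" for x using F1 k by simp
    then show False using nz by auto
  qed
  then have "cf u = (\<lambda>x. qf u x * ((1 / k) * G2 x))"
    by (auto simp: F1 G1 k G2 fun_eq_iff)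
  then show ?thesis using bform_cmult[OF G2(1), of "1 / k"] by blast
qed

lemma hyp_type_section:
  assumes u: "u \<noteq> 0"
  shows "section_type surf conic gens (fst (hyp_type u)) (snd (hyp_type u)) (hplane u)"
    and "hyp_type u \<in> {(5,0), (4,1), (3,0), (3,1), (3,2), (2,0), (2,1), (2,2), (2,3)}"
proof -
  have "section_type surf conic gens (fst (hyp_type u)) (snd (hyp_type u)) (hplane u) \<and>
    hyp_type u \<in> {(5,0), (4,1), (3,0), (3,1), (3,2), (2,0), (2,1), (2,2), (2,3)}"
  proof (cases "qf u = (\<lambda>_. 0)")
    case True
    have "section_type surf conic gens 2 (card (roots u)) (hplane u)"
      by (rule section_typeI[of _ "cf u" "\<lambda>_. 0" "\<lambda>_. 1"]) (auto simp: True curve_conic)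
    moreover have "roots u = {v \<in> proj_line. cf u v = 0}" by (auto simp: roots_def True)
    then have "card (roots u) \<le> 3"
      using bform_card_roots[OF bform_cf qf_cf_zero[OF u True]] by simp
    then have "card (roots u) \<in> {0, 1, 2, 3}" unfolding insert_iff empty_iff by linarith
    moreover have "hyp_type u = (2, card (roots u))" using True by (simp add: hyp_type_def)
    ultimately show ?thesis by (elim insertE emptyE) simp_all
  next
    case nz: False
    have le2: "card (roots u) \<le> 2"
    proof -
      have "card (roots u) \<le> card {v \<in> proj_line. qf u v = 0}"
        by (rule card_mono) (auto simp: roots_def)
      then show ?thesis using bform_card_roots[OF bform_qf nz] by simp
    qed
    show ?thesis
    proof (cases "\<exists>h. bform (Suc 0) h \<and> cf u = (\<lambda>v. qf u v * h v)")
      case True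
      then obtain h where h: "bform (Suc 0) h" "cf u = (\<lambda>v. qf u v * h v)" by blast
      have "section_type surf conic gens 3 (card (roots u)) (hplane u)"
        by (rule section_typeI[of _ "qf u" "\<lambda>_. 1" h]) (auto simp: h(2) nrc_curve_3[OF h(1)])
      moreover have "card (roots u) \<in> {0, 1, 2}" using le2 unfolding insert_iff empty_iff by linarith
      moreover have "hyp_type u = (3, card (roots u))" using nz True by (simp add: hyp_type_def)
      ultimately show ?thesis by (elim insertE emptyE) simp_all
    next
      case nd: False
      have "card (roots u) < 2"
      proof (rule ccontr)
        assume "\<not> card (roots u) < 2"
        then have "card (roots u) = 2" using le2 by linarith
        then obtain v w where "roots u = {v, w}" "v \<noteq> w" by (auto simp: card_2_iff)
        then show False using two_roots_dvd[OF nz, of v w] nd by blast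
      qed
      then consider "card (roots u) = 0" | "card (roots u) = 1" by linarith
      then show ?thesis
      proof cases
        case 1
        then have e: "roots u = {}" by simp
        have FG: "\<And>v. v \<in> proj_line \<Longrightarrow> qf u v \<noteq> 0 \<or> cf u v \<noteq> 0" using e by (auto simp: roots_def)
        have "nrc 5 (curve (qf u) (cf u))"
          by (rule nrc_curve_5[OF bform_qf nz bform_cf FG]) (use nd in auto)
        then have "section_type surf conic gens 5 (card (roots u)) (hplane u)"
          by (intro section_typeI[of _ "\<lambda>_. 1" "qf u" "cf u"]) (use FG in auto)
        moreover have "hyp_type u = (5, 0)"
          by (simp only: hyp_type_def nz nd 1 if_False zero_neq_one)
        ultimately show ?thesis using 1 by simp
      next
        case 2
        then obtain v where v: "roots u = {v}" by (metis card_1_singletonE)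
        then have v': "v \<in> proj_line" "qf u v = 0" "cf u v = 0" by (auto simp: roots_def)
        note v0 = proj_line_nonzero[OF v'(1)]
        obtain F where F: "bform (Suc 0) F" "\<And>x. qf u x = cross2 v x * F x"
          using bform_factor[OF bform_qf' v0 v'(2)] by blast
        obtain G where G: "bform (Suc (Suc 0)) G" "\<And>x. cf u x = cross2 v x * G x"
          using bform_factor[OF bform_cf' v0 v'(3)] by blast
        obtain w where w: "w \<in> proj_line" "F w = 0" by (rule bform_1_root[OF F(1)])
        note w0 = proj_line_nonzero[OF w(1)]
        obtain k where k: "\<And>x. F x = k * cross2 w x" by (rule bform_1_eq[OF F(1) w0 w(2)]) blast
        have k0: "k \<noteq> 0" using nz F k by auto
        have Gw: "G w \<noteq> 0"
        proof
          assume "G w = 0"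
          then obtain G1 where G1: "bform (Suc 0) G1" "\<And>x. G x = cross2 w x * G1 x"
            using bform_factor[OF G(1) w0] by blast
          have "cf u = (\<lambda>x. qf u x * ((1 / k) * G1 x))"
            using k0 by (auto simp: F G k G1 fun_eq_iff)
          then show False using nd bform_cmult[OF G1(1), of "1 / k"] by blast
        qed
        have FG: "F x \<noteq> 0 \<or> G x \<noteq> 0" if "x \<in> proj_line" for x
          using k k0 Gw cross2_eq_0_iff[OF w(1) that] by auto
        have "bform 2 G" using G(1) by (simp add: numeral_2_eq_2)
        then have "nrc 4 (curve F G)" using F(1) w Gw k0 k by (intro nrc_curve_4)
        then have "section_type surf conic gens 4 (card (roots u)) (hplane u)"
          by (intro section_typeI[of _ "cross2 v" F G]) (use FG F G in auto)
        moreover have "hyp_type u = (4, 1)"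
          by (simp only: hyp_type_def nz nd 2 if_False if_True refl)
        ultimately show ?thesis using 2 by simp
      qed
    qed
  qed
  then show "section_type surf conic gens (fst (hyp_type u)) (snd (hyp_type u)) (hplane u)"
    and "hyp_type u \<in> {(5,0), (4,1), (3,0), (3,1), (3,2), (2,0), (2,1), (2,2), (2,3)}"
    by blast+
qed

section \<open>Uniqueness of the type\<close>

lemma nrc_par_gen:
  assumes np: "nrc_par r n S" "r \<ge> 2"
  shows "card {w \<in> proj_line. n w \<in> gen v} \<le> 2"
proof -
  have "card {w \<in> proj_line. n w \<in> gen v} \<le> vec.dim (gen v)"
    by (rule nrc_par_inter[OF np(1)]) (use dim_gen_le[of v] np(2) in auto)
  then show ?thesis using dim_gen_le[of v] by simp
qed

lemma card_gen_points:
  assumes "v \<in> proj_line"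
  shows "card (pg_points (gen v)) \<ge> 3"
proof -
  let ?a = "vec.span {A v}" and ?b = "vec.span {B v}" and ?c = "vec.span {A v + B v}"
  have nz: "A v \<noteq> 0" "B v \<noteq> 0" "A v + B v \<noteq> 0"
    using A_nonzero B_nonzero gen_coeffs_0[of v 1 1] assms by auto
  have ab: "?a \<noteq> ?b"
  proof
    assume "?a = ?b"
    then obtain k where "B v = k *s A v" using span_singleton_eq_iff[OF nz(1)] by blast
    then show False using gen_coeffs_0[of v k "- 1"] assms by simp
  qed
  have ac: "?a \<noteq> ?c"
  proof
    assume "?a = ?c"
    then obtain k where "A v + B v = k *s A v" using span_singleton_eq_iff[OF nz(1)] by blast
    then have "(k - 1) *s A v + (- 1) *s B v = 0" by (simp add: vec.scale_left_diff_distrib algebra_simps)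
    then show False using gen_coeffs_0[of v "k - 1" "- 1"] assms by simp
  qed
  have bc: "?b \<noteq> ?c"
  proof
    assume "?b = ?c"
    then obtain k where "A v + B v = k *s B v" using span_singleton_eq_iff[OF nz(2)] by blast
    then have "1 *s A v + (1 - k) *s B v = 0" by (simp add: vec.scale_left_diff_distrib algebra_simps)
    then show False using gen_coeffs_0[of v 1 "1 - k"] assms by simp
  qed
  have "{?a, ?b, ?c} \<subseteq> pg_points (gen v)"
    using nz A_in_gen[of v] B_in_gen[of v] vec.subspace_add[OF subspace_gen A_in_gen B_in_gen]
    by (simp add: span_in_gen)
  then have "card {?a, ?b, ?c} \<le> card (pg_points (gen v))" by (intro card_mono) auto
  then show ?thesis using ab ac bc by simp
qed

text \<open>A generator contained in the section is not covered by \<open>N\<close> and the other generators, so \<open>L\<close>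
  is forced; the points of the section off \<open>L\<close> then lie on \<open>N\<close>.\<close>

lemma section_type_facts:
  assumes st: "section_type surf conic gens r k (hplane u)" and r: "r \<ge> 2"
  obtains n S where "nrc_par r n S" "k = card (roots u)"
    "\<And>v. v \<in> proj_line - roots u \<Longrightarrow> \<exists>w\<in>proj_line. vec.span {n w} = vec.span {nvec (qf u) (cf u) v}"
    "(\<lambda>w. vec.span {n w}) ` proj_line \<subseteq> pg_points (hplane u) \<inter> surf"
    "r \<noteq> 2 \<Longrightarrow> k = 0 \<Longrightarrow> nrc r (pg_points (hplane u) \<inter> surf)"
proof -
  obtain N L where NL: "if r = 2 then N = conic else nrc r N" "L \<subseteq> gens" "card L = k"
    "pg_points (hplane u) \<inter> surf = N \<union> (\<Union>l\<in>L. pg_points l)"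
    using st by (auto simp: section_type_def)
  have "nrc r N" using NL(1) nrc_conic by (auto split: if_splits)
  then obtain n S where n: "nrc_par r n S" "N = points_of n" by (rule nrcE)
  have off: "P \<in> N" if P: "P \<in> pg_points (gen v)" "P \<in> pg_points (hplane u)" and v: "v \<in> proj_line" "gen v \<notin> L" for P v
  proof -
    have "P \<in> surf" using P v by (auto simp: surf_eq)
    moreover have "P \<notin> pg_points l" if lL: "l \<in> L" for l
    proof
      assume l: "P \<in> pg_points l"
      obtain w where w: "w \<in> proj_line" "l = gen w" using lL NL(2) unfolding gens_def by blast
      obtain x where x: "x \<noteq> 0" "P = vec.span {x}" using P(1) pg_points_eq[OF subspace_gen] by auto
      have "v = w" using gen_disjoint[OF v(1) w(1), of x] P(1) l x unfolding w(2) x(2) span_in_gen by blast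
      then show False using v lL w by simp
    qed
    ultimately show ?thesis using NL(4) P(2) by blast
  qed
  have L: "L = gen ` roots u"
  proof (intro equalityI subsetI)
    fix l assume l: "l \<in> L"
    then obtain v where v: "v \<in> proj_line" "l = gen v" using NL(2) by (auto simp: gens_def)
    have sub: "pg_points (gen v) \<subseteq> pg_points (hplane u)" using NL(4) l v by blast
    have "vec.span {A v} \<in> pg_points (gen v)" "vec.span {B v} \<in> pg_points (gen v)"
      using A_nonzero B_nonzero A_in_gen B_in_gen v by (auto simp: span_in_gen)
    then have "qf u v = 0" "cf u v = 0" using sub span_in_hplane by (auto simp: qf_def cf_def)
    then show "l \<in> gen ` roots u" using v by (auto simp: roots_def)
  next
    fix l assume "l \<in> gen ` roots u"
    then obtain v where v: "v \<in> roots u" "l = gen v" by blast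
    then have vp: "v \<in> proj_line" and sub: "gen v \<subseteq> hplane u" by (auto simp: roots_def gen_subset_hplane)
    show "l \<in> L"
    proof (rule ccontr)
      assume "l \<notin> L"
      then have "pg_points (gen v) \<subseteq> N" using off[of _ v] v sub vp by (auto simp: pg_points_def)
      then have "pg_points (gen v) \<subseteq> (\<lambda>w. vec.span {n w}) ` {w \<in> proj_line. n w \<in> gen v}"
        unfolding n(2) by (auto simp: span_in_gen)
      then have "card (pg_points (gen v)) \<le> card {w \<in> proj_line. n w \<in> gen v}"
        by (intro surj_card_le) auto
      then show False using nrc_par_gen[OF n(1) r, of v] card_gen_points[OF vp] by simp
    qed
  qed
  have "inj_on gen (roots u)" by (rule inj_on_subset[OF inj_gen]) (auto simp: roots_def)
  then have k: "k = card (roots u)" using NL(3) L by (simp add: card_image)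
  have pts: "\<exists>w\<in>proj_line. vec.span {n w} = vec.span {nvec (qf u) (cf u) v}" if v: "v \<in> proj_line - roots u" for v
  proof -
    have nz: "nvec (qf u) (cf u) v \<noteq> 0" using v nvec_eq_0 by (auto simp: roots_def)
    have "dotp u (nvec (qf u) (cf u) v) = 0"
      by (simp add: nvec_def) (simp add: qf_def cf_def)
    then have "vec.span {nvec (qf u) (cf u) v} \<in> N"
      using off[of _ v] v nz nvec_in_gen inj_gen inj_on_image_mem_iff[OF inj_gen, of v "roots u"]
      by (auto simp: span_in_gen span_in_hplane L roots_def)
    then show ?thesis unfolding n(2) by auto
  qed
  have "nrc r (pg_points (hplane u) \<inter> surf)" if "r \<noteq> 2" "k = 0"
  proof -
    have "L = {}" using k L that by simp
    then show ?thesis using NL that by simp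
  qed
  moreover have "N \<subseteq> pg_points (hplane u) \<inter> surf" using NL(4) by blast
  ultimately show ?thesis using that[OF n(1) k pts] unfolding n(2) by simp
qed

lemma section_type_le:
  assumes st: "section_type surf conic gens r k (hplane u)" "r \<ge> 2"
    and st': "section_type surf conic gens r' k' (hplane u)" "r' \<ge> 2" "r' + k' \<le> 5"
    and rr: "r + k \<le> 5"
  shows "r' \<le> r"
proof (rule ccontr)
  assume lt: "\<not> r' \<le> r"
  obtain n S where n: "nrc_par r n S" "k = card (roots u)"
    "\<And>v. v \<in> proj_line - roots u \<Longrightarrow> \<exists>w\<in>proj_line. vec.span {n w} = vec.span {nvec (qf u) (cf u) v}"
    using section_type_facts[OF st] by metis
  obtain n' S' where n': "nrc_par r' n' S'" "k' = card (roots u)"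
    "\<And>v. v \<in> proj_line - roots u \<Longrightarrow> \<exists>w\<in>proj_line. vec.span {n' w} = vec.span {nvec (qf u) (cf u) v}"
    using section_type_facts[OF st'(1,2)] by metis
  define Y where "Y = (\<lambda>v. vec.span {nvec (qf u) (cf u) v}) ` (proj_line - roots u)"
  have nz: "nvec (qf u) (cf u) v \<noteq> 0" if "v \<in> proj_line - roots u" for v
    using that nvec_eq_0 by (auto simp: roots_def)
  have "inj_on (\<lambda>v. vec.span {nvec (qf u) (cf u) v}) (proj_line - roots u)"
  proof (rule inj_onI)
    fix v w assume vw: "v \<in> proj_line - roots u" "w \<in> proj_line - roots u"
      "vec.span {nvec (qf u) (cf u) v} = vec.span {nvec (qf u) (cf u) w}"
    have "vec.span {nvec (qf u) (cf u) v} \<in> pg_points (gen w)"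
      unfolding vw(3) span_in_gen using nz[OF vw(2)] nvec_in_gen by blast
    then have "nvec (qf u) (cf u) v \<in> gen w"
      unfolding span_in_gen by simp
    then show "v = w" using gen_disjoint[OF _ _ nvec_in_gen] nz[OF vw(1)] vw(1,2) by blast
  qed
  then have "card Y = card (proj_line - roots u)" unfolding Y_def by (rule card_image)
  also have "\<dots> = CARD('a) + 1 - k"
    using card_Diff_subset[of "roots u" proj_line] card_proj_line[where 'a='a] n(2) by (auto simp: roots_def)
  finally have cY: "card Y = CARD('a) + 1 - k" .
  define K where "K = {w \<in> proj_line. n' w \<in> S}"
  have "Y \<subseteq> (\<lambda>w. vec.span {n' w}) ` K"
  proof
    fix P assume "P \<in> Y"
    then obtain v where v: "v \<in> proj_line - roots u" "P = vec.span {nvec (qf u) (cf u) v}" by (auto simp: Y_def)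
    obtain w where w: "w \<in> proj_line" "vec.span {n w} = P" using n(3) v by blast
    obtain w' where w': "w' \<in> proj_line" "vec.span {n' w'} = P" using n'(3) v by blast
    have "P \<in> pg_points S" using w nrc_par_S[OF n(1)] nrc_par_nonzero[OF n(1)] span_in_pg_points by blast
    then have "w' \<in> K" using w' nrc_par_S[OF n(1)] span_in_pg_points by (auto simp: K_def)
    then show "P \<in> (\<lambda>w. vec.span {n' w}) ` K" using w' by blast
  qed
  then have "card Y \<le> card K" by (intro surj_card_le) auto
  also have "\<dots> \<le> vec.dim S"
    by (rule nrc_par_inter[OF n'(1)]) (use lt nrc_par_S[OF n(1)] in \<open>auto simp: K_def\<close>)
  also have "\<dots> = r + 1" using nrc_par_S[OF n(1)] by simp
  finally show False using cY q_ge_7 rr by simp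
qed

lemma section_type_iff:
  assumes u: "u \<noteq> 0" and rk: "r \<ge> 2" "r + k \<le> 5"
  shows "section_type surf conic gens r k (hplane u) \<longleftrightarrow> hyp_type u = (r, k)"
proof
  assume st: "section_type surf conic gens r k (hplane u)"
  obtain r' k' where h: "hyp_type u = (r', k')" by (cases "hyp_type u")
  have st': "section_type surf conic gens r' k' (hplane u)" "r' \<ge> 2" "r' + k' \<le> 5"
    using hyp_type_section[OF u] h by auto
  have "k = card (roots u)" by (rule section_type_facts[OF st rk(1)]) simp
  moreover have "k' = card (roots u)" by (rule section_type_facts[OF st'(1,2)]) simp
  moreover have "r' \<le> r" by (rule section_type_le[OF st rk(1) st' rk(2)])
  moreover have "r \<le> r'" by (rule section_type_le[OF st'(1,2) st rk st'(3)])
  ultimately show "hyp_type u = (r, k)" using h by simp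
next
  assume "hyp_type u = (r, k)"
  then show "section_type surf conic gens r k (hplane u)" using hyp_type_section(1)[OF u] by simp
qed

lemma pg_space_5_iff: "pg_space 5 H \<longleftrightarrow> vec.subspace H \<and> vec.dim H + 1 = CARD(7)" for H :: "('a ^ 7) set"
  by (simp add: pg_space_def)

lemma pg_space_5E:
  fixes H :: "('a ^ 7) set"
  assumes "pg_space 5 H"
  obtains u where "u \<noteq> 0" "H = hplane u"
  using hyperplane_eq_hplane[of H] assms unfolding pg_space_5_iff by blast

lemma ex1_section_type:
  assumes "pg_space 5 H"
  shows "\<exists>!(r, k). (r, k) \<in> {(5,0), (4,1), (3,0), (3,1), (3,2), (2,0), (2,1), (2,2), (2,3)} \<and>
    section_type surf conic gens r k H"
proof -
  obtain u where u: "u \<noteq> 0" "H = hplane u" using pg_space_5E assms by blast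
  obtain r0 k0 where h: "hyp_type u = (r0, k0)" by (cases "hyp_type u")
  show ?thesis
  proof (rule ex1I[of _ "(r0, k0)"])
    show "case (r0, k0) of (r, k) \<Rightarrow> (r, k) \<in> {(5,0), (4,1), (3,0), (3,1), (3,2), (2,0), (2,1), (2,2), (2,3)} \<and>
      section_type surf conic gens r k H"
      using hyp_type_section[OF u(1)] u(2) unfolding h by simp
  next
    fix p :: "nat \<times> nat"
    assume p: "case p of (r, k) \<Rightarrow> (r, k) \<in> {(5,0), (4,1), (3,0), (3,1), (3,2), (2,0), (2,1), (2,2), (2,3)} \<and>
      section_type surf conic gens r k H"
    obtain r k where rk: "p = (r, k)" by (cases p)
    have "r \<ge> 2" "r + k \<le> 5" "section_type surf conic gens r k (hplane u)" using p rk u(2) by auto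
    then show "p = (r0, k0)" using section_type_iff[OF u(1)] h rk by simp
  qed
qed

lemma card_section_type:
  assumes "r \<ge> 2" "r + k \<le> 5"
  shows "card {H. pg_space 5 H \<and> section_type surf conic gens r k H} * (CARD('a) - 1) =
    card {u. u \<noteq> 0 \<and> hyp_type u = (r, k)}"
proof -
  have "{u. u \<noteq> 0 \<and> section_type surf conic gens r k (hplane u)} = {u. u \<noteq> 0 \<and> hyp_type u = (r, k)}"
    using section_type_iff assms by auto
  then show ?thesis
    using card_hplanes[of "section_type surf conic gens r k"] by (simp add: pg_space_5_iff conj_assoc)
qed

end

section \<open>Counting hyperplanes of each type\<close>

text \<open>The factorial moments of the number of roots determine its distribution.\<close>

lemma root_moments:
  fixes R :: "'u \<Rightarrow> 'b set" and N :: "nat \<Rightarrow> nat"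
  assumes U: "finite U" and P: "finite P"
    and R: "\<And>u. u \<in> U \<Longrightarrow> R u \<subseteq> P" "\<And>u. u \<in> U \<Longrightarrow> card (R u) \<le> 3"
    and N: "\<And>T. T \<subseteq> P \<Longrightarrow> card T \<le> 3 \<Longrightarrow> card {u \<in> U. T \<subseteq> R u} = N (card T)"
    and j: "j \<le> 3"
  shows "(\<Sum>k\<le>3. card {u \<in> U. card (R u) = k} * (k choose j)) = (card P choose j) * N j"
proof -
  let ?T = "{T. T \<subseteq> P \<and> card T = j}"
  have fT: "finite ?T" using P by simp
  have "(\<Sum>k\<le>3. card {u \<in> U. card (R u) = k} * (k choose j)) =
    (\<Sum>k\<le>3. \<Sum>u\<in>{u \<in> U. card (R u) = k}. card (R u) choose j)"
    by (intro sum.cong) auto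
  also have "\<dots> = (\<Sum>u\<in>U. card (R u) choose j)"
    using U R by (intro sum.group) auto
  also have "\<dots> = (\<Sum>u\<in>U. \<Sum>T\<in>?T. if T \<subseteq> R u then 1 else 0)"
  proof (rule sum.cong[OF refl])
    fix u assume u: "u \<in> U"
    have "finite (R u)" using R(1)[OF u] P by (rule finite_subset)
    then have "card (R u) choose j = card {T. T \<subseteq> R u \<and> card T = j}" by (simp add: n_subsets)
    also have "{T. T \<subseteq> R u \<and> card T = j} = {T \<in> ?T. T \<subseteq> R u}" using R(1)[OF u] by auto
    also have "card \<dots> = (\<Sum>T\<in>?T. if T \<subseteq> R u then 1 else 0)"
      using fT by (simp add: sum.If_cases Int_def)
    finally show "card (R u) choose j = (\<Sum>T\<in>?T. if T \<subseteq> R u then 1 else 0)" .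
  qed
  also have "\<dots> = (\<Sum>T\<in>?T. \<Sum>u\<in>U. if T \<subseteq> R u then 1 else 0)" by (rule sum.swap)
  also have "\<dots> = (\<Sum>T\<in>?T. N j)"
  proof (rule sum.cong[OF refl])
    fix T assume T: "T \<in> ?T"
    have "(\<Sum>u\<in>U. if T \<subseteq> R u then 1 else 0) = card {u \<in> U. T \<subseteq> R u}"
      using U by (simp add: sum.If_cases Int_def)
    then show "(\<Sum>u\<in>U. if T \<subseteq> R u then 1 else 0) = N j" using N[of T] T j by auto
  qed
  also have "\<dots> = (card P choose j) * N j" using n_subsets[OF P, of j] by simp
  finally show ?thesis .
qed

lemma choose_2_real: "2 * real (n choose 2) = real n * (real n - 1)"
proof (cases n)
  case (Suc m)
  have "2 * (n choose 2) = n * m" using times_binomial_minus1_eq[of 2 n] Suc by simp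
  then have "2 * real (n choose 2) = real n * real m" by (metis of_nat_mult of_nat_numeral)
  then show ?thesis using Suc by simp
qed simp

lemma choose_3_real: "6 * real (n choose 3) = real n * (real n - 1) * (real n - 2)"
proof (cases n)
  case (Suc m)
  have "3 * (n choose 3) = n * (m choose 2)" using times_binomial_minus1_eq[of 3 n] Suc by simp
  then have "3 * real (n choose 3) = real n * real (m choose 2)" by (metis of_nat_mult of_nat_numeral)
  then have "6 * real (n choose 3) = real n * (2 * real (m choose 2))" by simp
  then show ?thesis unfolding choose_2_real using Suc by simp
qed simp

lemma root_moments_real:
  fixes R :: "'u \<Rightarrow> 'b set" and N :: "nat \<Rightarrow> nat" and m :: "nat \<Rightarrow> real" and Q :: real
  assumes "finite U" "finite P" "\<And>u. u \<in> U \<Longrightarrow> R u \<subseteq> P" "\<And>u. u \<in> U \<Longrightarrow> card (R u) \<le> 3"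
    and "\<And>T. T \<subseteq> P \<Longrightarrow> card T \<le> 3 \<Longrightarrow> card {u \<in> U. T \<subseteq> R u} = N (card T)"
    and Q: "real (card P) = Q + 1"
  defines "m \<equiv> \<lambda>k. real (card {u \<in> U. card (R u) = k})"
  shows "m 3 = (Q + 1) * Q * (Q - 1) / 6 * N 3"
    and "m 2 = (Q + 1) * Q / 2 * N 2 - 3 * m 3"
    and "m 1 = (Q + 1) * N 1 - 2 * m 2 - 3 * m 3"
    and "m 0 = N 0 - m 1 - m 2 - m 3"
proof -
  have eq: "(\<Sum>k\<le>3. m k * real (k choose j)) = real (card P choose j) * real (N j)" if "j \<le> 3" for j
    using arg_cong[OF root_moments[OF assms(1-5) that], of real] by (simp add: m_def)
  have c: "real (card P choose 2) = (Q + 1) * Q / 2" "real (card P choose 3) = (Q + 1) * Q * (Q - 1) / 6"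
    using choose_2_real[of "card P"] choose_3_real[of "card P"] unfolding Q by (simp_all add: algebra_simps)
  have s: "(\<Sum>k\<le>3. f k) = f 0 + f 1 + f 2 + f 3" for f :: "nat \<Rightarrow> real"
    by (simp add: eval_nat_numeral)
  show "m 3 = (Q + 1) * Q * (Q - 1) / 6 * N 3"
    using eq[of 3] unfolding s c by (simp add: binomial_eq_0)
  show "m 2 = (Q + 1) * Q / 2 * N 2 - 3 * m 3"
    using eq[of 2] unfolding s c by (simp add: binomial_eq_0 eval_nat_numeral)
  show "m 1 = (Q + 1) * N 1 - 2 * m 2 - 3 * m 3"
    using eq[of 1] unfolding s by (simp add: Q)
  show "m 0 = N 0 - m 1 - m 2 - m 3"
    using eq[of 0] unfolding s by simp
qed

context scroll
begin

lemma card_hyperplane_forms: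
  "card {u. X (qf u) (cf u)} = card {(F, G). bform 2 F \<and> bform 3 G \<and> X F G}"
proof (rule bij_betw_same_card)
  show "bij_betw (\<lambda>u. (qf u, cf u)) {u. X (qf u) (cf u)} {(F, G). bform 2 F \<and> bform 3 G \<and> X F G}"
    unfolding bij_betw_def
  proof (intro conjI equalityI subsetI)
    show "inj_on (\<lambda>u. (qf u, cf u)) {u. X (qf u) (cf u)}"
      by (rule inj_onI) (simp add: qf_cf_inj)
  next
    fix p assume "p \<in> {(F, G). bform 2 F \<and> bform 3 G \<and> X F G}"
    then obtain F G where p: "p = (F, G)" "bform 2 F" "bform 3 G" "X F G" by auto
    then obtain u where "qf u = F" "cf u = G" using ex_hyperplane by blast
    then show "p \<in> (\<lambda>u. (qf u, cf u)) ` {u. X (qf u) (cf u)}" using p by auto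
  qed (use bform_qf bform_cf in auto)
qed

lemma card_nonzero:
  fixes X :: "'a ^ 7 \<Rightarrow> bool"
  assumes "X 0"
  shows "card {u. u \<noteq> 0 \<and> X u} = card {u. X u} - 1"
proof -
  have "{u. u \<noteq> 0 \<and> X u} = {u. X u} - {0}" by auto
  then show ?thesis using assms by (simp add: card_Diff_singleton)
qed

lemma qf_0: "qf 0 = (\<lambda>_. 0)" and cf_0: "cf 0 = (\<lambda>_. 0)"
  by (simp_all add: qf_def cf_def)

lemma subset_roots_iff: "T \<subseteq> proj_line \<Longrightarrow> T \<subseteq> roots u \<longleftrightarrow> (\<forall>v\<in>T. qf u v = 0) \<and> (\<forall>v\<in>T. cf u v = 0)"
  by (auto simp: roots_def)

lemma card_vanish_2: "T \<subseteq> proj_line \<Longrightarrow> card T \<le> 3 \<Longrightarrow>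
    card {F :: 'a ^ 2 \<Rightarrow> 'a. bform 2 F \<and> (\<forall>v\<in>T. F v = 0)} = CARD('a) ^ (3 - card T)"
  and card_vanish_3: "T \<subseteq> proj_line \<Longrightarrow> card T \<le> 3 \<Longrightarrow>
    card {F :: 'a ^ 2 \<Rightarrow> 'a. bform 3 F \<and> (\<forall>v\<in>T. F v = 0)} = CARD('a) ^ (4 - card T)"
  using card_bform_vanishing[of T 2] card_bform_vanishing[of T 3] q_ge_7 by simp_all

lemma card_through_all:
  assumes T: "T \<subseteq> proj_line" "card T \<le> 3"
  shows "card {u \<in> {u. u \<noteq> 0}. T \<subseteq> roots u} = CARD('a) ^ (7 - 2 * card T) - 1"
proof -
  have "card {u. T \<subseteq> roots u} = card {u. (\<forall>v\<in>T. qf u v = 0) \<and> (\<forall>v\<in>T. cf u v = 0)}"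
    using subset_roots_iff[OF T(1)] by simp
  also have "\<dots> = card {(F :: 'a ^ 2 \<Rightarrow> 'a, G :: 'a ^ 2 \<Rightarrow> 'a). bform 2 F \<and> bform 3 G \<and> (\<forall>v\<in>T. F v = 0) \<and> (\<forall>v\<in>T. G v = 0)}"
    by (rule card_hyperplane_forms)
  also have "{(F :: 'a ^ 2 \<Rightarrow> 'a, G :: 'a ^ 2 \<Rightarrow> 'a). bform 2 F \<and> bform 3 G \<and> (\<forall>v\<in>T. F v = 0) \<and> (\<forall>v\<in>T. G v = 0)} =
    {F. bform 2 F \<and> (\<forall>v\<in>T. F v = 0)} \<times> {G. bform 3 G \<and> (\<forall>v\<in>T. G v = 0)}" by auto
  also have "card \<dots> = CARD('a) ^ (3 - card T) * CARD('a) ^ (4 - card T)"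
    using T by (simp only: card_cartesian_product card_vanish_2 card_vanish_3)
  also have "\<dots> = CARD('a) ^ (7 - 2 * card T)"
  proof -
    have "3 - card T + (4 - card T) = 7 - 2 * card T" using T(2) by simp
    then show ?thesis by (metis power_add)
  qed
  finally have "card {u. T \<subseteq> roots u} = CARD('a) ^ (7 - 2 * card T)" .
  then show ?thesis using card_nonzero[of "\<lambda>u. T \<subseteq> roots u"] T
    by (simp add: subset_roots_iff qf_0 cf_0)
qed

lemma card_through_qf_0:
  assumes T: "T \<subseteq> proj_line" "card T \<le> 3"
  shows "card {u \<in> {u. u \<noteq> 0 \<and> qf u = (\<lambda>_. 0)}. T \<subseteq> roots u} = CARD('a) ^ (4 - card T) - 1"
proof -
  have "card {u. qf u = (\<lambda>_. 0) \<and> T \<subseteq> roots u} = card {u. qf u = (\<lambda>_. 0) \<and> (\<forall>v\<in>T. cf u v = 0)}"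
    using subset_roots_iff[OF T(1)] by (intro arg_cong[of _ _ card]) auto
  also have "\<dots> = card {(F :: 'a ^ 2 \<Rightarrow> 'a, G :: 'a ^ 2 \<Rightarrow> 'a). bform 2 F \<and> bform 3 G \<and> F = (\<lambda>_. 0) \<and> (\<forall>v\<in>T. G v = 0)}"
    by (rule card_hyperplane_forms[of "\<lambda>F G. F = (\<lambda>_. 0) \<and> (\<forall>v\<in>T. G v = 0)"])
  also have "{(F :: 'a ^ 2 \<Rightarrow> 'a, G :: 'a ^ 2 \<Rightarrow> 'a). bform 2 F \<and> bform 3 G \<and> F = (\<lambda>_. 0) \<and> (\<forall>v\<in>T. G v = 0)} =
    {\<lambda>_ :: 'a ^ 2. 0 :: 'a} \<times> {G. bform 3 G \<and> (\<forall>v\<in>T. G v = 0)}" using bform_zero by auto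
  also have "card \<dots> = CARD('a) ^ (4 - card T)"
    using T by (simp only: card_cartesian_product card_vanish_3) simp
  finally have "card {u. qf u = (\<lambda>_. 0) \<and> T \<subseteq> roots u} = CARD('a) ^ (4 - card T)" .
  then show ?thesis using card_nonzero[of "\<lambda>u. qf u = (\<lambda>_. 0) \<and> T \<subseteq> roots u"] T
    by (simp add: subset_roots_iff qf_0 cf_0 conj_assoc)
qed

lemma card_through_multiple:
  assumes h: "bform (Suc 0) h" and T: "T \<subseteq> proj_line" "card T \<le> 3"
  shows "card {u \<in> {u. u \<noteq> 0 \<and> cf u = (\<lambda>v. qf u v * h v)}. T \<subseteq> roots u} = CARD('a) ^ (3 - card T) - 1"
proof -
  have "card {u. cf u = (\<lambda>v. qf u v * h v) \<and> T \<subseteq> roots u} =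
    card {u. cf u = (\<lambda>v. qf u v * h v) \<and> (\<forall>v\<in>T. qf u v = 0)}"
    using subset_roots_iff[OF T(1)] by (intro arg_cong[of _ _ card]) auto
  also have "\<dots> = card {(F :: 'a ^ 2 \<Rightarrow> 'a, G :: 'a ^ 2 \<Rightarrow> 'a). bform 2 F \<and> bform 3 G \<and> G = (\<lambda>v. F v * h v) \<and> (\<forall>v\<in>T. F v = 0)}"
    by (rule card_hyperplane_forms)
  also have "{(F :: 'a ^ 2 \<Rightarrow> 'a, G :: 'a ^ 2 \<Rightarrow> 'a). bform 2 F \<and> bform 3 G \<and> G = (\<lambda>v. F v * h v) \<and> (\<forall>v\<in>T. F v = 0)} =
    (\<lambda>F. (F, \<lambda>v. F v * h v)) ` {F. bform 2 F \<and> (\<forall>v\<in>T. F v = 0)}"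
    using bform_mult[OF _ h, of 2] by (auto simp: numeral_3_eq_3 numeral_2_eq_2)
  also have "card \<dots> = card {F :: 'a ^ 2 \<Rightarrow> 'a. bform 2 F \<and> (\<forall>v\<in>T. F v = 0)}"
    by (intro card_image inj_onI) simp
  also have "\<dots> = CARD('a) ^ (3 - card T)" by (rule card_vanish_2[OF T])
  finally have "card {u. cf u = (\<lambda>v. qf u v * h v) \<and> T \<subseteq> roots u} = CARD('a) ^ (3 - card T)" .
  then show ?thesis using card_nonzero[of "\<lambda>u. cf u = (\<lambda>v. qf u v * h v) \<and> T \<subseteq> roots u"] T
    by (simp add: subset_roots_iff qf_0 cf_0 conj_assoc)
qed

lemma card_roots_le_3:
  assumes "u \<noteq> 0"
  shows "card (roots u) \<le> 3"
proof (cases "qf u = (\<lambda>_. 0)")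
  case True
  have "card (roots u) \<le> card {v \<in> proj_line. cf u v = 0}" by (rule card_mono) (auto simp: roots_def)
  then show ?thesis using bform_card_roots[OF bform_cf qf_cf_zero[OF assms True]] by simp
next
  case False
  have "card (roots u) \<le> card {v \<in> proj_line. qf u v = 0}" by (rule card_mono) (auto simp: roots_def)
  then show ?thesis using bform_card_roots[OF bform_qf False] by simp
qed

abbreviation "num rk \<equiv> real (card {u. u \<noteq> 0 \<and> hyp_type u = rk})"
abbreviation "num_in U k \<equiv> real (card {u \<in> U. card (roots u) = k})"

context
  fixes Q :: real
  assumes Q: "Q = real CARD('a)"
begin

lemma distribution:
  assumes U: "U \<subseteq> {u. u \<noteq> 0}"
    and N: "\<forall>T. T \<subseteq> proj_line \<longrightarrow> card T \<le> 3 \<longrightarrow> card {u \<in> U. T \<subseteq> roots u} = CARD('a) ^ N (card T) - 1"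
  shows "num_in U 3 = (Q + 1) * Q * (Q - 1) / 6 * (Q ^ N 3 - 1)"
    and "num_in U 2 = (Q + 1) * Q / 2 * (Q ^ N 2 - 1) - 3 * num_in U 3"
    and "num_in U 1 = (Q + 1) * (Q ^ N 1 - 1) - 2 * num_in U 2 - 3 * num_in U 3"
    and "num_in U 0 = (Q ^ N 0 - 1) - num_in U 1 - num_in U 2 - num_in U 3"
proof -
  have c: "real (card (proj_line :: ('a ^ 2) set)) = Q + 1" by (simp add: card_proj_line Q)
  have s: "roots u \<subseteq> proj_line" for u by (auto simp: roots_def)
  have le: "card (roots u) \<le> 3" if "u \<in> U" for u using card_roots_le_3 that U by blast
  have T: "card {u \<in> U. T \<subseteq> roots u} = CARD('a) ^ N (card T) - 1" if "T \<subseteq> proj_line" "card T \<le> 3" for T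
    using N that by blast
  have r: "real (CARD('a) ^ j - 1) = Q ^ j - 1" for j by (simp add: of_nat_diff Q)
  note d = root_moments_real[OF finite finite s le T c, unfolded r]
  show "num_in U 3 = (Q + 1) * Q * (Q - 1) / 6 * (Q ^ N 3 - 1)"
    by (rule d(1))
  show "num_in U 2 = (Q + 1) * Q / 2 * (Q ^ N 2 - 1) - 3 * num_in U 3"
    by (rule d(2))
  show "num_in U 1 = (Q + 1) * (Q ^ N 1 - 1) - 2 * num_in U 2 - 3 * num_in U 3"
    by (rule d(3))
  show "num_in U 0 = (Q ^ N 0 - 1) - num_in U 1 - num_in U 2 - num_in U 3"
    by (rule d(4))
qed

lemma num_2:
  "num (2, 3) = (Q ^ 3 - Q) / 6 * (Q - 1)"
  "num (2, 2) = (Q ^ 2 + Q) * (Q - 1)"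
  "num (2, 1) = (Q ^ 3 / 2 + Q / 2 + 1) * (Q - 1)"
  "num (2, 0) = (Q ^ 3 - Q) / 3 * (Q - 1)"
proof -
  let ?U = "{u. u \<noteq> 0 \<and> qf u = (\<lambda>_. 0)}"
  have eq: "{u. u \<noteq> 0 \<and> hyp_type u = (2, k)} = {u \<in> ?U. card (roots u) = k}" for k
    by (auto simp: hyp_type_def)
  have U: "?U \<subseteq> {u. u \<noteq> 0}" by blast
  have "\<forall>T. T \<subseteq> proj_line \<longrightarrow> card T \<le> 3 \<longrightarrow> card {u \<in> ?U. T \<subseteq> roots u} = CARD('a) ^ (4 - card T) - 1"
    using card_through_qf_0 by blast
  note d = distribution[OF U, of "\<lambda>j. 4 - j", OF this]
  show 3: "num (2, 3) = (Q ^ 3 - Q) / 6 * (Q - 1)"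
    unfolding eq d(1) by (simp add: field_simps power_numeral_reduce)
  show 2: "num (2, 2) = (Q ^ 2 + Q) * (Q - 1)"
    unfolding eq d(2) 3[unfolded eq] by (simp add: field_simps power_numeral_reduce)
  show 1: "num (2, 1) = (Q ^ 3 / 2 + Q / 2 + 1) * (Q - 1)"
    unfolding eq d(3) 3[unfolded eq] 2[unfolded eq] by (simp add: field_simps power_numeral_reduce)
  show "num (2, 0) = (Q ^ 3 - Q) / 3 * (Q - 1)"
    unfolding eq d(4) 3[unfolded eq] 2[unfolded eq] 1[unfolded eq] by (simp add: field_simps power_numeral_reduce)
qed

lemma num_3:
  "num (3, 2) = (Q ^ 4 + Q ^ 3) / 2 * (Q - 1)"
  "num (3, 1) = (Q ^ 3 + Q ^ 2) * (Q - 1)"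
  "num (3, 0) = (Q ^ 4 - Q ^ 3) / 2 * (Q - 1)"
proof -
  define U where "U = (\<lambda>h. {u. u \<noteq> 0 \<and> cf u = (\<lambda>v. qf u v * h v)})"
  let ?H = "{h :: 'a ^ 2 \<Rightarrow> 'a. bform (Suc 0) h}"
  have qf0: "qf u \<noteq> (\<lambda>_. 0)" if "u \<in> U h" for u h
    using that qf_cf_zero[of u] by (auto simp: U_def)
  have sum: "card {u. u \<noteq> 0 \<and> hyp_type u = (3, k)} = (\<Sum>h\<in>?H. card {u \<in> U h. card (roots u) = k})" for k
  proof -
    have "{u. u \<noteq> 0 \<and> hyp_type u = (3, k)} = (\<Union>h\<in>?H. {u \<in> U h. card (roots u) = k})"
    proof (intro equalityI subsetI)
      fix u assume "u \<in> {u. u \<noteq> 0 \<and> hyp_type u = (3, k)}"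
      then show "u \<in> (\<Union>h\<in>?H. {u \<in> U h. card (roots u) = k})"
        by (auto simp: U_def hyp_type_def split: if_splits)
    next
      fix u assume "u \<in> (\<Union>h\<in>?H. {u \<in> U h. card (roots u) = k})"
      then obtain h where h: "bform (Suc 0) h" "u \<in> U h" "card (roots u) = k" by blast
      then have "\<exists>h. bform (Suc 0) h \<and> cf u = (\<lambda>v. qf u v * h v)" "u \<noteq> 0" by (auto simp: U_def)
      then show "u \<in> {u. u \<noteq> 0 \<and> hyp_type u = (3, k)}"
        using qf0[OF h(2)] h(3) by (simp add: hyp_type_def)
    qed
    moreover have "h = h'" if "bform (Suc 0) h" "bform (Suc 0) h'" "u \<in> U h" "u \<in> U h'" for h h' u
    proof (rule bform_mult_cancel[OF bform_qf[of u] that(1,2) _ qf0[OF that(3)]])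
      show "qf u v * h v = qf u v * h' v" for v
        using that(3,4) by (auto simp: U_def fun_eq_iff)
    qed (use q_ge_7 in simp)
    ultimately show ?thesis
      by (simp only:) (rule card_UN_disjoint, auto)
  qed
  have "card ?H = CARD('a) ^ 2"
    using card_bform[where 'a='a and d = "Suc 0"] q_ge_7 by (simp add: power2_eq_square)
  then have num: "num (3, k) = Q ^ 2 * x" if "\<And>h. bform (Suc 0) h \<Longrightarrow> num_in (U h) k = x" for k x
    unfolding sum of_nat_sum by (simp add: that Q)
  have d3: "num_in (U h) 3 = 0" and d2: "num_in (U h) 2 = (Q ^ 2 + Q) / 2 * (Q - 1)"
    and d1: "num_in (U h) 1 = (Q + 1) * (Q - 1)" and d0: "num_in (U h) 0 = (Q ^ 2 - Q) / 2 * (Q - 1)"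
    if h: "bform (Suc 0) h" for h
  proof -
    have U: "U h \<subseteq> {u. u \<noteq> 0}" by (auto simp: U_def)
    have "\<forall>T. T \<subseteq> proj_line \<longrightarrow> card T \<le> 3 \<longrightarrow> card {u \<in> U h. T \<subseteq> roots u} = CARD('a) ^ (3 - card T) - 1"
      unfolding U_def using card_through_multiple[OF h] by blast
    note d = distribution[OF U, of "\<lambda>j. 3 - j", OF this]
    show 3: "num_in (U h) 3 = 0" unfolding d(1) by simp
    show 2: "num_in (U h) 2 = (Q ^ 2 + Q) / 2 * (Q - 1)"
      unfolding d(2) 3 by (simp add: field_simps power_numeral_reduce)
    show 1: "num_in (U h) 1 = (Q + 1) * (Q - 1)"
      unfolding d(3) 3 2 by (simp add: field_simps power_numeral_reduce)
    show "num_in (U h) 0 = (Q ^ 2 - Q) / 2 * (Q - 1)"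
      unfolding d(4) 3 2 1 by (simp add: field_simps power_numeral_reduce)
  qed
  show "num (3, 2) = (Q ^ 4 + Q ^ 3) / 2 * (Q - 1)"
    by (subst num, erule d2) (simp add: field_simps power_numeral_reduce)
  show "num (3, 1) = (Q ^ 3 + Q ^ 2) * (Q - 1)"
    by (subst num, erule d1) (simp add: field_simps power_numeral_reduce)
  show "num (3, 0) = (Q ^ 4 - Q ^ 3) / 2 * (Q - 1)"
    by (subst num, erule d0) (simp add: field_simps power_numeral_reduce)
qed

lemma num_45:
  "num (4, 1) = (Q ^ 5 + Q ^ 4 - Q ^ 3 - Q ^ 2) * (Q - 1)"
  "num (5, 0) = (Q ^ 6 - Q ^ 4) * (Q - 1)"
proof -
  let ?U = "{u :: 'a ^ 7. u \<noteq> 0}"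
  have "\<forall>T. T \<subseteq> proj_line \<longrightarrow> card T \<le> 3 \<longrightarrow> card {u \<in> ?U. T \<subseteq> roots u} = CARD('a) ^ (7 - 2 * card T) - 1"
    using card_through_all by blast
  note d = distribution[OF subset_refl, of "\<lambda>j. 7 - 2 * j", OF this]
  have 3: "num_in ?U 3 = (Q ^ 3 - Q) / 6 * (Q - 1)"
    unfolding d(1) by (simp add: field_simps power_numeral_reduce)
  have 2: "num_in ?U 2 = (Q ^ 2 + Q) / 2 * (Q ^ 3 - 1) - 3 * ((Q ^ 3 - Q) / 6 * (Q - 1))"
    unfolding d(2) 3 by (simp add: field_simps power_numeral_reduce)
  have 1: "num_in ?U 1 = (Q + 1) * (Q ^ 5 - 1) - 2 * num_in ?U 2 - 3 * num_in ?U 3"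
    unfolding d(3) by simp
  have 0: "num_in ?U 0 = (Q ^ 7 - 1) - num_in ?U 1 - num_in ?U 2 - num_in ?U 3"
    unfolding d(4) by simp
  have two: "card (roots u) < 2" if "qf u \<noteq> (\<lambda>_. 0)" "\<nexists>h. bform (Suc 0) h \<and> cf u = (\<lambda>v. qf u v * h v)" for u
  proof (rule ccontr)
    assume "\<not> card (roots u) < 2"
    then obtain T where "T \<subseteq> roots u" "card T = 2" using obtain_subset_with_card_n[of 2 "roots u"] by auto
    then obtain v w where "v \<in> roots u" "w \<in> roots u" "v \<noteq> w" by (auto simp: card_2_iff)
    then show False using two_roots_dvd[OF that(1)] that(2) by blast
  qed
  have part: "num_in ?U k = num (2, k) + num (3, k) + num (r, k)" if rk: "(r, k) = (4, 1) \<or> (r, k) = (5, 0)" for r k :: nat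
  proof -
    have roots: "card (roots u) = k" if "u \<noteq> 0" "hyp_type u = (r', k)" "r' \<in> {2, 3, r}" for u r'
      using that rk two[of u] by (auto simp: hyp_type_def split: if_splits simp del: card_0_eq)
    have types: "hyp_type u \<in> {(2, k), (3, k), (r, k)}" if "u \<noteq> 0" "card (roots u) = k" for u
      using that rk by (auto simp: hyp_type_def)
    have "{u \<in> ?U. card (roots u) = k} = {u. u \<noteq> 0 \<and> hyp_type u = (2, k)} \<union> {u. u \<noteq> 0 \<and> hyp_type u = (3, k)}
      \<union> {u. u \<noteq> 0 \<and> hyp_type u = (r, k)}" (is "_ = ?A \<union> ?B \<union> ?C")
      using roots types by blast
    moreover have "card (?A \<union> ?B \<union> ?C) = card ?A + card ?B + card ?C"
    proof -
      have "card (?A \<union> ?B \<union> ?C) = card (?A \<union> ?B) + card ?C"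
        using rk by (intro card_Un_disjoint) auto
      also have "card (?A \<union> ?B) = card ?A + card ?B"
        by (intro card_Un_disjoint) auto
      finally show ?thesis .
    qed
    ultimately show ?thesis by simp
  qed
  show "num (4, 1) = (Q ^ 5 + Q ^ 4 - Q ^ 3 - Q ^ 2) * (Q - 1)"
    using part[of 4 1] unfolding 1 2 3 num_2 num_3 by (simp add: field_simps power_numeral_reduce)
  show "num (5, 0) = (Q ^ 6 - Q ^ 4) * (Q - 1)"
    using part[of 5 0] unfolding 0 1 2 3 num_2 num_3 by (simp add: field_simps power_numeral_reduce)
qed

abbreviation "hyperplanes r k \<equiv> real (card {H. pg_space 5 H \<and> section_type surf conic gens r k H})"

lemma hyperplanes_eq:
  assumes "num (r, k) = x * (Q - 1)" "r \<ge> 2" "r + k \<le> 5"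
  shows "hyperplanes r k = x"
proof -
  have "hyperplanes r k * (Q - 1) = num (r, k)"
    using arg_cong[OF card_section_type[OF assms(2,3)], of real] q_ge_7 by (simp add: of_nat_diff Q)
  then show ?thesis using assms(1) q_ge_7 Q by simp
qed

lemma hyperplane_counts:
  "hyperplanes 5 0 = Q ^ 6 - Q ^ 4"
  "hyperplanes 4 1 = Q ^ 5 + Q ^ 4 - Q ^ 3 - Q ^ 2"
  "hyperplanes 3 0 = (Q ^ 4 - Q ^ 3) / 2"
  "hyperplanes 3 1 = Q ^ 3 + Q ^ 2"
  "hyperplanes 3 2 = (Q ^ 4 + Q ^ 3) / 2"
  "hyperplanes 2 0 = (Q ^ 3 - Q) / 3"
  "hyperplanes 2 1 = Q ^ 3 / 2 + Q / 2 + 1"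
  "hyperplanes 2 2 = Q ^ 2 + Q"
  "hyperplanes 2 3 = (Q ^ 3 - Q) / 6"
  by (rule hyperplanes_eq, rule num_2 num_3 num_45, simp, simp)+

end

section \<open>Lines and normal rational curves on the scroll\<close>

lemma pg_space_gen:
  assumes "v \<in> proj_line"
  shows "pg_space 1 (gen v)"
proof -
  have "A v \<notin> vec.span {B v}"
  proof
    assume "A v \<in> vec.span {B v}"
    then obtain k where "A v = k *s B v" by (auto simp: vec.span_singleton)
    then show False using gen_coeffs_0[of v 1 "- k"] assms by simp
  qed
  then have "vec.dim (gen v) = 2"
    using B_nonzero[OF assms] by (simp add: gen_def vec.dim_insert)
  then show ?thesis by (simp add: pg_space_def subspace_gen)
qed

lemma lines_in_surf: "{l. pg_space 1 l \<and> pg_points l \<subseteq> surf} = gens"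
proof (intro equalityI subsetI)
  fix l assume "l \<in> gens"
  then show "l \<in> {l. pg_space 1 l \<and> pg_points l \<subseteq> surf}"
    using pg_space_gen by (auto simp: gens_def surf_eq)
next
  fix l assume "l \<in> {l. pg_space 1 l \<and> pg_points l \<subseteq> surf}"
  then have l: "vec.subspace l" "vec.dim l = 2" "pg_points l \<subseteq> surf" by (auto simp: pg_space_def)
  have on: "\<exists>v\<in>proj_line. x \<in> gen v" if "x \<in> l" "x \<noteq> 0" for x
    using that l span_in_pg_points[OF l(1), of x] span_in_surf[of x] by blast
  obtain S where S: "S \<subseteq> l" "vec.independent S" "l \<subseteq> vec.span S" "card S = 2"
    using vec.basis_exists[of l] l(2) by metis
  then obtain x1 x2 where x: "S = {x1, x2}" "x1 \<noteq> x2" by (auto simp: card_2_iff)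
  have nz: "x1 \<noteq> 0" "x2 \<noteq> 0" using S(2) x(1) vec.dependent_zero[of S] by auto
  have "x1 + x2 \<noteq> 0"
  proof
    assume "x1 + x2 = 0"
    then have "x1 = - x2" by (simp add: eq_neg_iff_add_eq_0)
    then have "x1 \<in> vec.span {x2}" by (simp add: vec.span_neg vec.span_base)
    moreover have "S - {x1} = {x2}" using x by auto
    ultimately show False using S(2) x(1) by (auto simp: vec.dependent_def)
  qed
  moreover have xl: "x1 \<in> l" "x2 \<in> l" using S x by auto
  moreover have "x1 + x2 \<in> l" using xl l(1) by (simp add: vec.subspace_add)
  ultimately have "\<exists>v\<in>proj_line. x1 \<in> gen v" "\<exists>v\<in>proj_line. x2 \<in> gen v" "\<exists>v\<in>proj_line. x1 + x2 \<in> gen v"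
    by (auto intro!: on nz)
  then obtain v1 v2 v3 where v: "v1 \<in> proj_line" "x1 \<in> gen v1" "v2 \<in> proj_line" "x2 \<in> gen v2"
    "v3 \<in> proj_line" "x1 + x2 \<in> gen v3"
    by blast
  have "v1 = v2"
  proof (rule ccontr)
    assume ne: "v1 \<noteq> v2"
    have ne1: "v3 \<noteq> v1"
    proof
      assume "v3 = v1"
      then have "x1 + x2 - x1 \<in> gen v1" using v by (intro vec.subspace_diff subspace_gen) auto
      then show False using gen_disjoint[of v1 v2 x2] v nz ne by simp
    qed
    have ne2: "v3 \<noteq> v2"
    proof
      assume "v3 = v2"
      then have "x1 + x2 - x2 \<in> gen v2" using v by (intro vec.subspace_diff subspace_gen) auto
      then show False using gen_disjoint[of v1 v2 x1] v nz ne by simp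
    qed
    obtain s1 t1 s2 t2 s3 t3 where st: "x1 = s1 *s A v1 + t1 *s B v1" "x2 = s2 *s A v2 + t2 *s B v2"
      "x1 + x2 = s3 *s A v3 + t3 *s B v3"
      using v unfolding mem_gen by metis
    define s where "s = (\<lambda>v. if v = v1 then s1 else if v = v2 then s2 else - s3)"
    define t where "t = (\<lambda>v. if v = v1 then t1 else if v = v2 then t2 else - t3)"
    have "(\<Sum>v\<in>{v1, v2, v3}. s v *s A v + t v *s B v) = x1 + (x2 + (- s3 *s A v3 + - t3 *s B v3))"
      using ne ne1 ne2 by (simp add: s_def t_def st)
    also have "\<dots> = x1 + x2 - (s3 *s A v3 + t3 *s B v3)" by (simp add: vec.scale_minus_left)
    also have "\<dots> = 0" unfolding st(3)[symmetric] by simp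
    finally have sum0: "(\<Sum>v\<in>{v1, v2, v3}. s v *s A v + t v *s B v) = 0" .
    have K: "{v1, v2, v3} \<subseteq> proj_line" "card {v1, v2, v3} \<le> 3" using v by (simp_all add: card_insert_if)
    have "s v1 = 0" "t v1 = 0" using relation_trivial[OF K sum0, of v1] by blast+
    then have "x1 = 0" by (simp add: st s_def t_def)
    then show False using nz by simp
  qed
  then have "S \<subseteq> gen v1" using x v by simp
  then have "vec.span S \<subseteq> gen v1" by (intro vec.span_minimal subspace_gen)
  then have "l \<subseteq> gen v1" using S by blast
  then have "l = gen v1"
    using vec.subspace_dim_equal[OF l(1) subspace_gen] dim_gen_le[of v1] l(2) by simp
  then show "l \<in> gens" using v by (simp add: gens_def)
qed

lemma card_gens: "card gens = CARD('a) + 1"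
  by (simp add: gens_def card_image[OF inj_gen] card_proj_line)

lemma card_nrc:
  assumes "nrc r N" "r \<ge> 1"
  shows "card (N :: ('a ^ 7) set set) = CARD('a) + 1"
proof -
  obtain n S where n: "nrc_par r n S" "N = points_of n" using nrcE assms(1) by blast
  show ?thesis unfolding n(2) using card_image[OF nrc_par_inj[OF n(1) assms(2)]] card_proj_line by metis
qed

lemma span_in_curve:
  assumes "v \<in> proj_line" "s *s A v + t *s B v \<noteq> 0" "s * F v + t * G v = 0" "F v \<noteq> 0 \<or> G v \<noteq> 0"
  shows "vec.span {s *s A v + t *s B v} \<in> curve F G"
proof -
  obtain k where k: "s *s A v + t *s B v = k *s nvec F G v" using curve_point assms(3,4) by blast
  then have "k \<noteq> 0" using assms(2) by auto
  then have "vec.span {s *s A v + t *s B v} = vec.span {nvec F G v}"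
    unfolding k by (rule span_singleton_scale)
  then show ?thesis using assms(1) by (auto simp: curve_def)
qed

lemma curve_subset_surf:
  assumes "\<And>v. v \<in> proj_line \<Longrightarrow> F v \<noteq> 0 \<or> G v \<noteq> 0"
  shows "curve F G \<subseteq> surf"
proof
  fix P assume "P \<in> curve F G"
  then obtain v where v: "v \<in> proj_line" "P = vec.span {nvec F G v}" by (auto simp: curve_def)
  then show "P \<in> surf"
    unfolding v(2) span_in_surf using assms[OF v(1)] nvec_eq_0[OF v(1), of F G] nvec_in_gen[of F G v] v(1) by blast
qed

lemma curve_scale:
  assumes "k \<noteq> 0"
  shows "curve (\<lambda>v. k * F v) (\<lambda>v. k * G v) = curve F G"
proof -
  have "nvec (\<lambda>v. k * F v) (\<lambda>v. k * G v) v = k *s nvec F G v" for v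
    by (simp add: nvec_def vec_eq_iff algebra_simps)
  then show ?thesis using assms by (simp add: curve_def span_singleton_scale)
qed

lemma curve_eqD:
  assumes eq: "curve F G = curve F' G'"
    and nz: "\<And>v. v \<in> proj_line \<Longrightarrow> F v \<noteq> 0 \<or> G v \<noteq> 0"
    and v: "v \<in> proj_line"
  shows "F v * G' v = F' v * G v"
proof -
  have n0: "nvec F G v \<noteq> 0" using nz[OF v] nvec_eq_0[OF v] by blast
  have "vec.span {nvec F G v} \<in> curve F' G'" unfolding eq[symmetric] using v by (simp add: curve_def)
  then obtain w where w: "w \<in> proj_line" "vec.span {nvec F G v} = vec.span {nvec F' G' w}"
    by (auto simp: curve_def)
  then obtain k where k: "k \<noteq> 0" "nvec F' G' w = k *s nvec F G v"
    using span_singleton_eq_iff[OF n0] by blast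
  have "k *s nvec F G v \<in> gen v" by (intro vec.subspace_scale subspace_gen nvec_in_gen)
  moreover have "k *s nvec F G v \<in> gen w" unfolding k(2)[symmetric] by (rule nvec_in_gen)
  ultimately have "v = w" using gen_disjoint[OF v w(1)] k(1) n0 by simp
  then have "(G' v - k * G v) *s A v + (k * F v - F' v) *s B v = 0"
    using k(2) unfolding \<open>v = w\<close> by (simp add: nvec_def vec_eq_iff algebra_simps)
  then have "G' v - k * G v = 0" "k * F v - F' v = 0" using gen_coeffs_0[OF v] by blast+
  then show ?thesis by (simp add: algebra_simps)
qed

lemma nrc_in_surf_eq_curve:
  assumes N: "nrc_par r n S" "points_of n \<subseteq> surf" "r \<ge> 1" "r \<le> 5"
    and c: "nrc r (curve F G)"
    and FG: "\<And>v. v \<in> proj_line \<Longrightarrow> F v \<noteq> 0 \<or> G v \<noteq> 0"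
    and m: "\<And>v. v \<in> proj_line \<Longrightarrow> \<exists>m. m v \<noteq> 0 \<and> bform 2 (\<lambda>v. m v * F v) \<and> bform 3 (\<lambda>v. m v * G v)"
    and K: "K \<subseteq> proj_line" "card K \<ge> r + 1" "\<And>w. w \<in> K \<Longrightarrow> vec.span {n w} \<in> curve F G"
  shows "points_of n = curve F G"
proof -
  obtain n0 S0 where n0: "nrc_par r n0 S0" "curve F G = (\<lambda>v. vec.span {n0 v}) ` proj_line"
    using nrcE[OF c] by blast
  note S = nrc_par_S[OF N(1)] and S0 = nrc_par_S[OF n0(1)]
  have inS0: "x \<in> S0" if x: "vec.span {x} \<in> curve F G" for x
  proof -
    obtain w where w: "w \<in> proj_line" "vec.span {x} = vec.span {n0 w}" using x n0(2) by auto
    have "x \<in> vec.span {n0 w}" unfolding w(2)[symmetric] by (simp add: vec.span_base)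
    also have "\<dots> \<subseteq> S0" using S0 by (intro vec.span_minimal) auto
    finally show ?thesis .
  qed
  obtain K' where K': "K' \<subseteq> K" "card K' = r + 1" using obtain_subset_with_card_n[OF K(2)] by blast
  have "n ` K' \<subseteq> S0" using K'(1) K(3) inS0 by blast
  moreover have "K' \<subseteq> proj_line" using K'(1) K(1) by blast
  ultimately have "S \<subseteq> S0" using K'(2) S0(1) by (intro nrc_par_span[OF N(1), of K'])
  have S0_hplane: "S0 \<subseteq> hplane u" if u: "\<And>v. dotp u (nvec F G v) = 0" for u
  proof -
    have "r + 1 \<le> card (proj_line :: ('a ^ 2) set)"
      using card_proj_line[where 'a='a] N(4) q_ge_7 by simp
    then obtain K0 :: "('a ^ 2) set" where K0: "K0 \<subseteq> proj_line" "card K0 = r + 1"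
      by (rule obtain_subset_with_card_n)
    have "n0 v \<in> hplane u" if "v \<in> K0" for v
    proof -
      have "vec.span {n0 v} \<in> curve F G" using n0(2) that K0 by auto
      then obtain w where "vec.span {n0 v} = vec.span {nvec F G w}" by (auto simp: curve_def)
      then have "n0 v \<in> vec.span {nvec F G w}" by (metis singletonI vec.span_base)
      then show ?thesis using u by (auto simp: vec.span_singleton hplane_def)
    qed
    then have "n0 ` K0 \<subseteq> hplane u" by blast
    then show ?thesis by (rule nrc_par_span[OF n0(1) K0 _ subspace_hplane])
  qed
  have "points_of n \<subseteq> curve F G"
  proof (rule image_subsetI)
    fix w :: "'a ^ 2" assume w: "w \<in> proj_line"
    have "vec.span {n w} \<in> surf" using N(2) w by blast
    then obtain v where v: "v \<in> proj_line" "n w \<in> gen v" "n w \<noteq> 0" using span_in_surf by blast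
    then obtain s t where st: "n w = s *s A v + t *s B v" using mem_gen by blast
    obtain m where m: "m v \<noteq> 0" "bform 2 (\<lambda>v. m v * F v)" "bform 3 (\<lambda>v. m v * G v)"
      using m[OF v(1)] by blast
    obtain u where u: "qf u = (\<lambda>v. m v * F v)" "cf u = (\<lambda>v. m v * G v)" using ex_hyperplane m by blast
    have "dotp u (nvec F G v) = 0" for v
    proof -
      have "dotp u (nvec F G v) = G v * qf u v - F v * cf u v" by (simp add: nvec_def qf_def cf_def)
      then show ?thesis by (simp add: u)
    qed
    then have "n w \<in> hplane u" using S0_hplane \<open>S \<subseteq> S0\<close> S(3) by blast
    then have "s * qf u v + t * cf u v = 0" unfolding hplane_def st using dotp_gen by simp
    then have "m v * (s * F v + t * G v) = 0" by (simp add: u algebra_simps)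
    then have "s * F v + t * G v = 0" using m(1) by simp
    then show "vec.span {n w} \<in> curve F G"
      using v st FG[OF v(1)] by (simp add: span_in_curve)
  qed
  moreover have "card (points_of n) = card (curve F G)"
    using card_image[OF nrc_par_inj[OF N(1,3)]] card_nrc[OF c N(3)] card_proj_line[where 'a='a] by simp
  ultimately show ?thesis by (intro card_subset_eq) auto
qed

text \<open>Two points of the curve on one generator put that generator into \<open>S\<close>, and three generators
  span a hyperplane; so at most two generators meet the curve twice.\<close>

lemma nrc_distinct_generators:
  assumes np: "nrc_par r n S" "points_of n \<subseteq> surf" and r: "2 \<le> r" "r \<le> 4"
  shows "\<exists>K p s t. K \<subseteq> proj_line \<and> card K = r + 2 \<and> inj_on p K \<and>
    (\<forall>w\<in>K. p w \<in> proj_line \<and> n w = s w *s A (p w) + t w *s B (p w))"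
proof -
  have "\<exists>v s t. v \<in> proj_line \<and> n w = s *s A v + t *s B v" if "w \<in> proj_line" for w
  proof -
    have "vec.span {n w} \<in> surf" using np(2) that by blast
    then show ?thesis unfolding span_in_surf mem_gen by blast
  qed
  then obtain p s t where p: "\<And>w. w \<in> proj_line \<Longrightarrow> p w \<in> proj_line \<and> n w = s w *s A (p w) + t w *s B (p w)"
    by metis
  have pgen: "n w \<in> gen (p w)" if "w \<in> proj_line" for w
    using p[OF that] mem_gen by blast
  define fib where "fib = (\<lambda>v. {w \<in> proj_line. p w = v})"
  have fib_le: "card (fib v) \<le> 2" for v
  proof -
    have "card (fib v) \<le> card {w \<in> proj_line. n w \<in> gen v}"
      by (rule card_mono) (use pgen in \<open>auto simp: fib_def\<close>)
    then show ?thesis using nrc_par_gen[OF np(1) r(1), of v] by simp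
  qed
  let ?D = "p ` proj_line"
  let ?E = "{v \<in> ?D. card (fib v) = 2}"
  have E: "card ?E \<le> 2"
  proof (rule ccontr)
    assume "\<not> ?thesis"
    then obtain T where T: "T \<subseteq> ?E" "card T = 3" using obtain_subset_with_card_n[of 3 ?E] by auto
    have genS: "gen v \<subseteq> S" if v: "v \<in> T" for v
    proof -
      have fv: "fib v \<subseteq> proj_line" "card (fib v) = 2" using v T by (auto simp: fib_def)
      have "gen v \<subseteq> vec.span (n ` fib v)"
      proof (rule vec.card_ge_dim_independent)
        show "n ` fib v \<subseteq> gen v" using pgen by (auto simp: fib_def)
        show "vec.independent (n ` fib v)" using nrc_par_independent(2)[OF np(1) fv(1)] fv(2) r by simp
        have "card (n ` fib v) = 2" using nrc_par_independent(1)[OF np(1) fv(1)] fv(2) r by (simp add: card_image)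
        then show "vec.dim (gen v) \<le> card (n ` fib v)" using dim_gen_le[of v] by simp
      qed
      also have "\<dots> \<subseteq> S" using nrc_par_S[OF np(1)] by (intro vec.span_minimal) auto
      finally show ?thesis .
    qed
    have Tp: "T \<subseteq> proj_line" using T p by auto
    have "annih S \<subseteq> insert 0 {u \<in> {u. u \<noteq> 0}. T \<subseteq> roots u}"
    proof
      fix u assume "u \<in> annih S"
      then have "S \<subseteq> hplane u" by (auto simp: annih_def hplane_def)
      then have "qf u v = 0 \<and> cf u v = 0" if "v \<in> T" for v
        using genS[OF that] gen_subset_hplane by blast
      then have "T \<subseteq> roots u" using Tp unfolding roots_def by blast
      then show "u \<in> insert 0 {u \<in> {u. u \<noteq> 0}. T \<subseteq> roots u}" by simp
    qed
    then have "card (annih S) \<le> card (insert 0 {u \<in> {u. u \<noteq> 0}. T \<subseteq> roots u})" by (intro card_mono) auto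
    also have "\<dots> \<le> Suc (card {u \<in> {u. u \<noteq> 0}. T \<subseteq> roots u})" by (rule card_insert_le_m1) simp_all
    also have "\<dots> = CARD('a)" using card_through_all[OF Tp] T(2) q_ge_7 by simp
    finally have "card (annih S) * CARD('a) ^ (r + 1) \<le> CARD('a) * CARD('a) ^ (r + 1)" by (rule mult_le_mono1)
    also have "\<dots> = CARD('a) ^ (r + 2)" by simp
    also have "\<dots> < CARD('a) ^ CARD(7)" using r q_ge_7 by (intro power_strict_increasing) auto
    finally show False using card_annih[of S] nrc_par_S(2)[OF np(1)] by simp
  qed
  have "CARD('a) + 1 = (\<Sum>w\<in>(proj_line :: ('a ^ 2) set). 1)" by (simp add: card_proj_line)
  also have "\<dots> = (\<Sum>v\<in>?D. \<Sum>w\<in>fib v. 1)" unfolding fib_def by (rule sum.group[symmetric]) auto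
  also have "\<dots> \<le> (\<Sum>v\<in>?D. 1 + (if card (fib v) = 2 then 1 else 0))"
  proof (rule sum_mono)
    fix v show "(\<Sum>w\<in>fib v. 1) \<le> 1 + (if card (fib v) = 2 then 1 else 0 :: nat)"
      using fib_le[of v] by simp
  qed
  also have "\<dots> = card ?D + card ?E" by (subst sum.distrib) (simp add: sum.If_cases Int_def)
  finally have "r + 2 \<le> card ?D" using E q_ge_7 r by simp
  then obtain D' where D': "D' \<subseteq> ?D" "card D' = r + 2" by (rule obtain_subset_with_card_n)
  then obtain K where K: "K \<subseteq> proj_line" "inj_on p K" "D' = p ` K" using subset_image_inj by metis
  then have "card K = r + 2" using D'(2) by (simp add: card_image)
  then show ?thesis using K p by blast
qed

text \<open>The hyperplane \<open>m (F, G)\<close> contains all but one of the points, hence all of them.\<close>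

lemma vanish_extend:
  assumes np: "nrc_par r n S" and K: "K \<subseteq> proj_line" "card K = r + 2" "inj_on p K"
    and p: "\<And>w. w \<in> K \<Longrightarrow> p w \<in> proj_line \<and> n w = s w *s A (p w) + t w *s B (p w)"
    and m: "\<And>m. bform e m \<Longrightarrow> bform 2 (\<lambda>v. m v * F v) \<and> bform 3 (\<lambda>v. m v * G v)"
    and K0: "K0 \<subseteq> K" "r + 2 \<le> card K0 + e + 1" "\<And>w. w \<in> K0 \<Longrightarrow> s w * F (p w) + t w * G (p w) = 0"
    and w: "w \<in> K"
  shows "s w * F (p w) + t w * G (p w) = 0"
proof (cases "w \<in> K0")
  case False
  obtain c where c: "(\<Sum>v\<in>K. c v *s n v) = 0" "\<And>v. v \<in> K \<Longrightarrow> c v \<noteq> 0"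
    using nrc_par_dependency[OF np K(1,2)] by blast
  let ?R = "K - K0 - {w}"
  have cK: "card (K - K0) = r + 2 - card K0" using K0(1) K(2) by (simp add: card_Diff_subset)
  have "card ?R \<le> e" using cK K0(2) w False by (simp add: card_Diff_singleton)
  then have R1: "card (p ` ?R) \<le> e" using card_image_le[of ?R p] by simp
  have R2: "p w \<notin> p ` ?R" using K(3) w by (auto dest: inj_onD)
  have R3: "p ` ?R \<subseteq> proj_line" using p by auto
  obtain M where M: "bform e M" "M (p w) \<noteq> 0" "\<And>v. v \<in> p ` ?R \<Longrightarrow> M v = 0"
    using bform_separate[OF conjunct1[OF p[OF w]] R3 R2 R1] by metis
  obtain u where u: "qf u = (\<lambda>v. M v * F v)" "cf u = (\<lambda>v. M v * G v)" using ex_hyperplane m[OF M(1)] by blast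
  have d: "dotp u (n v) = M (p v) * (s v * F (p v) + t v * G (p v))" if "v \<in> K" for v
  proof -
    have "dotp u (n v) = s v * qf u (p v) + t v * cf u (p v)" using p[OF that] dotp_gen by simp
    then show ?thesis by (simp add: u algebra_simps)
  qed
  have "0 = dotp u (\<Sum>v\<in>K. c v *s n v)" unfolding c(1) by simp
  also have "\<dots> = (\<Sum>v\<in>K. c v * dotp u (n v))" by (simp add: dotp_sum)
  also have "\<dots> = c w * dotp u (n w) + (\<Sum>v\<in>K - {w}. c v * dotp u (n v))"
    using w by (intro sum.remove) auto
  also have "(\<Sum>v\<in>K - {w}. c v * dotp u (n v)) = 0"
  proof (rule sum.neutral, rule ballI)
    fix v assume v: "v \<in> K - {w}"
    show "c v * dotp u (n v) = 0"
    proof (cases "v \<in> K0")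
      case True
      then show ?thesis using d[of v] K0(3)[of v] v by simp
    next
      case False
      then have "M (p v) = 0" using v by (intro M(3)) auto
      then show ?thesis using d[of v] v by simp
    qed
  qed
  finally have "dotp u (n w) = 0" using c(2)[OF w] by simp
  then show ?thesis using d[OF w] M(2) by simp
qed (rule K0(3))

lemma ex_vanishing_pair:
  fixes p :: "'a ^ 2 \<Rightarrow> 'a ^ 2" and s t :: "'a ^ 2 \<Rightarrow> 'a"
  assumes "card K < d + e + 2" "d \<le> CARD('a)" "e \<le> CARD('a)"
  obtains F G where "bform d F" "bform e G" "F \<noteq> (\<lambda>_. 0) \<or> G \<noteq> (\<lambda>_. 0)"
    "\<And>w. w \<in> K \<Longrightarrow> s w * F (p w) + t w * G (p w) = 0"
proof -
  define W :: "(('a ^ 2 \<Rightarrow> 'a) \<times> ('a ^ 2 \<Rightarrow> 'a)) set" where "W = {F. bform d F} \<times> {G. bform e G}"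
  define \<Psi> where "\<Psi> = (\<lambda>FG :: ('a ^ 2 \<Rightarrow> 'a) \<times> ('a ^ 2 \<Rightarrow> 'a). restrict (\<lambda>w. s w * fst FG (p w) + t w * snd FG (p w)) K)"
  have "card W = CARD('a) ^ (d + 1) * CARD('a) ^ (e + 1)"
    using card_bform[OF assms(2)] card_bform[OF assms(3)]
    by (simp add: W_def card_cartesian_product)
  also have "\<dots> = CARD('a) ^ (d + e + 2)" by (simp add: power_add)
  finally have cW: "card W = CARD('a) ^ (d + e + 2)" .
  have "\<Psi> ` W \<subseteq> K \<rightarrow>\<^sub>E UNIV" by (auto simp: \<Psi>_def)
  then have "card (\<Psi> ` W) \<le> card (K \<rightarrow>\<^sub>E (UNIV :: 'a set))" by (intro card_mono finite_PiE) auto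
  also have "\<dots> = CARD('a) ^ card K" by (simp add: card_funcsetE)
  also have "\<dots> < card W" unfolding cW using assms q_ge_7 by (intro power_strict_increasing) auto
  finally have "\<not> inj_on \<Psi> W" by (metis card_image less_irrefl)
  then obtain F G F' G' where *: "(F, G) \<in> W" "(F', G') \<in> W" "(F, G) \<noteq> (F', G')" "\<Psi> (F, G) = \<Psi> (F', G')"
    by (auto simp: inj_on_def)
  have "s w * (F (p w) - F' (p w)) + t w * (G (p w) - G' (p w)) = 0" if "w \<in> K" for w
    using fun_cong[OF *(4), of w] that by (simp add: \<Psi>_def algebra_simps)
  moreover have "bform d (\<lambda>v. F v - F' v)" "bform e (\<lambda>v. G v - G' v)"
    using * by (auto simp: W_def intro: bform_diff)
  moreover have "(\<lambda>v. F v - F' v) \<noteq> (\<lambda>_. 0) \<or> (\<lambda>v. G v - G' v) \<noteq> (\<lambda>_. 0)"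
    using *(3) by (auto simp: fun_eq_iff)
  ultimately show ?thesis using that[of "\<lambda>v. F v - F' v" "\<lambda>v. G v - G' v"] by blast
qed

lemma point_in_conic_plane:
  obtains X where "vec.dim X = 3" "\<And>v k. v \<in> proj_line \<Longrightarrow> k *s A v \<in> X"
proof -
  obtain n S where n: "nrc_par 2 n S" "conic = points_of n" using nrcE[OF nrc_conic] by blast
  note S = nrc_par_S[OF n(1)]
  have "k *s A v \<in> S" if v: "v \<in> proj_line" for v k
  proof -
    have "vec.span {A v} \<in> conic" using v by (simp add: conic_def)
    then obtain w where "vec.span {A v} = vec.span {n w}" using n(2) by auto
    then have "A v \<in> vec.span {n w}" by (metis singletonI vec.span_base)
    moreover have "vec.span {n w} \<subseteq> S" using S by (intro vec.span_minimal) auto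
    ultimately show ?thesis using S(1) by (auto intro: vec.subspace_scale)
  qed
  then show ?thesis using that[of S] S(2) by simp
qed

lemma point_in_cubic_space:
  assumes h: "bform (Suc 0) h"
  obtains X where "vec.dim X = 4"
    "\<And>v s t. v \<in> proj_line \<Longrightarrow> s + t * h v = 0 \<Longrightarrow> s *s A v + t *s B v \<in> X"
proof -
  obtain n S where n: "nrc_par 3 n S" "curve (\<lambda>_. 1) h = points_of n"
    using nrcE[OF nrc_curve_3[OF h]] by blast
  note S = nrc_par_S[OF n(1)]
  have "s *s A v + t *s B v \<in> S" if v: "v \<in> proj_line" "s + t * h v = 0" for v s t
  proof (cases "s *s A v + t *s B v = 0")
    case True
    then show ?thesis using S(1) by (simp add: vec.subspace_0)
  next
    case False
    then have "vec.span {s *s A v + t *s B v} \<in> curve (\<lambda>_. 1) h"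
      using v by (intro span_in_curve) auto
    then obtain w where "vec.span {s *s A v + t *s B v} = vec.span {n w}" using n(2) by auto
    then have "s *s A v + t *s B v \<in> vec.span {n w}" by (metis singletonI vec.span_base)
    moreover have "vec.span {n w} \<subseteq> S" using S by (intro vec.span_minimal) auto
    ultimately show ?thesis by blast
  qed
  then show ?thesis using that[of S] S(2) by simp
qed

lemma card_image_roots:
  fixes G :: "'a ^ 2 \<Rightarrow> 'a" and K :: "('a ^ 2) set"
  assumes "bform d G" "G \<noteq> (\<lambda>_. 0)" "inj_on p K" "p ` K \<subseteq> proj_line"
  shows "card K \<le> card {w \<in> K. G (p w) \<noteq> 0} + d"
proof -
  have "card {w \<in> K. G (p w) = 0} = card (p ` {w \<in> K. G (p w) = 0})"
    using assms(3) by (intro card_image[symmetric]) (auto intro: inj_on_subset)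
  also have "\<dots> \<le> card {v \<in> proj_line. G v = 0}" using assms(4) by (intro card_mono) auto
  also have "\<dots> \<le> d" by (rule bform_card_roots[OF assms(1,2)])
  finally have "card {w \<in> K. G (p w) = 0} \<le> d" .
  moreover have "card K = card {w \<in> K. G (p w) \<noteq> 0} + card {w \<in> K. G (p w) = 0}"
    by (subst card_Un_disjoint[symmetric]) (auto intro: arg_cong[of _ _ card])
  ultimately show ?thesis by simp
qed

lemma first_form_nonzero:
  assumes np: "nrc_par r n S" "r \<ge> 3" and K: "K \<subseteq> proj_line" "card K \<ge> d + 4" "inj_on p K"
    and p: "\<And>w. w \<in> K \<Longrightarrow> p w \<in> proj_line \<and> n w = s w *s A (p w) + t w *s B (p w)"
    and G: "bform d G" "F \<noteq> (\<lambda>_. 0) \<or> G \<noteq> (\<lambda>_. 0)"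
    and z: "\<And>w. w \<in> K \<Longrightarrow> s w * F (p w) + t w * G (p w) = 0"
  shows "F \<noteq> (\<lambda>_. 0)"
proof
  assume F: "F = (\<lambda>_. 0)"
  then have G0: "G \<noteq> (\<lambda>_. 0)" using G(2) by simp
  obtain X where X: "vec.dim X = 3" "\<And>v k. v \<in> proj_line \<Longrightarrow> k *s A v \<in> X" using point_in_conic_plane by blast
  have "card {w \<in> K. G (p w) \<noteq> 0} \<le> vec.dim X"
  proof (rule nrc_par_inter[OF np(1)])
    show "n ` {w \<in> K. G (p w) \<noteq> 0} \<subseteq> X"
    proof (rule image_subsetI)
      fix w assume w: "w \<in> {w \<in> K. G (p w) \<noteq> 0}"
      then have "t w = 0" using z[of w] F by auto
      then show "n w \<in> X" using p[of w] w X(2) by simp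
    qed
  qed (use K X np in auto)
  then show False using card_image_roots[OF G(1) G0 K(3)] p K(2) X(1) by fastforce
qed

lemma nrc_2_in_surf:
  assumes N: "nrc 2 N" "N \<subseteq> surf"
  shows "N = conic"
proof -
  obtain n S where n: "nrc_par 2 n S" "N = points_of n" using nrcE[OF N(1)] by blast
  have sub: "points_of n \<subseteq> surf" using N(2) n(2) by simp
  have r: "2 \<le> (2 :: nat)" "(2 :: nat) \<le> 4" by simp_all
  obtain K p s t where K: "K \<subseteq> proj_line" "card K = 2 + 2" "inj_on p K"
    and p0: "\<forall>w\<in>K. p w \<in> proj_line \<and> n w = s w *s A (p w) + t w *s B (p w)"
    using nrc_distinct_generators[OF n(1) sub r] by blast
  note p = p0[rule_format]
  have z: "s w * 0 + t w * 1 = 0" if "w \<in> K" for w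
    by (rule vanish_extend[OF n(1) K p, where e = 3 and ?K0.0 = "{}"]) (use that bform_zero in auto)
  have "points_of n = curve (\<lambda>_. 0) (\<lambda>_. 1)"
  proof (rule nrc_in_surf_eq_curve[OF n(1) _ _ _ _ _ _ K(1)])
    show "nrc 2 (curve (\<lambda>_. 0) (\<lambda>_. 1))" unfolding curve_conic by (rule nrc_conic)
    show "\<exists>m. m v \<noteq> 0 \<and> bform 2 (\<lambda>v. m v * 0) \<and> bform 3 (\<lambda>v. m v * 1)" if v: "v \<in> proj_line" for v :: "'a ^ 2"
      using bform_separate[of v "{}" 3] v bform_zero[of 2] by auto
    fix w assume w: "w \<in> K"
    have "n w \<noteq> 0" using nrc_par_nonzero[OF n(1)] w K(1) by blast
    then show "vec.span {n w} \<in> curve (\<lambda>_. 0) (\<lambda>_. 1)"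
      using p[OF w] z[OF w] span_in_curve[of "p w" "s w" "t w" "\<lambda>_. 0" "\<lambda>_. 1"] by simp
  qed (use N(2) n(2) K in auto)
  then show ?thesis using n(2) curve_conic by simp
qed

lemma nrc_3_in_surf:
  assumes N: "nrc 3 N" "N \<subseteq> surf"
  obtains h where "bform (Suc 0) h" "N = curve (\<lambda>_. 1) h"
proof -
  obtain n S where n: "nrc_par 3 n S" "N = points_of n" using nrcE[OF N(1)] by blast
  have sub: "points_of n \<subseteq> surf" using N(2) n(2) by simp
  have r: "2 \<le> (3 :: nat)" "(3 :: nat) \<le> 4" by simp_all
  obtain K p s t where K: "K \<subseteq> proj_line" "card K = 3 + 2" "inj_on p K"
    and p0: "\<forall>w\<in>K. p w \<in> proj_line \<and> n w = s w *s A (p w) + t w *s B (p w)"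
    using nrc_distinct_generators[OF n(1) sub r] by blast
  note p = p0[rule_format]
  obtain K0 where K0: "K0 \<subseteq> K" "card K0 = 2" using obtain_subset_with_card_n[of 2 K] K(2) by auto
  obtain F G where FG: "bform 0 F" "bform (Suc 0) G" "F \<noteq> (\<lambda>_. 0) \<or> G \<noteq> (\<lambda>_. 0)"
    "\<And>w. w \<in> K0 \<Longrightarrow> s w * F (p w) + t w * G (p w) = 0"
    using ex_vanishing_pair[of K0 0 "Suc 0" s p t] K0(2) by auto
  have m: "bform 2 (\<lambda>v. m v * F v) \<and> bform 3 (\<lambda>v. m v * G v)" if "bform 2 m" for m
    using bform_mult[OF that FG(1)] bform_mult[OF that FG(2)] by (simp add: numeral_3_eq_3 numeral_2_eq_2)
  have z: "s w * F (p w) + t w * G (p w) = 0" if "w \<in> K" for w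
    by (rule vanish_extend[OF n(1) K p m K0(1) _ FG(4)]) (use that K0(2) in auto)
  obtain f where f: "F = (\<lambda>_. f)" using FG(1) by (auto simp: bform_const)
  have "F \<noteq> (\<lambda>_. 0)"
    by (rule first_form_nonzero[OF n(1) _ K(1) _ K(3) p FG(2,3) z]) (use K(2) in auto)
  then have f0: "f \<noteq> 0" using f by auto
  define h where "h = (\<lambda>v. (1 / f) * G v)"
  have h: "bform (Suc 0) h" unfolding h_def by (rule bform_cmult[OF FG(2)])
  have "points_of n = curve (\<lambda>_. 1) h"
  proof (rule nrc_in_surf_eq_curve[OF n(1) _ _ _ nrc_curve_3[OF h] _ _ K(1)])
    show "\<exists>m. m v \<noteq> 0 \<and> bform 2 (\<lambda>v. m v * 1) \<and> bform 3 (\<lambda>v. m v * h v)" if v: "v \<in> proj_line" for v :: "'a ^ 2"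
    proof -
      obtain m where m: "bform 2 m" "m v \<noteq> 0" using bform_separate[of v "{}" 2] v by auto
      then show ?thesis using bform_mult[OF m(1) h] by (auto simp: numeral_3_eq_3 numeral_2_eq_2)
    qed
    fix w assume w: "w \<in> K"
    have "n w \<noteq> 0" using nrc_par_nonzero[OF n(1)] w K(1) by blast
    moreover have "s w * 1 + t w * h (p w) = 0" using z[OF w] f0 by (simp add: h_def f field_simps)
    ultimately show "vec.span {n w} \<in> curve (\<lambda>_. 1) h"
      using p[OF w] span_in_curve[of "p w" "s w" "t w" "\<lambda>_. 1" h] by simp
  qed (use N(2) n(2) K in auto)
  then show ?thesis using n(2) h that by blast
qed

lemma nrc_4_in_surf:
  assumes N: "nrc 4 N" "N \<subseteq> surf"
  obtains v0 G where "v0 \<in> proj_line" "bform 2 G" "G v0 \<noteq> 0" "N = curve (cross2 v0) G"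
proof -
  obtain n S where n: "nrc_par 4 n S" "N = points_of n" using nrcE[OF N(1)] by blast
  have sub: "points_of n \<subseteq> surf" using N(2) n(2) by simp
  have r: "2 \<le> (4 :: nat)" "(4 :: nat) \<le> 4" by simp_all
  obtain K p s t where K: "K \<subseteq> proj_line" "card K = 4 + 2" "inj_on p K"
    and p0: "\<forall>w\<in>K. p w \<in> proj_line \<and> n w = s w *s A (p w) + t w *s B (p w)"
    using nrc_distinct_generators[OF n(1) sub r] by blast
  note p = p0[rule_format]
  obtain K0 where K0: "K0 \<subseteq> K" "card K0 = 4" using obtain_subset_with_card_n[of 4 K] K(2) by auto
  obtain F G where FG: "bform (Suc 0) F" "bform 2 G" "F \<noteq> (\<lambda>_. 0) \<or> G \<noteq> (\<lambda>_. 0)"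
    "\<And>w. w \<in> K0 \<Longrightarrow> s w * F (p w) + t w * G (p w) = 0"
    using ex_vanishing_pair[of K0 "Suc 0" 2 s p t] K0(2) q_ge_7 by auto
  have m: "bform 2 (\<lambda>v. m v * F v) \<and> bform 3 (\<lambda>v. m v * G v)" if "bform (Suc 0) m" for m
    using bform_mult[OF that FG(1)] bform_mult[OF that FG(2)] by (simp add: numeral_3_eq_3 numeral_2_eq_2)
  have z: "s w * F (p w) + t w * G (p w) = 0" if "w \<in> K" for w
    by (rule vanish_extend[OF n(1) K p m K0(1) _ FG(4)]) (use that K0(2) in auto)
  have F0: "F \<noteq> (\<lambda>_. 0)"
    by (rule first_form_nonzero[OF n(1) _ K(1) _ K(3) p FG(2,3) z]) (use K(2) in auto)
  obtain v0 where v0: "v0 \<in> proj_line" "F v0 = 0" by (rule bform_1_root[OF FG(1)])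
  note v00 = proj_line_nonzero[OF v0(1)]
  obtain k where k: "\<And>v. F v = k * cross2 v0 v" by (rule bform_1_eq[OF FG(1) v00 v0(2)]) blast
  have k0: "k \<noteq> 0" using F0 k by auto
  have G0: "G v0 \<noteq> 0"
  proof
    assume "G v0 = 0"
    then obtain G1 where G1: "bform (Suc 0) G1" "\<And>v. G v = cross2 v0 v * G1 v"
      using bform_factor[of "Suc 0" G v0] FG(2) v00 by (metis numeral_2_eq_2)
    define h where "h = (\<lambda>v. (1 / k) * G1 v)"
    have h: "bform (Suc 0) h" unfolding h_def by (rule bform_cmult[OF G1(1)])
    have Gh: "G v = F v * h v" for v using k0 by (simp add: G1 k h_def)
    obtain X where X: "vec.dim X = 4"
      "\<And>v s t. v \<in> proj_line \<Longrightarrow> s + t * h v = 0 \<Longrightarrow> s *s A v + t *s B v \<in> X"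
      using point_in_cubic_space[OF h] by blast
    have "card {w \<in> K. F (p w) \<noteq> 0} \<le> vec.dim X"
    proof (rule nrc_par_inter[OF n(1)])
      show "n ` {w \<in> K. F (p w) \<noteq> 0} \<subseteq> X"
      proof (rule image_subsetI)
        fix w assume w: "w \<in> {w \<in> K. F (p w) \<noteq> 0}"
        then have "F (p w) * (s w + t w * h (p w)) = 0" using z[of w] by (simp add: Gh algebra_simps)
        then have "s w + t w * h (p w) = 0" using w by simp
        then show "n w \<in> X" using p[of w] w X(2) by simp
      qed
    qed (use K X in auto)
    then show False using card_image_roots[OF FG(1) F0 K(3)] p K(2) X(1) by fastforce
  qed
  have nz: "F v \<noteq> 0 \<or> G v \<noteq> 0" if "v \<in> proj_line" for v
    using k k0 G0 cross2_eq_0_iff[OF v0(1) that] by auto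
  have "points_of n = curve F G"
  proof (rule nrc_in_surf_eq_curve[OF n(1) _ _ _ nrc_curve_4[OF FG(1,2) v0 G0 k0 k] nz _ K(1)])
    show "\<exists>m. m v \<noteq> 0 \<and> bform 2 (\<lambda>v. m v * F v) \<and> bform 3 (\<lambda>v. m v * G v)" if v: "v \<in> proj_line" for v :: "'a ^ 2"
    proof -
      obtain M where "bform (Suc 0) M" "M v \<noteq> 0" using bform_separate[of v "{}" "Suc 0"] v by auto
      then show ?thesis using m by blast
    qed
    fix w assume w: "w \<in> K"
    have "n w \<noteq> 0" using nrc_par_nonzero[OF n(1)] w K(1) by blast
    then show "vec.span {n w} \<in> curve F G"
      using p[OF w] z[OF w] nz[of "p w"] span_in_curve[of "p w" "s w" "t w" F G] by simp
  qed (use N(2) n(2) K in auto)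
  moreover have "F = (\<lambda>v. k * cross2 v0 v)" by (rule ext) (rule k)
  then have "curve F G = curve (cross2 v0) (\<lambda>v. (1 / k) * G v)"
    using curve_scale[OF k0, of "cross2 v0" "\<lambda>v. (1 / k) * G v"] k0 by simp
  ultimately have "N = curve (cross2 v0) (\<lambda>v. (1 / k) * G v)" using n(2) by simp
  then show ?thesis using that[OF v0(1) bform_cmult[OF FG(2), of "1 / k"]] G0 k0 by simp
qed

lemma proj_line_minus_point:
  assumes "v0 \<in> proj_line"
  shows "card (proj_line - {v0} :: ('a ^ 2) set) = CARD('a)"
  using assms card_proj_line[where 'a='a] by (simp add: card_Diff_singleton)

lemma card_cubics: "card {N. nrc 3 N \<and> N \<subseteq> surf} = CARD('a) ^ 2"
proof -
  have "{N. nrc 3 N \<and> N \<subseteq> surf} = curve (\<lambda>_. 1) ` {h. bform (Suc 0) h}"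
  proof (intro equalityI subsetI)
    fix N assume "N \<in> {N. nrc 3 N \<and> N \<subseteq> surf}"
    then obtain h where "bform (Suc 0) h" "N = curve (\<lambda>_. 1) h" using nrc_3_in_surf by blast
    then show "N \<in> curve (\<lambda>_. 1) ` {h. bform (Suc 0) h}" by blast
  next
    fix N assume "N \<in> curve (\<lambda>_. 1) ` {h. bform (Suc 0) h}"
    then obtain h where h: "bform (Suc 0) h" "N = curve (\<lambda>_. 1) h" by blast
    then show "N \<in> {N. nrc 3 N \<and> N \<subseteq> surf}"
      using nrc_curve_3[OF h(1)] curve_subset_surf[of "\<lambda>_. 1" h] by simp
  qed
  moreover have "inj_on (curve (\<lambda>_. 1)) {h. bform (Suc 0) h}"
  proof (rule inj_onI)
    fix h h' :: "'a ^ 2 \<Rightarrow> 'a"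
    assume h: "h \<in> {h. bform (Suc 0) h}" "h' \<in> {h. bform (Suc 0) h}" "curve (\<lambda>_. 1) h = curve (\<lambda>_. 1) h'"
    have "h v = h' v" if "v \<in> proj_line" for v using curve_eqD[OF h(3) _ that] by simp
    then show "h = h'"
      using bform_ext[of "Suc 0" h h' proj_line] h card_proj_line[where 'a='a] q_ge_7 by simp
  qed
  ultimately have "card {N. nrc 3 N \<and> N \<subseteq> surf} = card {h :: 'a ^ 2 \<Rightarrow> 'a. bform (Suc 0) h}"
    by (simp add: card_image)
  then show ?thesis using card_bform[where 'a='a and d = "Suc 0"] q_ge_7 by (simp add: power2_eq_square)
qed

lemma card_quartics: "card {N. nrc 4 N \<and> N \<subseteq> surf} = (CARD('a) + 1) * (CARD('a) ^ 3 - CARD('a) ^ 2)"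
proof -
  let ?W = "SIGMA v0 : (proj_line :: ('a ^ 2) set). {G :: 'a ^ 2 \<Rightarrow> 'a. bform 2 G \<and> G v0 \<noteq> 0}"
  define c where "c = (\<lambda>p :: ('a ^ 2) \<times> ('a ^ 2 \<Rightarrow> 'a). curve (cross2 (fst p)) (snd p))"
  have nz: "cross2 v0 v \<noteq> 0 \<or> G v \<noteq> 0" if "v0 \<in> proj_line" "G v0 \<noteq> 0" "v \<in> proj_line" for v0 v :: "'a ^ 2" and G :: "'a ^ 2 \<Rightarrow> 'a"
    using that cross2_eq_0_iff[of v0 v] by auto
  have "{N. nrc 4 N \<and> N \<subseteq> surf} = c ` ?W"
  proof (intro equalityI subsetI)
    fix N assume "N \<in> {N. nrc 4 N \<and> N \<subseteq> surf}"
    then have "nrc 4 N" "N \<subseteq> surf" by auto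
    then obtain v0 G where "v0 \<in> proj_line" "bform 2 G" "G v0 \<noteq> 0" "N = curve (cross2 v0) G"
      by (rule nrc_4_in_surf)
    then have "(v0, G) \<in> ?W" "N = c (v0, G)" by (simp_all add: c_def)
    then show "N \<in> c ` ?W" by blast
  next
    fix N assume "N \<in> c ` ?W"
    then obtain v0 G where p: "v0 \<in> proj_line" "bform 2 G" "G v0 \<noteq> 0" "N = curve (cross2 v0) G"
      by (auto simp: c_def)
    have "nrc 4 N" unfolding p(4)
      by (rule nrc_curve_4[of _ _ v0 1]) (use p bform_cross2 in auto)
    moreover have "N \<subseteq> surf" unfolding p(4) by (rule curve_subset_surf) (use nz[of v0 G] p in blast)
    ultimately show "N \<in> {N. nrc 4 N \<and> N \<subseteq> surf}" by simp
  qed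
  moreover have "inj_on c ?W"
  proof (rule inj_onI)
    fix p p' assume pp: "p \<in> ?W" "p' \<in> ?W" "c p = c p'"
    obtain v G v' G' where e: "p = (v, G)" "p' = (v', G')" by (cases p, cases p') auto
    have v: "v \<in> proj_line" "bform 2 G" "G v \<noteq> 0" "v' \<in> proj_line" "bform 2 G'" "G' v' \<noteq> 0"
      using pp e by auto
    have cc: "curve (cross2 v) G = curve (cross2 v') G'" using pp(3) by (simp add: c_def e)
    have eq: "cross2 v w * G' w = cross2 v' w * G w" if "w \<in> proj_line" for w
      by (rule curve_eqD[OF cc _ that]) (use nz[of v G] v in blast)
    have "cross2 v' v = 0" using eq[OF v(1)] v by simp
    then have vv: "v' = v" using cross2_eq_0_iff[OF v(4,1)] by simp
    have "G w = G' w" if "w \<in> proj_line - {v}" for w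
      using eq[of w] that cross2_eq_0_iff[OF v(1), of w] unfolding vv by auto
    then have "G = G'"
      by (intro bform_ext[OF v(2,5), of "proj_line - {v}"]) (use proj_line_minus_point[OF v(1)] q_ge_7 in auto)
    then show "p = p'" using vv e by simp
  qed
  ultimately have "card {N. nrc 4 N \<and> N \<subseteq> surf} = card ?W" by (simp add: card_image)
  also have "\<dots> = (\<Sum>v0\<in>(proj_line :: ('a ^ 2) set). card {G :: 'a ^ 2 \<Rightarrow> 'a. bform 2 G \<and> G v0 \<noteq> 0})"
    by (rule card_SigmaI) auto
  also have "\<dots> = (\<Sum>v0\<in>(proj_line :: ('a ^ 2) set). CARD('a) ^ 3 - CARD('a) ^ 2)"
  proof (rule sum.cong[OF refl])
    fix v0 :: "'a ^ 2" assume v0: "v0 \<in> proj_line"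
    have "{G :: 'a ^ 2 \<Rightarrow> 'a. bform 2 G \<and> G v0 \<noteq> 0} = {G. bform 2 G} - {G. bform 2 G \<and> (\<forall>v\<in>{v0}. G v = 0)}" by auto
    also have "card \<dots> = card {G :: 'a ^ 2 \<Rightarrow> 'a. bform 2 G} - card {G. bform 2 G \<and> (\<forall>v\<in>{v0}. G v = 0)}"
      by (rule card_Diff_subset) auto
    also have "\<dots> = CARD('a) ^ 3 - CARD('a) ^ 2"
      using card_bform[where 'a='a and d = 2] card_bform_vanishing[of "{v0}" 2] v0 q_ge_7 by simp
    finally show "card {G :: 'a ^ 2 \<Rightarrow> 'a. bform 2 G \<and> G v0 \<noteq> 0} = CARD('a) ^ 3 - CARD('a) ^ 2" .
  qed
  also have "\<dots> = (CARD('a) + 1) * (CARD('a) ^ 3 - CARD('a) ^ 2)" by (simp add: card_proj_line)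
  finally show ?thesis .
qed

lemma nrc_5_hyp_type:
  assumes np: "nrc_par 5 n (hplane u)" "points_of n \<subseteq> surf" and u: "u \<noteq> 0"
  shows "hyp_type u = (5, 0)"
proof -
  have on: "\<exists>v s t. v \<in> proj_line \<and> n w = s *s A v + t *s B v \<and> s * qf u v + t * cf u v = 0" if w: "w \<in> proj_line" for w
  proof -
    have "vec.span {n w} \<in> surf" using np(2) w by blast
    then obtain v s t where v: "v \<in> proj_line" "n w = s *s A v + t *s B v" unfolding span_in_surf mem_gen by blast
    have "dotp u (n w) = 0" using nrc_par_S(3)[OF np(1)] by (simp add: hplane_def)
    then show ?thesis using v dotp_gen by metis
  qed
  have few: "card (proj_line :: ('a ^ 2) set) \<le> vec.dim X" if "\<And>w. w \<in> proj_line \<Longrightarrow> n w \<in> X" "vec.dim X \<le> 5" for X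
    by (rule nrc_par_inter[OF np(1)]) (use that in auto)
  have roots0: "roots u = {}"
  proof (rule ccontr)
    assume "roots u \<noteq> {}"
    then obtain v0 where v0: "v0 \<in> proj_line" "qf u v0 = 0" "cf u v0 = 0" by (auto simp: roots_def)
    note v00 = proj_line_nonzero[OF v0(1)]
    obtain F where F: "bform (Suc 0) F" "\<And>x. qf u x = cross2 v0 x * F x"
      using bform_factor[OF bform_qf' v00 v0(2)] by blast
    obtain G where G: "bform (Suc (Suc 0)) G" "\<And>x. cf u x = cross2 v0 x * G x"
      using bform_factor[OF bform_cf' v00 v0(3)] by blast
    obtain z :: "'a ^ 2" where z: "z \<in> proj_line" "z \<noteq> v0" by (rule proj_line_other)
    have "bform 2 (\<lambda>x. cross2 z x * F x)" "bform 3 (\<lambda>x. cross2 z x * G x)"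
      using bform_mult[OF bform_cross2 F(1)] bform_mult[OF bform_cross2 G(1)]
      by (simp_all add: numeral_3_eq_3 numeral_2_eq_2)
    then obtain u' where u': "qf u' = (\<lambda>x. cross2 z x * F x)" "cf u' = (\<lambda>x. cross2 z x * G x)"
      using ex_hyperplane by blast
    have FG: "F \<noteq> (\<lambda>_. 0) \<or> G \<noteq> (\<lambda>_. 0)"
    proof (rule ccontr)
      assume "\<not> ?thesis"
      then have "qf u = qf 0" "cf u = cf 0" using F(2) G(2) by (auto simp: qf_0 cf_0)
      then show False using qf_cf_inj u by blast
    qed
    have indep: "u' \<noteq> k *s u" for k
    proof
      assume k: "u' = k *s u"
      define L where "L = (\<lambda>x. cross2 z x - k * cross2 v0 x)"
      have L: "bform (Suc 0) L" unfolding L_def by (intro bform_diff bform_cmult bform_cross2)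
      have "L v0 \<noteq> 0" using cross2_eq_0_iff[OF z(1) v0(1)] z by (simp add: L_def)
      then have L0: "L \<noteq> (\<lambda>_. 0)" by auto
      have q: "qf u' x = k * qf u x" "cf u' x = k * cf u x" for x by (simp_all add: k qf_def cf_def)
      have "L x * F x = 0" for x using q(1)[of x] by (simp add: u' F L_def algebra_simps)
      then have "F = (\<lambda>_. 0)" using bform_mult_eq_0[OF L F(1)] L0 q_ge_7 by simp
      moreover have "L x * G x = 0" for x using q(2)[of x] by (simp add: u' G L_def algebra_simps)
      then have "G = (\<lambda>_. 0)" using bform_mult_eq_0[OF L G(1)] L0 q_ge_7 by simp
      ultimately show False using FG by simp
    qed
    then have u'0: "u' \<noteq> 0" using indep[of 0] by simp
    have "hplane u \<noteq> hplane u'" using hplane_eq_iff[OF u u'0] indep by blast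
    define X where "X = hplane u \<inter> hplane u'"
    have sX: "vec.subspace X" unfolding X_def by (intro vec.subspace_inter subspace_hplane)
    have dX: "vec.dim X \<le> 5"
    proof (rule ccontr)
      assume a: "\<not> ?thesis"
      have d: "vec.dim (hplane u) = 6" "vec.dim (hplane u') = 6" using dim_hplane[OF u] dim_hplane[OF u'0] by simp_all
      have "X = hplane u" using vec.subspace_dim_equal[OF sX subspace_hplane[of u]] a d by (simp add: X_def)
      moreover have "X = hplane u'" using vec.subspace_dim_equal[OF sX subspace_hplane[of u']] a d by (simp add: X_def)
      ultimately show False using \<open>hplane u \<noteq> hplane u'\<close> by simp
    qed
    let ?K1 = "{w \<in> proj_line. n w \<in> gen v0}" and ?K2 = "{w \<in> proj_line. n w \<in> X}"
    have "proj_line \<subseteq> ?K1 \<union> ?K2"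
    proof
      fix w :: "'a ^ 2" assume w: "w \<in> proj_line"
      obtain v s t where v: "v \<in> proj_line" "n w = s *s A v + t *s B v" "s * qf u v + t * cf u v = 0"
        using on[OF w] by blast
      show "w \<in> ?K1 \<union> ?K2"
      proof (cases "v = v0")
        case True
        then show ?thesis using w v mem_gen by blast
      next
        case False
        have "cross2 v0 v * (s * F v + t * G v) = 0" using v(3) by (simp add: F G algebra_simps)
        then have "s * F v + t * G v = 0" using False cross2_eq_0_iff[OF v0(1) v(1)] by simp
        moreover have "dotp u' (n w) = cross2 z v * (s * F v + t * G v)"
          unfolding v(2) dotp_gen u' by (simp add: algebra_simps)
        ultimately have "n w \<in> hplane u'" by (simp add: hplane_def)
        then show ?thesis using w nrc_par_S(3)[OF np(1)] by (simp add: X_def)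
      qed
    qed
    then have "card (proj_line :: ('a ^ 2) set) \<le> card (?K1 \<union> ?K2)" by (intro card_mono) auto
    also have "\<dots> \<le> card ?K1 + card ?K2" by (rule card_Un_le)
    also have "card ?K1 \<le> 2" by (rule nrc_par_gen[OF np(1)]) simp
    also have "card ?K2 \<le> vec.dim X" by (rule nrc_par_inter[OF np(1)]) (use dX in auto)
    finally show False using dX card_proj_line[where 'a='a] q_ge_7 by simp
  qed
  have nr: "qf u v \<noteq> 0 \<or> cf u v \<noteq> 0" if "v \<in> proj_line" for v using roots0 that by (auto simp: roots_def)
  have nz: "qf u \<noteq> (\<lambda>_. 0)"
  proof
    assume q: "qf u = (\<lambda>_. 0)"
    obtain X where X: "vec.dim X = 3" "\<And>v k. v \<in> proj_line \<Longrightarrow> k *s A v \<in> X" using point_in_conic_plane by blast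
    have "n w \<in> X" if w: "w \<in> proj_line" for w
    proof -
      obtain v s t where v: "v \<in> proj_line" "n w = s *s A v + t *s B v" "s * qf u v + t * cf u v = 0"
        using on[OF w] by blast
      then have "t = 0" using nr[OF v(1)] q by simp
      then show ?thesis using X(2) v by simp
    qed
    then show False using few[of X] X(1) card_proj_line[where 'a='a] q_ge_7 by simp
  qed
  have nd: "\<nexists>h. bform (Suc 0) h \<and> cf u = (\<lambda>v. qf u v * h v)"
  proof
    assume "\<exists>h. bform (Suc 0) h \<and> cf u = (\<lambda>v. qf u v * h v)"
    then obtain h where h: "bform (Suc 0) h" "cf u = (\<lambda>v. qf u v * h v)" by blast
    obtain X where X: "vec.dim X = 4"
      "\<And>v s t. v \<in> proj_line \<Longrightarrow> s + t * h v = 0 \<Longrightarrow> s *s A v + t *s B v \<in> X"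
      using point_in_cubic_space[OF h(1)] by blast
    have "n w \<in> X" if w: "w \<in> proj_line" for w
    proof -
      obtain v s t where v: "v \<in> proj_line" "n w = s *s A v + t *s B v" "s * qf u v + t * cf u v = 0"
        using on[OF w] by blast
      have "qf u v * (s + t * h v) = 0" using v(3) by (simp add: h(2) algebra_simps)
      moreover have "qf u v \<noteq> 0" using nr[OF v(1)] by (auto simp: h(2))
      ultimately show ?thesis using X(2)[OF v(1)] v(2) by simp
    qed
    then show False using few[of X] X(1) card_proj_line[where 'a='a] q_ge_7 by simp
  qed
  show ?thesis by (simp only: hyp_type_def nz nd roots0 if_False card.empty zero_neq_one)
qed

lemma card_quintics:
  "card {N. nrc 5 N \<and> N \<subseteq> surf} = card {H. pg_space 5 H \<and> section_type surf conic gens 5 0 H}"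
proof -
  let ?H = "{H. pg_space 5 H \<and> section_type surf conic gens 5 0 H}"
  define c where "c = (\<lambda>H. pg_points H \<inter> surf)"
  have nrc: "nrc 5 (c H)" if H: "H \<in> ?H" for H
  proof -
    obtain u where u: "u \<noteq> 0" "H = hplane u" using H pg_space_5E by blast
    have "section_type surf conic gens 5 0 (hplane u)" using H u by simp
    then show ?thesis unfolding c_def u(2) by (rule section_type_facts) simp_all
  qed
  have "{N. nrc 5 N \<and> N \<subseteq> surf} = c ` ?H"
  proof (intro equalityI subsetI)
    fix N assume "N \<in> {N. nrc 5 N \<and> N \<subseteq> surf}"
    then have N: "nrc 5 N" "N \<subseteq> surf" by auto
    obtain n S where n: "nrc_par 5 n S" "N = points_of n" using nrcE[OF N(1)] by blast
    note S = nrc_par_S[OF n(1)]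
    have pS: "pg_space 5 S" using S by (simp add: pg_space_def)
    obtain u where u: "u \<noteq> 0" "S = hplane u" by (rule pg_space_5E[OF pS])
    have "hyp_type u = (5, 0)" by (rule nrc_5_hyp_type) (use n u N in auto)
    then have SH: "S \<in> ?H" using section_type_iff[OF u(1), of 5 0] u(2) pS by simp
    have "N \<subseteq> c S"
    proof
      fix P assume P: "P \<in> N"
      then obtain v where v: "v \<in> proj_line" "P = vec.span {n v}" using n(2) by auto
      have "P \<in> pg_points S"
        unfolding v(2) span_in_pg_points[OF S(1)] using S(3) nrc_par_nonzero[OF n(1) v(1)] by blast
      then show "P \<in> c S" using P N(2) by (auto simp: c_def)
    qed
    then have "N = c S"
      by (intro card_subset_eq) (use card_nrc[OF N(1)] card_nrc[OF nrc[OF SH]] in auto)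
    then show "N \<in> c ` ?H" using SH by blast
  next
    fix N assume "N \<in> c ` ?H"
    then show "N \<in> {N. nrc 5 N \<and> N \<subseteq> surf}" using nrc by (auto simp: c_def)
  qed
  moreover have "inj_on c ?H"
  proof (rule inj_onI)
    fix H H' assume H: "H \<in> ?H" "H' \<in> ?H" "c H = c H'"
    obtain n S where n: "nrc_par 5 n S" "c H = points_of n" using nrcE[OF nrc[OF H(1)]] by blast
    note S = nrc_par_S[OF n(1)]
    obtain K :: "('a ^ 2) set" where K: "K \<subseteq> proj_line" "card K = 5 + 1"
      using obtain_subset_with_card_n[of "5 + 1" "proj_line :: ('a ^ 2) set"] card_proj_line[where 'a='a] q_ge_7 by auto
    have *: "S = X" if X: "X \<in> ?H" "c X = c H" for X
    proof -
      have sX: "vec.subspace X" "vec.dim X = 6" using X by (auto simp: pg_space_def)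
      have "n v \<in> X" if "v \<in> proj_line" for v
      proof -
        have "vec.span {n v} \<in> c X" using that n(2) X(2) by simp
        then show ?thesis using span_in_pg_points[OF sX(1)] by (auto simp: c_def)
      qed
      then have "n ` K \<subseteq> X" using K(1) by blast
      then have "S \<subseteq> X" by (rule nrc_par_span[OF n(1) K _ sX(1)])
      then show ?thesis using vec.subspace_dim_equal[OF S(1) sX(1)] S(2) sX(2) by simp
    qed
    have "S = H" by (rule *[OF H(1) refl])
    moreover have "S = H'" by (rule *[OF H(2) H(3)[symmetric]])
    ultimately show "H = H'" by simp
  qed
  ultimately show ?thesis by (simp add: card_image)
qed

end

section \<open>Finite fields\<close>

lemma of_nat_CARD_eq_0: "of_nat CARD('a) = (0 :: 'a::{field,finite})"
proof -
  have "(\<Sum>x\<in>(UNIV :: 'a set). x) = (\<Sum>x\<in>UNIV. x + 1)"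
    by (rule sum.reindex_bij_witness[of _ "\<lambda>x. x + 1" "\<lambda>x. x - 1"]) auto
  then show ?thesis by (simp add: sum.distrib)
qed

lemma power_CARD_minus_1:
  fixes x :: "'a::{field,finite}"
  assumes "x \<noteq> 0"
  shows "x ^ (CARD('a) - 1) = 1"
proof -
  have "(\<Prod>y\<in>UNIV - {0 :: 'a}. y) = (\<Prod>y\<in>UNIV - {0}. x * y)"
    by (rule prod.reindex_bij_witness[of _ "\<lambda>y. x * y" "\<lambda>y. y / x"]) (use assms in auto)
  also have "\<dots> = x ^ (CARD('a) - 1) * (\<Prod>y\<in>UNIV - {0}. y)"
    by (simp add: prod.distrib card_Diff_singleton)
  finally show ?thesis by simp
qed

lemma sum_power_eq_0:
  assumes "i < CARD('a) - 1"
  shows "(\<Sum>x\<in>(UNIV :: 'a::{field,finite} set). x ^ i) = 0"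
proof (cases "i = 0")
  case True
  then show ?thesis by (simp add: of_nat_CARD_eq_0)
next
  case False
  define F :: "'a ^ 2 \<Rightarrow> 'a" where "F = (\<lambda>v. v $ 2 ^ i - v $ 1 ^ i)"
  have F: "bform i F"
    unfolding F_def using bform_diff[OF bform_power[OF bform_coord(2), of i] bform_power[OF bform_coord(1), of i]] by simp
  have "\<exists>u :: 'a. u \<noteq> 0 \<and> u ^ i \<noteq> 1"
  proof (rule ccontr)
    assume "\<not> (\<exists>u :: 'a. u \<noteq> 0 \<and> u ^ i \<noteq> 1)"
    then have all: "u ^ i = 1" if "u \<noteq> 0" for u :: 'a using that by blast
    have inj: "inj_on (\<lambda>t::'a. vector [1, t] :: 'a ^ 2) (UNIV - {0})"
      by (rule inj_onI) (metis vector_2(2))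
    have "F (vector [0, 1]) = 0"
    proof (rule bform_eq_0[OF F, of "(\<lambda>t. vector [1, t]) ` (UNIV - {0})"])
      show "i < card ((\<lambda>t::'a. vector [1, t] :: 'a ^ 2) ` (UNIV - {0}))"
        using assms by (simp add: card_image[OF inj] card_Diff_singleton)
      fix v :: "'a ^ 2" assume "v \<in> (\<lambda>t. vector [1, t]) ` (UNIV - {0})"
      then obtain t where "t \<noteq> 0" "v = vector [1, t]" by blast
      then show "F v = 0" by (simp add: F_def all)
    qed (auto simp: proj_line_def)
    then show False using False by (simp add: F_def power_0_left)
  qed
  then obtain u :: 'a where u: "u \<noteq> 0" "u ^ i \<noteq> 1" by blast
  have "(\<Sum>x\<in>(UNIV :: 'a set). x ^ i) = (\<Sum>x\<in>UNIV. (u * x) ^ i)"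
    by (rule sum.reindex_bij_witness[of _ "\<lambda>x. u * x" "\<lambda>x. x / u"]) (use u in auto)
  also have "\<dots> = u ^ i * (\<Sum>x\<in>UNIV. x ^ i)" by (simp add: power_mult_distrib sum_distrib_left)
  finally have "(1 - u ^ i) * (\<Sum>x\<in>(UNIV :: 'a set). x ^ i) = 0" by (simp add: algebra_simps)
  then show ?thesis using u by simp
qed

lemma CARD_field_neq_6: "CARD('a::{field,finite}) \<noteq> 6"
proof
  assume c: "CARD('a) = 6"
  have "(- 1 :: 'a) ^ 5 = 1" using power_CARD_minus_1[of "- 1 :: 'a"] c by simp
  then have two: "(1 :: 'a) + 1 = 0" by (simp add: eval_nat_numeral)
  have dbl: "x + x = 0" for x :: 'a
  proof -
    have "x + x = x * (1 + 1)" by (simp add: distrib_left)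
    then show ?thesis using two by simp
  qed
  then have neg: "- x = x" for x :: 'a by (metis minus_unique)
  have "card {0, 1 :: 'a} < CARD('a)" using c by simp
  then obtain x :: 'a where x: "x \<notin> {0, 1}" by (metis UNIV_eq_I order.irrefl)
  have "card {0, 1, x, x + 1} \<le> 4" by (simp add: card_insert_if)
  then have "card {0, 1, x, x + 1} \<noteq> CARD('a)" unfolding c by linarith
  then obtain y where y: "y \<notin> {0, 1, x, x + 1}" by (metis UNIV_eq_I)
  have e: "a + b = 0 \<longleftrightarrow> a = b" for a b :: 'a using neg by (metis eq_neg_iff_add_eq_0)
  have "distinct [0, 1, x, x + 1, y, y + 1, y + x]"
  proof -
    have "y + 1 \<noteq> x" using y neg by (metis add_diff_cancel_right' diff_conv_add_uminus insertCI)
    moreover have "y + x \<noteq> 1" using y neg by (metis add.commute add_diff_cancel_right' diff_conv_add_uminus insertCI)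
    moreover have "y + x \<noteq> x + 1" using y by (simp add: add.commute)
    ultimately show ?thesis using x y by (auto simp: e)
  qed
  then have "card (set [0, 1, x, x + 1, y, y + 1, y + x]) = 7" by (subst distinct_card) auto
  then show False using card_mono[of UNIV "set [0, 1, x, x + 1, y, y + 1, y + x]"] c by simp
qed

section \<open>Isotropic vectors of ternary quadratic forms\<close>

inductive ternary_poly :: "nat \<Rightarrow> ('a::field \<Rightarrow> 'a \<Rightarrow> 'a \<Rightarrow> 'a) \<Rightarrow> bool" where
  zero: "ternary_poly d (\<lambda>x y z. 0)"
| monom_add: "i + j + k = d \<Longrightarrow> ternary_poly d F \<Longrightarrow>
    ternary_poly d (\<lambda>x y z. c * (x ^ i * y ^ j * z ^ k) + F x y z)"

lemma ternary_poly_add: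
  "ternary_poly d F \<Longrightarrow> ternary_poly d G \<Longrightarrow> ternary_poly d (\<lambda>x y z. F x y z + G x y z)"
proof (induction rule: ternary_poly.induct)
  case (monom_add i j k d F c)
  then show ?case using ternary_poly.monom_add[of i j k d "\<lambda>x y z. F x y z + G x y z" c]
    by (simp add: add.assoc)
qed simp

lemma ternary_poly_monom_mult:
  "ternary_poly d F \<Longrightarrow> i' + j' + k' = e \<Longrightarrow>
    ternary_poly (e + d) (\<lambda>x y z. c' * (x ^ i' * y ^ j' * z ^ k') * F x y z)"
proof (induction rule: ternary_poly.induct)
  case (zero d)
  then show ?case using ternary_poly.zero by simp
next
  case (monom_add i j k d F c)
  have "ternary_poly (e + d) (\<lambda>x y z. (c' * c) * (x ^ (i' + i) * y ^ (j' + j) * z ^ (k' + k)) +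
    c' * (x ^ i' * y ^ j' * z ^ k') * F x y z)"
    by (rule ternary_poly.monom_add) (use monom_add in auto)
  then show ?case by (simp add: power_add algebra_simps)
qed

lemma ternary_poly_mult:
  "ternary_poly e G \<Longrightarrow> ternary_poly d F \<Longrightarrow> ternary_poly (e + d) (\<lambda>x y z. G x y z * F x y z)"
proof (induction rule: ternary_poly.induct)
  case (zero e)
  then show ?case using ternary_poly.zero by simp
next
  case (monom_add i j k e G c)
  then show ?case
    using ternary_poly_add[OF ternary_poly_monom_mult[of d F i j k e c]] by (simp add: distrib_right)
qed

lemma ternary_poly_power: "ternary_poly e G \<Longrightarrow> ternary_poly (e * m) (\<lambda>x y z. G x y z ^ m)"
proof (induction m)
  case 0
  have "ternary_poly 0 (\<lambda>x y z. 1 * (x ^ 0 * y ^ 0 * z ^ 0) + (0 :: 'a))"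
    by (rule ternary_poly.monom_add[OF _ ternary_poly.zero]) simp
  then show ?case by simp
next
  case (Suc m)
  then show ?case using ternary_poly_mult[of e G "e * m"] by simp
qed

lemma ternary_poly_quadratic:
  "ternary_poly 2 (\<lambda>x y z. a * x ^ 2 + b * y ^ 2 + c * z ^ 2 + d * (x * y) + e * (x * z) + f * (y * z))"
proof -
  have m: "ternary_poly 2 (\<lambda>x y z. c * (x ^ i * y ^ j * z ^ k))" if "i + j + k = 2" for i j k and c :: 'a
    using ternary_poly.monom_add[OF that ternary_poly.zero, of c] by simp
  show ?thesis
    using m[of 2 0 0 a] m[of 0 2 0 b] m[of 0 0 2 c] m[of 1 1 0 d] m[of 1 0 1 e] m[of 0 1 1 f]
    by (intro ternary_poly_add) simp_all
qed

lemma sum_ternary_poly_eq_0: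
  assumes "ternary_poly d F" "d < 3 * (CARD('a::{field,finite}) - 1)"
  shows "(\<Sum>x\<in>UNIV. \<Sum>y\<in>UNIV. \<Sum>z\<in>UNIV. F x y z) = (0 :: 'a)"
  using assms
proof (induction rule: ternary_poly.induct)
  case (monom_add i j k d F c)
  have "(\<Sum>x\<in>(UNIV :: 'a set). \<Sum>y\<in>(UNIV :: 'a set). \<Sum>z\<in>(UNIV :: 'a set). c * (x ^ i * y ^ j * z ^ k)) =
    c * ((\<Sum>x\<in>UNIV. x ^ i) * ((\<Sum>y\<in>UNIV. y ^ j) * (\<Sum>z\<in>UNIV. z ^ k)))"
    by (simp only: mult.assoc[symmetric] sum_distrib_left[symmetric] sum_distrib_right[symmetric])
  moreover have "i < CARD('a) - 1 \<or> j < CARD('a) - 1 \<or> k < CARD('a) - 1" using monom_add by linarith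
  ultimately have "(\<Sum>x\<in>(UNIV :: 'a set). \<Sum>y\<in>(UNIV :: 'a set). \<Sum>z\<in>(UNIV :: 'a set). c * (x ^ i * y ^ j * z ^ k)) = 0"
    using sum_power_eq_0[where 'a='a] by auto
  then show ?case using monom_add by (simp add: sum.distrib)
qed simp

text \<open>Chevalley's argument: for an anisotropic form \<open>q\<close> the function \<open>q ^ (CARD('a) - 1)\<close> is the
  indicator of the non-zero vectors, whose sum is \<open>-1\<close>.\<close>

lemma ternary_isotropic:
  fixes a b c d e f :: "'a::{field,finite}"
  shows "\<exists>x y z. (x, y, z) \<noteq> (0, 0, 0) \<and>
    a * x ^ 2 + b * y ^ 2 + c * z ^ 2 + d * (x * y) + e * (x * z) + f * (y * z) = 0"
proof (rule ccontr)
  define q where "q = (\<lambda>x y z. a * x ^ 2 + b * y ^ 2 + c * z ^ 2 + d * (x * y) + e * (x * z) + f * (y * z))"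
  let ?m = "CARD('a) - 1"
  assume "\<not> ?thesis"
  then have q: "q x y z \<noteq> 0" if "(x, y, z) \<noteq> (0, 0, 0)" for x y z
    using that unfolding q_def by blast
  have "ternary_poly (2 * ?m) (\<lambda>x y z. q x y z ^ ?m)"
    unfolding q_def by (intro ternary_poly_power ternary_poly_quadratic)
  moreover have m: "?m > 0" using CARD_field_ge_2[where 'a='a] by simp
  ultimately have "(\<Sum>x\<in>UNIV. \<Sum>y\<in>UNIV. \<Sum>z\<in>UNIV. q x y z ^ ?m) = 0"
    by (intro sum_ternary_poly_eq_0[of "2 * ?m"]) auto
  moreover have "q x y z ^ ?m = 1 - (if x = 0 then if y = 0 then if z = 0 then 1 else 0 else 0 else 0)" for x y z
  proof (cases "(x, y, z) = (0, 0, 0)")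
    case True
    then show ?thesis using m by (simp add: q_def)
  next
    case False
    then show ?thesis using power_CARD_minus_1[OF q[OF False]] by auto
  qed
  ultimately have "(\<Sum>x\<in>(UNIV :: 'a set). \<Sum>y\<in>(UNIV :: 'a set). \<Sum>z\<in>(UNIV :: 'a set).
    1 - (if x = 0 then if y = 0 then if z = 0 then 1 else 0 else 0 else 0) :: 'a) = 0" by simp
  moreover have "(\<Sum>x\<in>(UNIV :: 'a set). \<Sum>y\<in>(UNIV :: 'a set). \<Sum>z\<in>(UNIV :: 'a set).
    (if x = 0 then if y = 0 then if z = 0 then 1 else 0 else 0 else 0) :: 'a) = 1"
  proof -
    have "(\<Sum>z\<in>(UNIV :: 'a set). (if x = 0 then if y = 0 then if z = 0 then 1 else 0 else 0 else 0) :: 'a)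
      = (if x = 0 then if y = 0 then 1 else 0 else 0)" for x y :: 'a by simp
    moreover have "(\<Sum>y\<in>(UNIV :: 'a set). (if x = 0 then if y = 0 then 1 else 0 else 0) :: 'a)
      = (if x = 0 then 1 else 0)" for x :: 'a by simp
    ultimately show ?thesis by simp
  qed
  moreover have "(\<Sum>x\<in>(UNIV :: 'a set). \<Sum>y\<in>(UNIV :: 'a set). \<Sum>z\<in>(UNIV :: 'a set). 1 :: 'a) = 0"
    by (simp add: of_nat_CARD_eq_0)
  ultimately show False by (simp only: sum_subtractf) simp
qed

section \<open>Non-degenerate conics are normal rational curves\<close>

definition bil :: "'a::field ^ 'n ^ 'n \<Rightarrow> 'a ^ 'n \<Rightarrow> 'a ^ 'n \<Rightarrow> 'a" where
  "bil A x y = (\<Sum>i\<in>UNIV. \<Sum>j\<in>UNIV. A $ i $ j * x $ i * y $ j)"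

lemma quad_form_bil: "quad_form A x = bil A x x"
  by (simp add: quad_form_def bil_def)

lemma bil_simps [simp]:
  "bil A (x + y) z = bil A x z + bil A y z"
  "bil A z (x + y) = bil A z x + bil A z y"
  "bil A (x - y) z = bil A x z - bil A y z"
  "bil A z (x - y) = bil A z x - bil A z y"
  "bil A (k *s x) z = k * bil A x z"
  "bil A z (k *s x) = k * bil A z x"
  "bil A 0 z = 0"
  "bil A z 0 = 0"
  by (simp_all add: bil_def sum.distrib sum_subtractf sum_distrib_left algebra_simps)

lemma sum_atMost_2: "(\<Sum>i\<le>2. f i) = f 0 + f 1 + f (2 :: nat)"
  by (simp add: eval_nat_numeral)

lemma span_basis_2:
  fixes b :: "nat \<Rightarrow> 'a::field ^ 'n"
  assumes "pg_basis 2 b S" "x \<in> S"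
  obtains k l m where "x = k *s b 0 + l *s b 1 + m *s b 2"
proof -
  have "b ` {..2} = {b 0, b 1, b 2}" by (auto simp: eval_nat_numeral atMost_Suc)
  then have "x \<in> vec.span {b 0, b 1, b 2}" using assms by (simp add: pg_basis_def)
  then obtain k l m where "x - k *s b 0 - l *s b 1 = m *s b 2"
    by (auto simp: vec.span_insert vec.span_singleton)
  then have "x = k *s b 0 + l *s b 1 + m *s b 2" by (simp add: algebra_simps)
  then show ?thesis using that by blast
qed

lemma basis_2_in:
  assumes "pg_basis 2 b S"
  shows "k *s b 0 + l *s b 1 + m *s b 2 \<in> S"
  using assms unfolding pg_basis_def
  by (metis (no_types, lifting) atMost_iff imageI le_numeral_extra(3) one_le_numeral order_refl vec.span_add vec.span_base vec.span_scale zero_le)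

lemma basis_2_coeff_0:
  assumes "pg_basis 2 b S" "k *s b 0 + l *s b 1 + m *s b 2 = 0"
  shows "k = 0" "l = 0" "m = 0"
proof -
  define c where "c = (\<lambda>i :: nat. if i = 0 then k else if i = 1 then l else m)"
  have "(\<Sum>i\<le>2. c i *s b i) = 0" using assms(2) by (simp add: sum_atMost_2 c_def)
  then have "c i = 0" if "i \<le> 2" for i
    using independent_family_coeff_0[of b "{..2}" c i] assms(1) that by (simp add: pg_basis_def)
  from this[of 0] this[of 1] this[of 2] show "k = 0" "l = 0" "m = 0" by (simp_all add: c_def)
qed

lemma conic_zero_set:
  fixes b :: "nat \<Rightarrow> 'a::field ^ 'n"
  assumes S: "pg_basis 2 b S" "vec.subspace S"
    and Q: "\<And>k l m. quad_form A (k *s b 0 + l *s b 1 + m *s b 2) = c * (l ^ 2 - k * m)" and c: "c \<noteq> 0"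
  shows "{P \<in> pg_points S. \<forall>x\<in>P. quad_form A x = 0} = nrc_points 2 b"
proof -
  define n where "n = (\<lambda>v :: 'a ^ 2. (v $ 1 ^ 2) *s b 0 + (v $ 1 * v $ 2) *s b 1 + (v $ 2 ^ 2) *s b 2)"
  have N: "nrc_points 2 b = {vec.span {n v} | v. v \<noteq> 0}"
    by (simp add: nrc_points_def nrc_point_def sum_atMost_2 n_def)
  have Qk: "quad_form A (k *s x) = k ^ 2 * quad_form A x" for k x
    by (simp add: quad_form_bil power2_eq_square)
  have n0: "n v \<noteq> 0" if "v \<noteq> 0" for v
  proof
    assume "n v = 0"
    then have "v $ 1 ^ 2 = 0" "v $ 2 ^ 2 = 0" using basis_2_coeff_0[OF S(1)] unfolding n_def by blast+
    then show False using that by (auto simp: vec_eq_iff forall_2)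
  qed
  show ?thesis unfolding N
  proof (intro equalityI subsetI)
    fix P assume P: "P \<in> {P \<in> pg_points S. \<forall>x\<in>P. quad_form A x = 0}"
    then obtain x where x: "x \<noteq> 0" "x \<in> S" "P = vec.span {x}" using pg_points_eq[OF S(2)] by auto
    obtain k l m where klm: "x = k *s b 0 + l *s b 1 + m *s b 2" using span_basis_2[OF S(1) x(2)] by blast
    have "quad_form A x = 0" using P x(3) vec.span_base[of x "{x}"] by blast
    then have eq: "l ^ 2 = k * m" using Q c unfolding klm by simp
    show "P \<in> {vec.span {n v} | v. v \<noteq> 0}"
    proof (cases "k = 0")
      case True
      then have "l = 0" using eq by simp
      then have m0: "m \<noteq> 0" and xm: "x = m *s b 2" using x(1) klm True by auto
      have "n (vector [0, m]) = m *s x" by (simp add: n_def xm power2_eq_square)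
      then have "P = vec.span {n (vector [0, m])}" using span_singleton_scale[OF m0, of x] x(3) by simp
      moreover have "vector [0, m] \<noteq> (0 :: 'a ^ 2)" using m0 by (auto simp: vec_eq_iff forall_2)
      ultimately show ?thesis by blast
    next
      case False
      have "n (vector [k, l]) = k *s x" using eq by (simp add: n_def klm vec_eq_iff power2_eq_square algebra_simps)
      then have "P = vec.span {n (vector [k, l])}" using span_singleton_scale[OF False, of x] x(3) by simp
      moreover have "vector [k, l] \<noteq> (0 :: 'a ^ 2)" using False by (auto simp: vec_eq_iff forall_2)
      ultimately show ?thesis by blast
    qed
  next
    fix P assume "P \<in> {vec.span {n v} | v. v \<noteq> 0}"
    then obtain v where v: "v \<noteq> 0" "P = vec.span {n v}" by blast
    have "n v \<in> S" unfolding n_def by (rule basis_2_in[OF S(1)])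
    then have "P \<in> pg_points S" using n0[OF v(1)] unfolding v(2) span_in_pg_points[OF S(2)] by blast
    moreover have "quad_form A (n v) = 0" unfolding n_def Q by (simp add: power_mult_distrib)
    then have "\<forall>x\<in>P. quad_form A x = 0" unfolding v(2) by (auto simp: vec.span_singleton Qk)
    ultimately show "P \<in> {P \<in> pg_points S. \<forall>x\<in>P. quad_form A x = 0}" by simp
  qed
qed

lemma nrc_imp_nondegenerate_conic:
  fixes N :: "('a::field ^ 'n) set set"
  assumes "nrc 2 N"
  shows "nondegenerate_conic N"
proof -
  obtain S b where S: "pg_space 2 S" "pg_basis 2 b S" "N = nrc_points 2 b" using assms by (auto simp: nrc_def)
  have b: "inj_on b {..2}" "vec.independent (b ` {..2})" using S(2) by (auto simp: pg_basis_def)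
  have "\<exists>u. \<forall>i\<le>2. dotp u (b i) = (if i = j then 1 else 0)" for j
  proof -
    obtain u where u: "\<And>w. w \<in> b ` {..2} \<Longrightarrow> dotp u w = (if inv_into {..2} b w = j then 1 else 0)"
      using dotp_interpolate[OF b(2), of "\<lambda>w. if inv_into {..2} b w = j then 1 else 0"] by blast
    have "dotp u (b i) = (if i = j then 1 else 0)" if "i \<le> 2" for i
      using u[of "b i"] inv_into_f_f[OF b(1), of i] that by simp
    then show ?thesis by blast
  qed
  then obtain u where u: "\<And>j i. i \<le> 2 \<Longrightarrow> dotp (u j) (b i) = (if i = j then 1 else 0)" by metis
  define A :: "'a ^ 'n ^ 'n" where "A = (\<chi> i j. u 1 $ i * u 1 $ j - u 0 $ i * u 2 $ j)"
  have QA: "quad_form A x = dotp (u 1) x ^ 2 - dotp (u 0) x * dotp (u 2) x" for x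
    by (simp add: quad_form_def A_def dotp_def power2_eq_square sum_product algebra_simps sum_subtractf)
  have Q: "quad_form A (k *s b 0 + l *s b 1 + m *s b 2) = 1 * (l ^ 2 - k * m)" for k l m
    by (simp add: QA u)
  have "z = 0" if z: "z \<in> S" "quad_form A z = 0"
    "\<forall>x\<in>S. quad_form A (x + z) - quad_form A x - quad_form A z = 0" for z
  proof -
    obtain k l m where klm: "z = k *s b 0 + l *s b 1 + m *s b 2" using span_basis_2[OF S(2) z(1)] by blast
    have b0: "b 0 \<in> S" "b 2 \<in> S" using basis_2_in[OF S(2), of 1 0 0] basis_2_in[OF S(2), of 0 0 1] by auto
    have "m = 0" using z(3)[rule_format, OF b0(1)] by (simp add: QA klm u algebra_simps)
    moreover have "k = 0" using z(3)[rule_format, OF b0(2)] by (simp add: QA klm u algebra_simps)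
    moreover have "l = 0" using z(2) \<open>k = 0\<close> unfolding klm Q by simp
    ultimately show ?thesis by (simp add: klm)
  qed
  moreover have "N = {P \<in> pg_points S. \<forall>x\<in>P. quad_form A x = 0}"
    unfolding S(3) using S(1) by (intro conic_zero_set[symmetric, OF S(2) _ Q]) (auto simp: pg_space_def)
  ultimately show ?thesis unfolding nondegenerate_conic_def using S(1) by blast
qed

text \<open>An isotropic vector \<open>p\<close> is completed to a hyperbolic pair \<open>p, r\<close>; the plane is the orthogonal
  sum of their span and the line of \<open>e\<close>.\<close>

lemma nondegenerate_conic_imp_nrc:
  fixes D :: "('a::{field,finite} ^ 'n) set set"
  assumes "nondegenerate_conic D"
  shows "nrc 2 D"
proof -
  obtain S A where S: "pg_space 2 S"
    and nd: "\<And>z. z \<in> S \<Longrightarrow> quad_form A z = 0 \<Longrightarrow>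
      (\<And>x. x \<in> S \<Longrightarrow> quad_form A (x + z) - quad_form A x - quad_form A z = 0) \<Longrightarrow> z = 0"
    and D: "D = {P \<in> pg_points S. \<forall>x\<in>P. quad_form A x = 0}"
    using assms unfolding nondegenerate_conic_def by blast
  define B where "B = (\<lambda>x y. bil A x y + bil A y x)"
  have B: "quad_form A (x + z) - quad_form A x - quad_form A z = B x z" for x z
    by (simp add: B_def quad_form_bil)
  have sS: "vec.subspace S" "vec.dim S = 3" using S by (auto simp: pg_space_def)
  obtain T where T: "T \<subseteq> S" "vec.independent T" "S \<subseteq> vec.span T" "card T = 3"
    using vec.basis_exists[of S] sS(2) by metis
  obtain t0 t1 t2 where t: "T = {t0, t1, t2}" "t0 \<noteq> t1" "t1 \<noteq> t2" "t0 \<noteq> t2" using T(4) by (auto simp: card_3_iff)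
  obtain x y z where xyz: "(x, y, z) \<noteq> (0, 0, 0)"
    "quad_form A t0 * x ^ 2 + quad_form A t1 * y ^ 2 + quad_form A t2 * z ^ 2 + B t0 t1 * (x * y) + B t0 t2 * (x * z) + B t1 t2 * (y * z) = 0"
    using ternary_isotropic by metis
  define p where "p = x *s t0 + y *s t1 + z *s t2"
  have pS: "p \<in> S" unfolding p_def using T(1) t(1) sS(1) by (intro vec.subspace_add vec.subspace_scale) auto
  have Qp: "quad_form A p = 0"
    using xyz(2) unfolding p_def by (simp add: quad_form_bil B_def power2_eq_square algebra_simps)
  have p0: "p \<noteq> 0"
  proof
    assume p: "p = 0"
    define c where "c = (\<lambda>w. if w = t0 then x else if w = t1 then y else z)"
    have "(\<Sum>w\<in>T. c w *s w) = 0" using p t by (simp add: p_def c_def add.assoc)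
    then have "c w = 0" if "w \<in> T" for w using vec.independentD[OF T(2), of T c w] that T by (auto simp: t)
    from this[of t0] this[of t1] this[of t2] show False using t xyz(1) by (simp add: c_def)
  qed
  obtain w where w: "w \<in> S" "B w p \<noteq> 0" using nd[OF pS Qp] p0 B by auto
  define w' where "w' = (1 / B w p) *s w"
  have "B (k *s w) p = k * B w p" for k by (simp add: B_def algebra_simps)
  then have w': "w' \<in> S" "B w' p = 1"
    using w sS(1) by (simp_all add: w'_def vec.subspace_scale)
  define r where "r = w' - quad_form A w' *s p"
  have rS: "r \<in> S" unfolding r_def using w' pS sS(1) by (intro vec.subspace_diff vec.subspace_scale)
  have Qp': "bil A p p = 0" using Qp by (simp add: quad_form_bil)
  have Bw: "bil A w' p + bil A p w' = 1" using w'(2) by (simp add: B_def)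
  have Brp: "B r p = 1" using Bw Qp' by (simp add: r_def B_def)
  have Qr: "quad_form A r = 0"
  proof -
    have "quad_form A r = bil A w' w' - bil A w' w' * (bil A w' p + bil A p w')"
      by (simp add: r_def quad_form_bil Qp' algebra_simps)
    then show ?thesis by (simp add: Bw)
  qed
  then have Qr': "bil A r r = 0" by (simp add: quad_form_bil)
  have "\<not> S \<subseteq> vec.span {p, r}"
  proof
    assume "S \<subseteq> vec.span {p, r}"
    then have "vec.dim S \<le> card {p, r}" by (intro vec.dim_le_card) auto
    then show False using sS(2) card_insert_le_m1[of 2 "{r}" p] by simp
  qed
  then obtain u where u: "u \<in> S" "u \<notin> vec.span {p, r}" by blast
  define e where "e = u - B u r *s p - B u p *s r"
  have eS: "e \<in> S" unfolding e_def using u pS rS sS(1) by (intro vec.subspace_diff vec.subspace_scale)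
  have Brp': "bil A r p + bil A p r = 1" using Brp by (simp add: B_def)
  have Bep: "bil A e p + bil A p e = 0"
  proof -
    have "bil A e p + bil A p e = B u p - B u p * (bil A r p + bil A p r)"
      by (simp add: e_def Qp' B_def algebra_simps)
    then show ?thesis by (simp add: Brp')
  qed
  have Ber: "bil A e r + bil A r e = 0"
  proof -
    have "bil A e r + bil A r e = B u r - B u r * (bil A r p + bil A p r)"
      by (simp add: e_def Qr' B_def algebra_simps)
    then show ?thesis by (simp add: Brp')
  qed
  have e_notin: "e \<notin> vec.span {p, r}"
  proof
    assume e: "e \<in> vec.span {p, r}"
    have "e + B u r *s p + B u p *s r \<in> vec.span {p, r}"
      by (intro vec.span_add vec.span_scale e) (auto intro: vec.span_base)
    moreover have "e + B u r *s p + B u p *s r = u" by (simp add: e_def)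
    ultimately show False using u(2) by simp
  qed
  have r0: "r \<noteq> 0" using Brp by (auto simp: B_def)
  have "p \<notin> vec.span {r}"
  proof
    assume "p \<in> vec.span {r}"
    then obtain k where "p = k *s r" by (auto simp: vec.span_singleton)
    then have "B r p = 0" by (simp add: B_def Qr')
    then show False using Brp by simp
  qed
  then have dim: "vec.dim {e, p, r} = 3" using e_notin r0 by (simp add: vec.dim_insert)
  have span: "vec.span {e, p, r} = S"
    by (rule vec.subspace_dim_equal) (use dim sS eS pS rS vec.span_minimal[of "{e, p, r}" S] in auto)
  define c where "c = quad_form A e"
  have Q: "quad_form A (k *s p + l *s e + m *s r) = l ^ 2 * c + k * m" for k l m
  proof -
    have "quad_form A (k *s p + l *s e + m *s r) = l ^ 2 * c + k * m * (bil A r p + bil A p r) +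
      k * l * (bil A e p + bil A p e) + l * m * (bil A e r + bil A r e)"
      by (simp add: quad_form_bil c_def Qp' Qr' power2_eq_square algebra_simps)
    then show ?thesis by (simp add: Brp' Bep Ber)
  qed
  have c0: "c \<noteq> 0"
  proof
    assume c: "c = 0"
    have Be: "B x e = 0" if "x \<in> S" for x
    proof -
      have "x \<in> vec.span {e, p, r}" using that span by simp
      then obtain k l m where "x - k *s e - l *s p = m *s r"
        by (auto simp: vec.span_insert vec.span_singleton)
      then have x: "x = k *s e + l *s p + m *s r" by (simp add: algebra_simps)
      have "B x e = 2 * k * c + l * (bil A e p + bil A p e) + m * (bil A e r + bil A r e)"
        by (simp add: x B_def c_def quad_form_bil algebra_simps)
      then show ?thesis by (simp add: Bep Ber c)
    qed
    have "e = 0" by (rule nd[OF eS c[unfolded c_def]]) (simp only: B Be)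
    then show False using e_notin vec.span_zero[of "{p, r}"] by simp
  qed
  define b where "b = (\<lambda>i :: nat. if i = 0 then p else if i = 1 then e else (- c) *s r)"
  have b: "b ` {..2} = {p, e, (- c) *s r}" by (auto simp: b_def eval_nat_numeral atMost_Suc)
  have sp: "vec.span {p, e, (- c) *s r} = S"
  proof -
    have "r = (- 1 / c) *s ((- c) *s r)" using c0 by simp
    then have "r \<in> vec.span {p, e, (- c) *s r}" by (metis insertCI vec.span_base vec.span_scale)
    then have "{e, p, r} \<subseteq> vec.span {p, e, (- c) *s r}" by (auto intro: vec.span_base)
    then have "S \<subseteq> vec.span {p, e, (- c) *s r}" unfolding span[symmetric] by (rule vec.span_minimal) simp
    moreover have "{p, e, (- c) *s r} \<subseteq> S" using pS eS rS sS(1) by (auto intro: vec.subspace_scale vec.subspace_neg)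
    then have "vec.span {p, e, (- c) *s r} \<subseteq> S" using sS(1) by (rule vec.span_minimal)
    ultimately show ?thesis by blast
  qed
  have "3 \<le> card {p, e, (- c) *s r}"
    using vec.dim_le_card[of S "{p, e, (- c) *s r}"] sp sS(2) by simp
  then have c3: "card {p, e, (- c) *s r} = 3"
    using card_insert_le_m1[of 3 "{e, (- c) *s r}" p] card_insert_le_m1[of 2 "{(- c) *s r}" e] by simp
  have "vec.independent {p, e, (- c) *s r}"
    by (rule vec.card_le_dim_spanning[of _ S]) (use sp c3 sS vec.span_superset[of "{p, e, (- c) *s r}"] in auto)
  moreover have "card (b ` {..2}) = card {..2 :: nat}" unfolding b c3 by simp
  then have "inj_on b {..2}" by (intro eq_card_imp_inj_on) simp_all
  ultimately have pb: "pg_basis 2 b S" unfolding pg_basis_def b sp by blast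
  have "quad_form A (k *s b 0 + l *s b 1 + m *s b 2) = c * (l ^ 2 - k * m)" for k l m
    using Q[of k l "m * (- c)"] by (simp add: b_def algebra_simps)
  then have "D = nrc_points 2 b" unfolding D by (rule conic_zero_set[OF pb sS(1) _ c0])
  then show ?thesis unfolding nrc_def using S pb by blast
qed

section \<open>The ruled quintic surface\<close>

lemma ruled_quintic_surface_scroll:
  fixes V C G :: "('a::{field,finite} ^ 7) set set"
  assumes V: "ruled_quintic_surface V C G" and q: "CARD('a) \<ge> 7"
  obtains A B where "scroll A B" "V = scroll.surf A B" "C = scroll.conic A" "G = scroll.gens A B"
proof -
  obtain \<alpha> \<beta> a b and M :: "'a ^ 2 ^ 2" where h: "pg_space 2 \<alpha>" "pg_space 3 \<beta>"
    "pg_points \<alpha> \<inter> pg_points \<beta> = {}" "pg_basis 2 a \<alpha>" "pg_basis 3 b \<beta>" "invertible M" "C = nrc_points 2 a"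
    "G = {pg_join (nrc_point 2 a v) (nrc_point 3 b (M *v v)) | v. v \<noteq> 0}" "V = (\<Union>l\<in>G. pg_points l)"
    using V unfolding ruled_quintic_surface_def by blast
  define A where "A = (\<lambda>v :: 'a ^ 2. \<Sum>i\<le>2. (v $ 1 ^ (2 - i) * v $ 2 ^ i) *s a i)"
  define B0 where "B0 = (\<lambda>v :: 'a ^ 2. \<Sum>i\<le>3. (v $ 1 ^ (3 - i) * v $ 2 ^ i) *s b i)"
  define B where "B = (\<lambda>v. B0 (M *v v))"
  have vA: "vform 2 A" and vB0: "vform 3 B0" unfolding A_def B0_def by (rule vform_sum)+
  have lin: "bform (Suc 0) (\<lambda>v. (M *v v) $ i)" for i
    by (simp add: matrix_vector_mult_def sum_2 bform_linear)
  have vB: "vform 3 B" unfolding vform_def B_def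
    using vB0 lin by (auto simp: vform_def intro: bform_subst)
  have sub: "S \<subseteq> hplane u" if np: "nrc_par r n S" "r \<le> 5" and z: "\<And>v. dotp u (n v) = 0" for r n S and u :: "'a ^ 7"
  proof -
    have "r + 1 \<le> card (proj_line :: ('a ^ 2) set)" using np(2) q by (simp add: card_proj_line)
    then obtain K :: "('a ^ 2) set" where K: "K \<subseteq> proj_line" "card K = r + 1" by (rule obtain_subset_with_card_n)
    have "n ` K \<subseteq> hplane u" using z by (auto simp: hplane_def)
    then show ?thesis by (rule nrc_par_span[OF np(1) K _ subspace_hplane])
  qed
  have sc: "scroll A B"
  proof
    fix u :: "'a ^ 7" assume uA: "\<And>v. dotp u (A v) = 0" and uB: "\<And>v. dotp u (B v) = 0"
    have uB0: "dotp u (B0 v) = 0" for v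
    proof -
      obtain M' where "M ** M' = mat 1" using h(6) by (auto simp: invertible_def)
      then have "M *v (M' *v v) = v" by (simp add: matrix_vector_mul_assoc)
      then show ?thesis using uB[of "M' *v v"] by (simp add: B_def)
    qed
    have "\<alpha> \<subseteq> hplane u" by (rule sub[OF nrc_par_basis[OF h(1,4) A_def]]) (simp_all add: uA)
    moreover have "\<beta> \<subseteq> hplane u" by (rule sub[OF nrc_par_basis[OF h(2,5) B0_def]]) (simp_all add: uB0)
    ultimately have "{x + y | x y. x \<in> \<alpha> \<and> y \<in> \<beta>} \<subseteq> hplane u"
      by (auto intro!: vec.subspace_add[OF subspace_hplane])
    then have le: "vec.dim {x + y | x y. x \<in> \<alpha> \<and> y \<in> \<beta>} \<le> vec.dim (hplane u)" by (rule vec.dim_subset)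
    have s: "vec.subspace \<alpha>" "vec.subspace \<beta>" "vec.dim \<alpha> = 3" "vec.dim \<beta> = 4" using h by (auto simp: pg_space_def)
    have "\<alpha> \<inter> \<beta> \<subseteq> {0}"
    proof
      fix x assume x: "x \<in> \<alpha> \<inter> \<beta>"
      show "x \<in> {0}"
      proof (rule ccontr)
        assume "x \<notin> {0}"
        then have "vec.span {x} \<in> pg_points \<alpha> \<inter> pg_points \<beta>"
          using x span_in_pg_points[OF s(1)] span_in_pg_points[OF s(2)] by auto
        then show False using h(3) by blast
      qed
    qed
    then have "vec.dim (\<alpha> \<inter> \<beta>) = 0" by simp
    then have "vec.dim {x + y | x y. x \<in> \<alpha> \<and> y \<in> \<beta>} = 7" using vec.dim_sums_Int[OF s(1,2)] s(3,4) by linarith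
    then show "u = 0" using le dim_hplane[of u] by (cases "u = 0") auto
  qed (use vA vB q in auto)
  interpret scroll A B by (rule sc)
  have C: "C = conic"
    unfolding h(7) conic_def by (rule nrc_points_vform) (simp add: A_def)
  have join: "pg_join (nrc_point 2 a v) (nrc_point 3 b (M *v v)) = gen v" for v
  proof -
    have "pg_join (nrc_point 2 a v) (nrc_point 3 b (M *v v)) = vec.span (vec.span {A v} \<union> vec.span {B v})"
      by (simp add: pg_join_def nrc_point_def A_def B_def B0_def)
    also have "\<dots> = vec.span ({A v} \<union> {B v})"
    proof (intro equalityI vec.span_minimal vec.span_mono)
      show "vec.span {A v} \<union> vec.span {B v} \<subseteq> vec.span ({A v} \<union> {B v})"
        by (intro Un_least vec.span_mono) auto
    qed (auto intro: vec.span_base)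
    finally show ?thesis by (simp add: gen_def insert_commute)
  qed
  have gen_scale: "gen (k *s w) = gen w" if "k \<noteq> 0" for k w
  proof -
    have e: "A (k *s w) = k ^ 2 *s A w" "B (k *s w) = k ^ 3 *s B w"
      using vform_homogeneous[OF vA] vform_homogeneous[OF vB] by auto
    show ?thesis
    proof (intro equalityI subsetI)
      fix x assume "x \<in> gen (k *s w)"
      then show "x \<in> gen w" unfolding mem_gen e vec.scale_scale by blast
    next
      fix x assume "x \<in> gen w"
      then obtain s t where "x = s *s A w + t *s B w" using mem_gen by blast
      then have "x = (s / k ^ 2) *s (k ^ 2 *s A w) + (t / k ^ 3) *s (k ^ 3 *s B w)" using that by simp
      then show "x \<in> gen (k *s w)" unfolding mem_gen e by blast
    qed
  qed
  have G: "G = gens"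
    unfolding h(8) join gens_def
  proof (intro equalityI subsetI)
    fix l assume "l \<in> {gen v | v. v \<noteq> 0}"
    then obtain v where v: "v \<noteq> 0" "l = gen v" by blast
    obtain k w where "w \<in> proj_line" "k \<noteq> 0" "v = k *s w" by (rule proj_line_rep[OF v(1)])
    then show "l \<in> gen ` proj_line" using v gen_scale by blast
  qed (use proj_line_nonzero in blast)
  show ?thesis by (rule that[OF sc _ C G]) (simp add: h(9) G surf_def)
qed

theorem theorem4p8:
  fixes V C G :: "('a::{field,finite} ^ 7) set set" and q :: real
  assumes "q = real CARD('a)" and "q \<ge> 6"
    and "ruled_quintic_surface V C G"
  shows
    "(real (card {l. pg_space 1 l \<and> pg_points l \<subseteq> V}) = q + 1 \<and>
      real (card {D. nondegenerate_conic D \<and> D \<subseteq> V}) = 1 \<and>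
      real (card {N. twisted_cubic N \<and> N \<subseteq> V}) = q ^ 2 \<and>
      real (card {N. nrc 4 N \<and> N \<subseteq> V}) = q ^ 4 - q ^ 2 \<and>
      real (card {N. nrc 5 N \<and> N \<subseteq> V}) = q ^ 6 - q ^ 4) \<and>
     (\<forall>H. pg_space 5 H \<longrightarrow>
        (\<exists>!(r, k). (r, k) \<in> {(5,0), (4,1), (3,0), (3,1), (3,2), (2,0), (2,1), (2,2), (2,3)} \<and>
                  section_type V C G r k H)) \<and>
     real (card {H. pg_space 5 H \<and> section_type V C G 5 0 H}) = q ^ 6 - q ^ 4 \<and>
     real (card {H. pg_space 5 H \<and> section_type V C G 4 1 H}) = q ^ 5 + q ^ 4 - q ^ 3 - q ^ 2 \<and>
     real (card {H. pg_space 5 H \<and> section_type V C G 3 0 H}) = (q ^ 4 - q ^ 3) / 2 \<and>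
     real (card {H. pg_space 5 H \<and> section_type V C G 3 1 H}) = q ^ 3 + q ^ 2 \<and>
     real (card {H. pg_space 5 H \<and> section_type V C G 3 2 H}) = (q ^ 4 + q ^ 3) / 2 \<and>
     real (card {H. pg_space 5 H \<and> section_type V C G 2 0 H}) = (q ^ 3 - q) / 3 \<and>
     real (card {H. pg_space 5 H \<and> section_type V C G 2 1 H}) = q ^ 3 / 2 + q / 2 + 1 \<and>
     real (card {H. pg_space 5 H \<and> section_type V C G 2 2 H}) = q ^ 2 + q \<and>
     real (card {H. pg_space 5 H \<and> section_type V C G 2 3 H}) = (q ^ 3 - q) / 6"
proof -
  have q7: "CARD('a) \<ge> 7" using assms(1,2) CARD_field_neq_6[where 'a='a] by simp
  obtain A B where sc: "scroll A B" "V = scroll.surf A B" "C = scroll.conic A" "G = scroll.gens A B"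
    by (rule ruled_quintic_surface_scroll[OF assms(3) q7])
  interpret scroll A B by (rule sc(1))
  have lines: "real (card {l. pg_space 1 l \<and> pg_points l \<subseteq> surf}) = q + 1"
    unfolding lines_in_surf card_gens by (simp add: assms(1))
  have "{D. nondegenerate_conic D \<and> D \<subseteq> surf} = {conic}"
  proof (intro equalityI subsetI)
    fix D assume "D \<in> {D. nondegenerate_conic D \<and> D \<subseteq> surf}"
    then show "D \<in> {conic}" using nondegenerate_conic_imp_nrc nrc_2_in_surf by blast
  next
    fix D assume "D \<in> {conic}"
    then show "D \<in> {D. nondegenerate_conic D \<and> D \<subseteq> surf}"
      using nrc_imp_nondegenerate_conic[OF nrc_conic] curve_subset_surf[of "\<lambda>_. 0" "\<lambda>_. 1"] curve_conic by simp
  qed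
  then have conics: "real (card {D. nondegenerate_conic D \<and> D \<subseteq> surf}) = 1" by simp
  have cubics: "real (card {N. nrc 3 N \<and> N \<subseteq> surf}) = q ^ 2"
    unfolding card_cubics by (simp add: assms(1))
  have quartics: "real (card {N. nrc 4 N \<and> N \<subseteq> surf}) = q ^ 4 - q ^ 2"
  proof -
    have "CARD('a) ^ 2 \<le> CARD('a) ^ 3" by (intro power_increasing) auto
    then have "real (CARD('a) ^ 3 - CARD('a) ^ 2) = q ^ 3 - q ^ 2" by (simp add: of_nat_diff assms(1))
    then show ?thesis unfolding card_quartics of_nat_mult
      by (simp add: power_numeral_reduce algebra_simps flip: assms(1))
  qed
  note counts = hyperplane_counts[OF assms(1)]
  have quintics: "real (card {N. nrc 5 N \<and> N \<subseteq> surf}) = q ^ 6 - q ^ 4"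
    unfolding card_quintics by (rule counts(1))
  have ex1: "\<forall>H. pg_space 5 H \<longrightarrow>
    (\<exists>!(r, k). (r, k) \<in> {(5,0), (4,1), (3,0), (3,1), (3,2), (2,0), (2,1), (2,2), (2,3)} \<and>
      section_type surf conic gens r k H)"
    using ex1_section_type by blast
  show ?thesis
    unfolding sc(2-4) by (intro conjI lines conics cubics quartics quintics ex1 counts)
qed

end
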